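(* Let $a_n$ be the number of permutations of $[n]$ that strongly avoid the pattern $132$ (with $a_0=1$), and let $\mathrm{Sav}_{132}(x)=\sum_{n\ge 0}a_nx^n$. Then, as formal power series, $$\mathrm{Sav}_{132}(x)=\frac{c\bigl(x^3c(x^3)\bigr)}{2-(1+x)\,c\bigl(x^3c(x^3)\bigr)}\left(\frac{1-x}{1-x-x^2c(x^2)}+\frac{2x(1+2x)\bigl(c(x^3)-1\bigr)}{1-x^2}\right),$$ where $c(x)=\sum_{n\ge0}\frac{1}{n+1}\binom{2n}{n}x^n$ is the generating function for the Catalan numbers.
   Context: A permutation $\pi=\pi_1\pi_2\cdots\pi_n$ of $[n]=\{1,\dots,n\}$ (one-line notation, $\pi_i=\pi(i)$) avoids $132$ if there are no indices $i<j<k$ with $\pi_i<\pi_k<\pi_j$. The permutation $\pi$ strongly avoids $132$ if both $\pi$ and $\pi^2=\pi\circ\pi$ avoid $132$. *)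

theory Defs
  imports
    "HOL-Combinatorics.Permutations"
    "HOL-Computational_Algebra.Formal_Power_Series"
begin

text \<open>
  A permutation of \<open>[n] = {1, \<dots>, n}\<close> is a function \<open>p :: nat \<Rightarrow> nat\<close> with
  \<open>p permutes {1..n}\<close>, so it is the identity outside \<open>[n]\<close> and distinct
  permutations of \<open>[n]\<close> are distinct functions.
\<close>

definition avoids_132 :: "nat \<Rightarrow> (nat \<Rightarrow> nat) \<Rightarrow> bool" where
  "avoids_132 n p \<longleftrightarrow>
     \<not> (\<exists>i\<in>{1..n}. \<exists>j\<in>{1..n}. \<exists>k\<in>{1..n}. i < j \<and> j < k \<and> p i < p k \<and> p k < p j)"

definition strongly_avoids_132 :: "nat \<Rightarrow> (nat \<Rightarrow> nat) \<Rightarrow> bool" where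
  "strongly_avoids_132 n p \<longleftrightarrow> avoids_132 n p \<and> avoids_132 n (p \<circ> p)"

definition num_strongly_avoiding_132 :: "nat \<Rightarrow> nat" where
  "num_strongly_avoiding_132 n = card {p. p permutes {1..n} \<and> strongly_avoids_132 n p}"

definition Sav_132 :: "rat fps" where
  "Sav_132 = Abs_fps (\<lambda>n. of_nat (num_strongly_avoiding_132 n))"

definition catalan_fps :: "rat fps" where
  "catalan_fps = Abs_fps (\<lambda>n. 1 / of_nat (n + 1) * of_nat ((2 * n) choose n))"

end

theory Submission
  imports Defs
begin

text \<open>
  Let \<open>i \<mapsto> n \<mapsto> j\<close> be the orbit of the maximum under a strongly 132-avoiding permutation \<open>p\<close> of \<open>[n]\<close>.
  If \<open>i = j = n\<close>, the point \<open>n\<close> can be removed. If \<open>i = j < n\<close>, then \<open>p \<circ> p\<close> fixes \<open>n\<close>, and this forces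
  \<open>p\<close> to be an involution. Inversion exchanges the cases \<open>i < j\<close> and \<open>i > j\<close>. If \<open>i < j\<close>, then either
  \<open>p\<close> is a rotation of \<open>[n]\<close> by \<open>k = n - j\<close> twisted by a 132-avoider \<open>\<alpha>\<close> and its inverse, or \<open>p\<close> cubed
  is the identity on \<open>{1..i}\<close>, and the 3-cycles through \<open>{1..i}\<close> form a shell around a smaller strongly
  132-avoiding permutation. Shells are inserted at cuts, and the number of cuts obeys the succession
  rule of the Catalan generating tree; this produces the series \<open>c (x^3 * c (x^3))\<close>, where the inner
  \<open>x^3 * c (x^3)\<close> counts the skew-indecomposable 132-avoiders that shape the shells.
\<close>

section \<open>Permutations avoiding 132\<close>

text \<open>Strong avoidance supplies two 132-avoiders, \<open>p\<close> and
  \<open>p \<circ> p\<close>, and each is cut into blocks both by its last value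
  (\<open>Av_last\<close>) and by the position of its maximum (\<open>Av_max\<close>). For
  \<open>p\<close> these data are \<open>j\<close> and \<open>i\<close>; for
  \<open>p \<circ> p\<close> they are \<open>p j\<close> and the preimage \<open>i2\<close> of
  \<open>i\<close>. Within the case \<open>i < j\<close> everything hinges on comparing
  \<open>i2\<close> with \<open>j\<close>: equality closes the orbit of \<open>n\<close> to a
  three-cycle, and the two strict orders give the twisted rotations with \<open>3 * k < n\<close>
  and with \<open>n < 3 * k\<close>. A twisted rotation with \<open>n = 3 * k\<close> is a shell
  around the empty permutation, so it is counted among the shells. The obstacle in counting shells
  is that the number of ways to add one depends on the permutation and not only on its size. Hence
  the second parameter, the number of cuts, which turns the count into a second-order recurrence in
  that parameter.\<close>

definition Av :: "nat \<Rightarrow> (nat \<Rightarrow> nat) set" where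
  "Av n = {p. p permutes {1..n} \<and> avoids_132 n p}"

definition SAv :: "nat \<Rightarrow> (nat \<Rightarrow> nat) set" where
  "SAv n = {p. p permutes {1..n} \<and> strongly_avoids_132 n p}"

lemma permutes_eq_iff: "p permutes S \<Longrightarrow> p x = p y \<longleftrightarrow> x = y"
  by (meson injD permutes_inj)

lemma permutes_interval:
  assumes "p permutes {1..n}"
  shows "1 \<le> p x \<longleftrightarrow> 1 \<le> x" and "p x \<le> n \<longleftrightarrow> x \<le> n"
proof -
  have *: "p x \<in> {1..n} \<longleftrightarrow> x \<in> {1..n}"
    by (rule permutes_in_image[OF assms])
  have out: "x \<notin> {1..n} \<Longrightarrow> p x = x"
    by (rule permutes_not_in[OF assms])
  show "1 \<le> p x \<longleftrightarrow> 1 \<le> x" using * out by (cases "x \<in> {1..n}") auto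
  show "p x \<le> n \<longleftrightarrow> x \<le> n" using * out by (cases "x \<in> {1..n}") auto
qed

lemma Av_permutes: "p \<in> Av n \<Longrightarrow> p permutes {1..n}"
  by (simp add: Av_def)

lemma Av_mono:
  assumes "p \<in> Av n" "1 \<le> a" "a < b" "b < c" "c \<le> n" "p a < p c"
  shows "p b < p c"
proof -
  have "avoids_132 n p" using assms(1) by (simp add: Av_def)
  hence "\<not> p c < p b"
    using assms(2-) unfolding avoids_132_def by (meson atLeastAtMost_iff le_trans less_imp_le)
  moreover have "p b \<noteq> p c"
    using permutes_eq_iff[OF Av_permutes[OF assms(1)]] assms by auto
  ultimately show ?thesis by simp
qed

lemma AvI:
  assumes "p permutes {1..n}"
    and "\<And>a b c. \<lbrakk>1 \<le> a; a < b; b < c; c \<le> n; p a < p c; p c < p b\<rbrakk> \<Longrightarrow> False"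
  shows "p \<in> Av n"
  using assms unfolding Av_def avoids_132_def by auto

lemma SAv_iff: "p \<in> SAv n \<longleftrightarrow> p \<in> Av n \<and> p \<circ> p \<in> Av n"
  by (auto simp: SAv_def Av_def strongly_avoids_132_def permutes_compose)

lemma id_in_Av: "id \<in> Av n"
  by (rule AvI) (auto simp: permutes_id)

text \<open>The pattern 132 is its own inverse: positions \<open>inv p a < inv p c < inv p b\<close>
  carry the values \<open>a\<close>, \<open>c\<close>, \<open>b\<close>.\<close>

lemma inv_in_Av:
  assumes "p \<in> Av n"
  shows "inv p \<in> Av n"
proof (rule AvI)
  note p = Av_permutes[OF assms]
  note pinv = permutes_inverses[OF p]
  show ip: "inv p permutes {1..n}" by (rule permutes_inv[OF p])
  fix a b c assume *: "1 \<le> a" "a < b" "b < c" "c \<le> n" "inv p a < inv p c" "inv p c < inv p b"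
  have "1 \<le> inv p a" "inv p b \<le> n" using permutes_interval[OF ip] * by auto
  from Av_mono[OF assms this(1) *(5,6) this(2)] * show False by (simp add: pinv)
qed

lemma inv_in_SAv: "p \<in> SAv n \<Longrightarrow> inv p \<in> SAv n"
  using inv_in_Av[of p n] inv_in_Av[of "p \<circ> p" n] permutes_bij[OF Av_permutes[of p n]]
  by (auto simp: SAv_iff o_inv_distrib)

lemma finite_Av: "finite (Av n)"
  by (rule finite_subset[OF _ finite_permutations[of "{1..n}"]]) (auto simp: Av_def)

lemma finite_SAv: "finite (SAv n)"
  by (rule finite_subset[OF _ finite_permutations[of "{1..n}"]]) (auto simp: SAv_def)

text \<open>Pattern avoidance typically shows only that a set of positions is closed downwards; a
  cardinality count then determines it completely.\<close>

lemma down_closed_nat: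
  assumes "U \<subseteq> {1..n::nat}" and down: "\<And>x y. \<lbrakk>y \<in> U; 1 \<le> x; x < y\<rbrakk> \<Longrightarrow> x \<in> U"
  shows "U = {1..card U}"
proof (cases "U = {}")
  case False
  have fin: "finite U" using assms(1) finite_subset by blast
  hence M: "Max U \<in> U" using False Max_in by blast
  have "U = {1..Max U}"
  proof
    show "U \<subseteq> {1..Max U}" using fin assms(1) by auto
    show "{1..Max U} \<subseteq> U" using down[OF M] M by (auto simp: le_less)
  qed
  thus ?thesis by (metis card_atLeastAtMost diff_Suc_1)
qed auto

lemma card_preimage_permutes:
  assumes "p permutes {1..n}" "B \<subseteq> {1..n}"
  shows "card {x \<in> {1..n}. p x \<in> B} = card B"
proof -
  note p_inverses = permutes_inverses[OF assms(1)]
  have "p ` {x \<in> {1..n}. p x \<in> B} = B"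
  proof (intro equalityI subsetI)
    fix y assume y: "y \<in> B"
    hence "inv p y \<in> {x \<in> {1..n}. p x \<in> B}"
      using p_inverses(1)[of y] permutes_in_image[OF permutes_inv[OF assms(1)], of y] assms(2) by auto
    thus "y \<in> p ` {x \<in> {1..n}. p x \<in> B}" using p_inverses(1) by (metis imageI)
  qed auto
  thus ?thesis
    using card_image[of p "{x \<in> {1..n}. p x \<in> B}"] inj_on_subset[OF permutes_inj[OF assms(1)]]
    by auto
qed

text \<open>If \<open>y\<close> carries a value above \<open>p n\<close> and some
  \<open>x < y\<close> a value below it, then \<open>x\<close>, \<open>y\<close>, \<open>n\<close>
  form a 132. So the positions of values above \<open>p n\<close> form an initial segment, and
  counting those values gives its length.\<close>

lemma Av_last:
  assumes "p \<in> Av n" "1 \<le> x" "x \<le> n"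
  shows "p n < p x \<longleftrightarrow> x \<le> n - p n"
proof -
  note p = Av_permutes[OF assms(1)]
  define U where "U = {x \<in> {1..n}. p n < p x}"
  have U: "U = {1..card U}"
  proof (rule down_closed_nat[of _ n])
    fix x y assume y: "y \<in> U" and x: "1 \<le> x" "x < y"
    have "y < n" using y by (auto simp: U_def le_less)
    moreover have "p x \<noteq> p n" using permutes_eq_iff[OF p] x \<open>y < n\<close> by auto
    ultimately show "x \<in> U"
      using Av_mono[OF assms(1) x(1,2) \<open>y < n\<close>] y x by (force simp: U_def)
  qed (auto simp: U_def)
  have "card U = card {x \<in> {1..n}. p x \<in> {p n<..n}}"
    using permutes_interval(2)[OF p] by (intro arg_cong[of _ _ card]) (auto simp: U_def)
  also have "\<dots> = card {p n<..n}" by (rule card_preimage_permutes[OF p]) auto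
  finally have "card U = n - p n" by simp
  hence "x \<in> U \<longleftrightarrow> x \<le> n - p n" using U assms(2) by (metis atLeastAtMost_iff)
  thus ?thesis using assms by (simp add: U_def)
qed

text \<open>This is \<open>Av_last\<close> for the inverse permutation, whose last value is
  \<open>i\<close>.\<close>

lemma Av_max:
  assumes "p \<in> Av n" "p i = n" "1 \<le> x" "x \<le> n"
  shows "n - i < p x \<longleftrightarrow> x \<le> i"
proof -
  note p = Av_permutes[OF assms(1)]
  have "inv p n = i" using assms(2) permutes_inverses(2)[OF p] by metis
  moreover have "1 \<le> p x" "p x \<le> n" using permutes_interval[OF p] assms by auto
  ultimately have "i < x \<longleftrightarrow> p x \<le> n - i"
    using Av_last[OF inv_in_Av[OF assms(1)], of "p x"] permutes_inverses(2)[OF p] by simp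
  thus ?thesis by linarith
qed

text \<open>Strict growth between two windows of equal length leaves no slack. Each use turns
  monotonicity forced by 132-avoidance, together with bounds on the values, into an explicit
  formula. The additive form of the conclusion avoids truncated subtraction.\<close>

lemma strict_mono_on_interval_shift:
  fixes f :: "nat \<Rightarrow> nat"
  assumes mono: "\<And>x y. \<lbrakk>a \<le> x; x < a + l; x < y; y < a + l\<rbrakk> \<Longrightarrow> f x < f y"
    and range: "\<And>x. \<lbrakk>a \<le> x; x < a + l\<rbrakk> \<Longrightarrow> b \<le> f x \<and> f x < b + l"
    and x: "a \<le> x" "x < a + l"
  shows "f x + a = x + b"
proof -
  have lower: "d < l \<Longrightarrow> b + d \<le> f (a + d)" for d
  proof (induction d)
    case 0 thus ?case using range[of a] by simp
  next
    case (Suc d) thus ?case using mono[of "a + d" "a + Suc d"] by simp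
  qed
  have upper: "d < l \<Longrightarrow> f (a + (l - Suc d)) + Suc d \<le> b + l" for d
  proof (induction d)
    case 0 thus ?case using range[of "a + l - 1"] by (simp add: Suc_le_eq)
  next
    case (Suc d)
    have "f (a + (l - Suc (Suc d))) < f (a + (l - Suc d))" by (rule mono) (use Suc in auto)
    thus ?case using Suc by simp
  qed
  have "b + (x - a) \<le> f x" using lower[of "x - a"] x by simp
  moreover have "f x + Suc (a + l - Suc x) \<le> b + l"
    using upper[of "a + l - Suc x"] x by (simp add: Suc_diff_Suc)
  ultimately show ?thesis using x by linarith
qed

lemma Av_fix_last:
  assumes "1 \<le> n"
  shows "{p \<in> Av n. p n = n} = Av (n - 1)"
proof (intro equalityI subsetI)
  have ins: "{1..n} = insert n {1..n - 1}" using assms by auto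
  fix p assume "p \<in> {p \<in> Av n. p n = n}"
  hence p: "p \<in> Av n" "p n = n" by auto
  show "p \<in> Av (n - 1)"
  proof (rule AvI)
    show "p permutes {1..n - 1}"
      by (rule permutes_superset[OF Av_permutes[OF p(1)]]) (use p ins in auto)
    fix a b c assume *: "1 \<le> a" "a < b" "b < c" "c \<le> n - 1" "p a < p c" "p c < p b"
    have "c \<le> n" using * by simp
    thus False using Av_mono[OF p(1), of a b c] * by auto
  qed
next
  fix p assume p: "p \<in> Av (n - 1)"
  note perm = Av_permutes[OF p]
  have n: "p n = n" by (rule permutes_not_in[OF perm]) (use assms in auto)
  have "p \<in> Av n"
  proof (rule AvI)
    show "p permutes {1..n}" by (rule permutes_subset[OF perm]) auto
    fix a b c assume *: "1 \<le> a" "a < b" "b < c" "c \<le> n" "p a < p c" "p c < p b"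
    show False
    proof (cases "c = n")
      case True
      thus False using * permutes_interval(2)[OF perm, of b] n by auto
    next
      case False
      hence "c \<le> n - 1" using * by simp
      thus False using Av_mono[OF p, of a b c] * by auto
    qed
  qed
  thus "p \<in> {p \<in> Av n. p n = n}" using n by simp
qed

lemma SAv_fix_last:
  assumes "1 \<le> n"
  shows "{p \<in> SAv n. p n = n} = SAv (n - 1)"
proof -
  have *: "p \<in> Av n \<and> p n = n \<longleftrightarrow> p \<in> Av (n - 1)" for p
    using Av_fix_last[OF assms] by blast
  have "p \<in> SAv n \<and> p n = n \<longleftrightarrow> p \<in> SAv (n - 1)" for p
    using *[of p] *[of "p \<circ> p"] unfolding SAv_iff by auto
  thus ?thesis by blast
qed

lemma Av_mono_subset: "m \<le> n \<Longrightarrow> Av m \<subseteq> Av n"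
proof (induction n rule: dec_induct)
  case (step n)
  have "Av n = {p \<in> Av (Suc n). p (Suc n) = Suc n}" using Av_fix_last[of "Suc n"] by simp
  thus ?case using step.IH by blast
qed simp

text \<open>The skew sum: the diagram of \<open>\<alpha>\<close>, of size \<open>a\<close>, stands
  to the left of and above that of \<open>\<beta>\<close>, of size \<open>b\<close>.\<close>

definition skew :: "nat \<Rightarrow> nat \<Rightarrow> (nat \<Rightarrow> nat) \<Rightarrow> (nat \<Rightarrow> nat) \<Rightarrow> nat \<Rightarrow> nat" where
  "skew a b \<alpha> \<beta> t =
     (if 1 \<le> t \<and> t \<le> a then b + \<alpha> t else if a < t \<and> t \<le> a + b then \<beta> (t - a) else t)"

text \<open>
  The cuts \<open>q\<close> of \<open>p\<close> are the heights at which a further shell of three-cycles can be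
  inserted below the top \<open>q\<close> points without losing strong avoidance; see \<open>shell_SAv_iff\<close>.
\<close>

definition cuts :: "nat \<Rightarrow> (nat \<Rightarrow> nat) \<Rightarrow> nat set" where
  "cuts n p = {q. q \<le> n \<and> (\<forall>x. 1 \<le> x \<longrightarrow> x \<le> n \<longrightarrow> (n - q < p x \<longleftrightarrow> x \<le> q)) \<and>
     (\<forall>x y. n - q < x \<longrightarrow> x < y \<longrightarrow> y \<le> n \<longrightarrow> p x < p y) \<and>
     (\<forall>x. n - q < x \<longrightarrow> x \<le> n \<longrightarrow> p x \<le> n - q \<and> p (p (p x)) = x)}"

text \<open>
  \<open>skew k (n - k) \<alpha> (inv \<alpha>)\<close> is the rotation of \<open>[n]\<close> by \<open>k\<close>, twisted by \<open>\<alpha>\<close> on its first block and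
  by \<open>inv \<alpha>\<close> on the second one. The two extreme sizes \<open>h = k\<close> and \<open>h = n - 2 * k\<close> of the support of
  \<open>\<alpha>\<close> are the only ones that occur.
\<close>

lemma rotation_form:
  assumes p: "p \<in> Av n" and k: "1 \<le> k" "2 * k < n" "p n = n - k"
    and E1: "\<And>t. \<lbrakk>1 \<le> t; t \<le> k\<rbrakk> \<Longrightarrow> p (p (k + t)) = n - k + t"
    and E2: "\<And>v. \<lbrakk>k + h < v; v \<le> n\<rbrakk> \<Longrightarrow> p v = v - k"
    and h: "h = min k (n - 2 * k)"
  shows "\<exists>\<alpha>\<in>Av h. p = skew k (n - k) \<alpha> (inv \<alpha>)"
proof -
  note perm = Av_permutes[OF p]
  define \<alpha> where "\<alpha> t = (if 1 \<le> t \<and> t \<le> k then p t - (n - k) else t)" for t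
  have last: "n - k < p x \<longleftrightarrow> x \<le> k" if "1 \<le> x" "x \<le> n" for x
    using Av_last[OF p that] k by simp
  have p_eq: "p t = n - k + \<alpha> t" if "1 \<le> t" "t \<le> k" for t
    using last[of t] that k by (simp add: \<alpha>_def)
  have \<alpha>_range: "1 \<le> \<alpha> t \<and> \<alpha> t \<le> k" if "1 \<le> t" "t \<le> k" for t
    using last[of t] that k permutes_interval(2)[OF perm, of t] by (auto simp: \<alpha>_def)
  have \<alpha>_perm: "\<alpha> permutes {1..k}"
  proof (rule inj_imp_permutes)
    show "inj_on \<alpha> {1..k}"
      by (rule inj_onI) (metis p_eq permutes_eq_iff[OF perm] atLeastAtMost_iff)
  qed (use \<alpha>_range in \<open>auto simp: \<alpha>_def\<close>)
  \<comment> \<open>Beyond \<open>h\<close> the map is the plain rotation by E2, so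
    \<open>k + t\<close> goes to \<open>t\<close>, and E1 then fixes the value at
    \<open>t\<close>.\<close>
  have E3: "\<alpha> t = t" if "h < t" "t \<le> k" for t
  proof -
    have "p (k + t) = t" using E2[of "k + t"] that k by simp
    thus ?thesis using E1[of t] that by (simp add: \<alpha>_def)
  qed
  have \<alpha>_Av: "\<alpha> \<in> Av h"
  proof (rule AvI)
    show "\<alpha> permutes {1..h}"
      by (rule permutes_superset[OF \<alpha>_perm]) (use E3 in auto)
    fix a b c assume *: "1 \<le> a" "a < b" "b < c" "c \<le> h" "\<alpha> a < \<alpha> c" "\<alpha> c < \<alpha> b"
    hence c: "c \<le> k" "c \<le> n" using h k by auto
    hence "p a < p c" using p_eq[of a] p_eq[of c] * by simp
    hence "p b < p c" using Av_mono[OF p, of a b c] * c by simp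
    thus False using p_eq[of b] p_eq[of c] * c by simp
  qed
  have inv: "p (k + t) = inv \<alpha> t" if t: "1 \<le> t" "k + t \<le> n" for t
  proof (cases "t \<le> k")
    case True
    let ?x = "p (k + t)"
    have px: "p ?x = n - k + t" by (rule E1[OF t(1) True])
    have x: "1 \<le> ?x" "?x \<le> n" using permutes_interval[OF perm] t by auto
    moreover have "n - k < p ?x" using px t k by linarith
    ultimately have "?x \<le> k" using last[of ?x] by simp
    hence "\<alpha> ?x = t" using p_eq[of ?x] x px by simp
    thus ?thesis using permutes_inverses(2)[OF \<alpha>_perm] by metis
  next
    case False
    hence "inv \<alpha> t = t" using permutes_not_in[OF permutes_inv[OF \<alpha>_perm], of t] by auto
    thus ?thesis using E2[of "k + t"] False t h by simp
  qed
  have "p t = skew k (n - k) \<alpha> (inv \<alpha>) t" for t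
    using p_eq[of t] inv[of "t - k"] permutes_not_in[OF perm, of t] k
    by (auto simp: skew_def)
  thus ?thesis using \<alpha>_Av by auto
qed

section \<open>The orbit of the maximum\<close>

locale rising_max =
  fixes n :: nat and p :: "nat \<Rightarrow> nat" and i j :: nat
  assumes SAv: "p \<in> SAv n" and p_i: "p i = n" and p_n: "p n = j" and i_less_j: "i < j"
begin

text \<open>\<open>i2\<close>, \<open>i\<close>, \<open>n\<close>, \<open>j\<close>,
  \<open>s\<close> are consecutive points on the orbit of \<open>n\<close>. Thus
  \<open>p \<circ> p\<close> takes its maximum at \<open>i2\<close> and has last value
  \<open>s\<close>, while \<open>k\<close> is the number of values above the last value of
  \<open>p\<close>.\<close>

definition k :: nat where "k = n - j"
definition i2 :: nat where "i2 = inv p i"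
definition s :: nat where "s = p j"

lemma Av: "p \<in> Av n" and Av2: "p \<circ> p \<in> Av n"
  using SAv by (auto simp: SAv_iff)

lemmas perm = Av_permutes[OF Av]
lemmas p_inverses = permutes_inverses[OF perm]
lemmas p_eq = permutes_eq_iff[OF perm]
lemmas p_ge = permutes_interval(1)[OF perm] and p_le = permutes_interval(2)[OF perm]

lemma n_pos: "1 \<le> n"
proof (rule ccontr)
  assume "\<not> 1 \<le> n"
  hence "p = id" using perm by simp
  thus False using p_i p_n i_less_j by simp
qed

lemma i_range: "1 \<le> i" "i < n" and j_range: "1 \<le> j" "j < n"
proof -
  show "1 \<le> i" using p_ge[of i] p_i n_pos by simp
  show "1 \<le> j" using p_ge[of n] p_n n_pos by simp
  have "j \<le> n" using p_le[of n] p_n by simp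
  moreover have "j \<noteq> n" using p_eq[of i n] p_i p_n i_less_j by auto
  ultimately show "j < n" by simp
  thus "i < n" using i_less_j by simp
qed

lemma k_pos: "1 \<le> k" and n_eq: "n = j + k"
  using j_range by (auto simp: k_def)

lemma p_i2: "p i2 = i" using p_inverses by (simp add: i2_def)

lemma i2_range: "1 \<le> i2" "i2 < n"
proof -
  show "1 \<le> i2" using p_ge[of i2] p_i2 i_range by simp
  have "i2 \<le> n" using p_le[of i2] p_i2 i_range by simp
  moreover have "i2 \<noteq> n" using p_i2 p_n i_less_j by auto
  ultimately show "i2 < n" by simp
qed

text \<open>This and the next three facts are the block decompositions of \<open>p\<close> and of
  \<open>p \<circ> p\<close> by last value and by position of the maximum; all later arguments about
  the orbit play them against each other.\<close>

lemma top_iff: "1 \<le> x \<Longrightarrow> x \<le> n \<Longrightarrow> j < p x \<longleftrightarrow> x \<le> k"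
  using Av_last[OF Av, of x] p_n by (simp add: k_def)

lemma top_i_iff: "1 \<le> x \<Longrightarrow> x \<le> n \<Longrightarrow> n - i < p x \<longleftrightarrow> x \<le> i"
  using Av_max[OF Av p_i] by simp

lemma top2_iff: "1 \<le> x \<Longrightarrow> x \<le> n \<Longrightarrow> s < p (p x) \<longleftrightarrow> x \<le> n - s"
  using Av_last[OF Av2, of x] p_n by (simp add: s_def)

lemma top2_i2_iff: "1 \<le> x \<Longrightarrow> x \<le> n \<Longrightarrow> n - i2 < p (p x) \<longleftrightarrow> x \<le> i2"
  using Av_max[OF Av2, of i2 x] p_i p_i2 by simp

lemma s_range: "1 \<le> s" "s \<le> n" "s \<noteq> n" "s \<noteq> j"
proof -
  show "1 \<le> s" "s \<le> n" using p_ge[of j] p_le[of j] j_range by (auto simp: s_def)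
  show "s \<noteq> n" using p_eq[of j i] p_i i_less_j by (auto simp: s_def)
  show "s \<noteq> j" using p_eq[of j n] p_n j_range by (auto simp: s_def)
qed

lemma i_le_k: "i \<le> k"
  using top_iff[of i] i_range j_range p_i by simp

text \<open>Otherwise \<open>j\<close> is among the first \<open>k\<close> positions, so
  \<open>s > j\<close>. As \<open>p \<circ> p\<close> sends \<open>i2\<close> to
  \<open>n > s\<close>, this puts \<open>i2\<close> within the first \<open>n - s < k\<close>
  positions, although its image \<open>i\<close> is too small for that.\<close>

lemma k_less_j: "k < j"
proof (rule ccontr)
  assume "\<not> k < j"
  hence "j < s" using top_iff[of j] j_range by (simp add: s_def)
  have "k < i2" using top_iff[of i2] i2_range p_i2 i_less_j by simp
  moreover have "i2 \<le> n - s"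
    using top2_iff[of i2] i2_range p_i p_i2 s_range by simp
  ultimately show False using \<open>j < s\<close> n_eq by simp
qed

lemma low_range:
  assumes "1 \<le> x" "x \<le> n" "p x \<le> k"
  shows "k < x" "x < n" "j < p (p x)"
proof -
  show "k < x" using top_iff[of x] assms k_less_j by linarith
  have "x \<noteq> n" using p_n assms k_less_j by auto
  thus "x < n" using assms by simp
  show "j < p (p x)" using top_iff[of "p x"] assms p_ge p_le by simp
qed

lemma k_less_i2: "k < i2"
  using low_range(1)[of i2] i2_range p_i2 i_le_k by simp

lemma image_top:
  assumes "j < y" "y \<le> n"
  obtains x where "1 \<le> x" "x \<le> k" "p x = y"
proof
  let ?x = "inv p y"
  show eq: "p ?x = y" using p_inverses by simp
  show "1 \<le> ?x" using p_ge[of ?x] eq assms by simp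
  moreover have "?x \<le> n" using p_le[of ?x] eq assms by simp
  ultimately show "?x \<le> k" using top_iff[of ?x] eq assms by simp
qed

lemma p_top_le: "j < y \<Longrightarrow> y \<le> n \<Longrightarrow> p y \<le> j"
  using top_iff[of y] k_less_j by linarith

text \<open>Every \<open>y\<close> above \<open>j\<close> is \<open>p x\<close> with
  \<open>x \<le> k < i2\<close>, so under \<open>p \<circ> p\<close> the position \<open>x\<close>
  lies before the maximum and \<open>v\<close> behind it.\<close>

lemma above_i2:
  assumes "i2 < v" "v \<le> n" "j < y" "y \<le> n"
  shows "p (p v) < p y"
proof -
  obtain x where x: "1 \<le> x" "x \<le> k" "p x = y" using image_top assms by blast
  have "n - i2 < p (p x)" using top2_i2_iff[of x] x k_less_i2 i2_range by simp
  moreover have "p (p v) \<le> n - i2" using top2_i2_iff[of v] assms by simp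
  ultimately show ?thesis using x by simp
qed

text \<open>A position of a value at most \<open>k\<close> has its image under
  \<open>p \<circ> p\<close> above \<open>j = p n\<close>, whereas behind \<open>i2\<close> these
  images stay below \<open>p n\<close>.\<close>

lemma low_le_i2:
  assumes "1 \<le> x" "x \<le> n" "p x \<le> k"
  shows "x \<le> i2"
proof (rule ccontr)
  assume "\<not> x \<le> i2"
  hence "p (p x) < p n" using above_i2[of x n] assms j_range by simp
  thus False using low_range(3)[OF assms] p_n by simp
qed

text \<open>The position \<open>i\<close> serves as the smallest entry of a would-be 132 in
  \<open>p \<circ> p\<close>: it precedes \<open>x\<close>, and its image \<open>j\<close> is below
  the images of \<open>x\<close> and \<open>y\<close>.\<close>

lemma p2_mono_low:
  assumes "1 \<le> x" "x < y" "y \<le> n" "p x \<le> k" "p y \<le> k"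
  shows "p (p x) < p (p y)"
proof -
  have "k < x" "j < p (p y)" using low_range(1)[of x] low_range(3)[of y] assms by auto
  moreover have "i < x" using \<open>k < x\<close> i_le_k by simp
  ultimately show ?thesis
    using Av_mono[OF Av2, of i x y] assms i_range p_i p_n by simp
qed

lemma card_le_value:
  assumes "c \<le> n"
  shows "card {x \<in> {1..n}. p x \<le> c} = c"
proof -
  have "{x \<in> {1..n}. p x \<le> c} = {x \<in> {1..n}. p x \<in> {1..c}}" using p_ge by auto
  thus ?thesis using card_preimage_permutes[OF perm, of "{1..c}"] assms by simp
qed

text \<open>On these \<open>k\<close> positions \<open>p \<circ> p\<close> is increasing with values
  among the \<open>k\<close> numbers above \<open>j\<close>. This supplies hypothesis E1 of
  \<open>rotation_form\<close>.\<close>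

lemma p2_shift:
  assumes low: "\<And>t. \<lbrakk>1 \<le> t; t \<le> k\<rbrakk> \<Longrightarrow> p (k + t) \<le> k" and t: "1 \<le> t" "t \<le> k"
  shows "p (p (k + t)) = j + t"
proof -
  have low': "p x \<le> k" if "k + 1 \<le> x" "x < k + 1 + k" for x
    using low[of "x - k"] that by simp
  have "p (p (k + t)) + (k + 1) = k + t + (j + 1)"
  proof (rule strict_mono_on_interval_shift[where f = "\<lambda>x. p (p x)" and l = k])
    fix x assume x: "k + 1 \<le> x" "x < k + 1 + k"
    have "x \<le> n" using x k_less_j n_eq by simp
    thus "j + 1 \<le> p (p x) \<and> p (p x) < j + 1 + k"
      using low_range(3)[of x] low'[of x] x p_le[of x] p_le[of "p x"] n_eq by simp
    fix y assume "x < y" "y < k + 1 + k"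
    thus "p (p x) < p (p y)"
      using p2_mono_low[of x y] low' x k_less_j n_eq by simp
  qed (use t in auto)
  thus ?thesis by simp
qed

lemma inj_on_p: "inj_on p A"
  using permutes_inj[OF perm] inj_on_subset by blast

text \<open>
  The preimage \<open>W\<close> of \<open>{1..k}\<close> lies between the first and the last \<open>k\<close> positions and has largest
  element \<open>i2 < j\<close>. Comparing the lengths of the suffix of \<open>p \<circ> p\<close> forced by its last value \<open>s\<close> and
  of the set \<open>R\<close> of non-\<open>W\<close> positions after \<open>Min W\<close> shows that both coincide.
\<close>

lemma rotation_if_i2_less:
  assumes "i2 < j"
  shows "\<exists>\<alpha>\<in>Av k. 3 * k < n \<and> p = skew k (n - k) \<alpha> (inv \<alpha>)"
proof -
  define W where "W = {x \<in> {1..n}. p x \<le> k}"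
  define w where "w = Min W"
  have finW: "finite W" by (simp add: W_def)
  have i2W: "i2 \<in> W" using i2_range p_i2 i_le_k by (simp add: W_def)
  hence wW: "w \<in> W" unfolding w_def using Min_in[OF finW] by blast
  have w_min: "x \<in> W \<Longrightarrow> w \<le> x" for x using finW by (simp add: w_def)
  have w: "1 \<le> w" "k < w" "w \<le> i2" "p w \<le> k"
    using wW low_range(1)[of w] w_min[OF i2W] by (auto simp: W_def)
  have mono: "p x < p y" if "w < x" "x < y" "y \<le> n" "k < p y" for x y
    using Av_mono[OF Av, of w x y] w that by simp
  have cardW: "card W = k" using card_le_value[of k] n_eq by (simp add: W_def)
  have W_less_j: "x < j" if "x \<in> W" for x
    using low_le_i2[of x] that assms by (simp add: W_def)
  have ks: "k < s"
    using W_less_j[of j] j_range by (force simp: s_def W_def)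
  have sj: "s < j"
    using top_iff[of j] j_range k_less_j s_range by (simp add: s_def)
  define R where "R = {x \<in> {1..n}. w < x \<and> k < p x}"
  define L where "L = {x \<in> R. x \<le> j}"
  have fin: "finite R" "finite L" by (auto simp: R_def L_def)
  \<comment> \<open>On the last \<open>s\<close> positions \<open>p \<circ> p\<close> is at most
    \<open>s < j\<close>, while it exceeds \<open>j\<close> on \<open>W\<close>; so these positions
    avoid \<open>W\<close>, and they lie behind \<open>i2\<close>, hence behind
    \<open>w\<close>.\<close>
  have suffix: "{n - s<..n} \<subseteq> R"
  proof
    fix x assume x: "x \<in> {n - s<..n}"
    hence x1: "1 \<le> x" "x \<le> n" by auto
    have le: "p (p x) \<le> s" using top2_iff[of x] x x1 by simp
    have "k < p x" using low_range(3)[of x] le sj x1 by fastforce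
    moreover have "s \<le> n - i2" using top2_i2_iff[of n] i2_range n_pos p_n by (simp add: s_def)
    hence "i2 < x" using top2_i2_iff[of x] le x1 by simp
    ultimately show "x \<in> R" using x1 w by (simp add: R_def)
  qed
  have L_le: "p x \<le> s" if "x \<in> L" for x
    using mono[of x j] that ks j_range by (cases "x = j") (auto simp: L_def R_def s_def)
  have R_split: "R = L \<union> {j<..n}"
  proof -
    have "x \<in> R" if "j < x" "x \<le> n" for x
      using W_less_j[of x] that w assms by (force simp: R_def W_def)
    thus ?thesis by (auto simp: L_def R_def)
  qed
  have cardR: "card R = card L + k"
    unfolding R_split by (subst card_Un_disjoint) (use fin n_eq in \<open>auto simp: L_def\<close>)
  have WL: "W \<union> L \<subseteq> {x \<in> {1..n}. p x \<le> s}"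
    using L_le ks by (auto simp: W_def L_def R_def)
  have cardWL: "card (W \<union> L) = k + card L"
    by (subst card_Un_disjoint) (use fin finW cardW in \<open>auto simp: W_def L_def R_def\<close>)
  have "card (W \<union> L) \<le> s"
    using card_mono[OF _ WL] card_le_value[of s] s_range by simp
  \<comment> \<open>The sandwich
    \<open>s \<le> card R = card L + k = card (W \<union> L) \<le> s\<close> makes both inclusions
    \<open>suffix\<close> and \<open>WL\<close> equalities.\<close>
  hence R_eq: "{n - s<..n} = R"
    using card_seteq[OF fin(1) suffix] cardR cardWL s_range by simp
  hence cardR': "card R = s" using s_range by (metis card_greaterThanAtMost diff_diff_cancel)
  have WL_eq: "W \<union> L = {x \<in> {1..n}. p x \<le> s}"
    by (rule card_seteq[OF _ WL]) (use card_le_value[of s] s_range cardWL cardR cardR' in auto)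
  have "p ` L = {k<..s}"
  proof (rule card_seteq)
    show "p ` L \<subseteq> {k<..s}" using L_le by (auto simp: L_def R_def)
    show "card {k<..s} \<le> card (p ` L)" using card_image[OF inj_on_p, of L] cardR cardR' by simp
  qed simp
  \<comment> \<open>As \<open>v\<close> is among the last \<open>s\<close> positions,
    \<open>p (k + 1) = p (p v) \<le> s\<close>, so \<open>k + 1\<close> lies in
    \<open>W \<union> L\<close>. Elements of \<open>L\<close> exceed \<open>w > k\<close>, which
    leaves only \<open>w = k + 1\<close>.\<close>
  then obtain v where v: "v \<in> L" "p v = k + 1" using ks by (metis Suc_eq_plus1 Suc_leI greaterThanAtMost_iff imageE lessI)
  have "v \<in> {n - s<..n}" using v R_eq by (auto simp: L_def)
  hence "p (k + 1) \<le> s" using top2_iff[of v] v by simp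
  hence "k + 1 \<in> W \<union> L" unfolding WL_eq using n_eq k_less_j by simp
  hence w_eq: "w = k + 1" using w_min[of "k + 1"] w by (auto simp: L_def R_def)
  have W_eq: "W = {k<..n - s}"
  proof (intro equalityI subsetI)
    fix x assume x: "x \<in> W"
    hence "x \<notin> R" by (auto simp: W_def R_def)
    thus "x \<in> {k<..n - s}" using x w w_min[of x] R_eq by (fastforce simp: W_def)
  next
    fix x assume x: "x \<in> {k<..n - s}"
    hence "x \<notin> R" using R_eq by auto
    thus "x \<in> W" using x w_eq wW by (cases "x = w") (auto simp: W_def R_def)
  qed
  hence s_eq: "s + 2 * k = n" using cardW n_eq k_pos s_range by auto
  have low: "p (k + t) \<le> k" if "1 \<le> t" "t \<le> k" for t
  proof -
    have "k + t \<in> W" unfolding W_eq using that s_eq by auto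
    thus ?thesis by (simp add: W_def)
  qed
  have shift: "p v = v - k" if v: "k + k < v" "v \<le> n" for v
  proof -
    have inR: "x \<in> R" if "2 * k < x" "x \<le> n" for x using R_eq that s_eq by auto
    have "p v + (2 * k + 1) = v + (k + 1)"
    proof (rule strict_mono_on_interval_shift[where l = s])
      fix x assume x: "2 * k + 1 \<le> x" "x < 2 * k + 1 + s"
      have "x \<in> R" using inR[of x] x s_eq by simp
      moreover have "p x \<le> j" using top_iff[of x] x s_eq by linarith
      ultimately show "k + 1 \<le> p x \<and> p x < k + 1 + s" using s_eq n_eq by (simp add: R_def)
      fix y assume y: "x < y" "y < 2 * k + 1 + s"
      have "y \<in> R" using inR[of y] x y s_eq by simp
      thus "p x < p y" using mono[of x y] x y w_eq k_pos s_eq by (simp add: R_def)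
    qed (use v s_eq in auto)
    thus ?thesis using v by simp
  qed
  have "\<exists>\<alpha>\<in>Av k. p = skew k (n - k) \<alpha> (inv \<alpha>)"
  proof (rule rotation_form[OF Av k_pos])
    show "p (p (k + t)) = n - k + t" if "1 \<le> t" "t \<le> k" for t
      using p2_shift[OF low that] n_eq by simp
  qed (use shift s_eq ks p_n n_eq in auto)
  thus ?thesis using s_eq ks by auto
qed

text \<open>Now \<open>i2\<close> is among the last \<open>k\<close> positions. These split into
  \<open>Y1\<close> (values at most \<open>k\<close>) and \<open>Y2\<close> (larger values), and
  \<open>Z\<close> collects the remaining positions of values at most \<open>k\<close>. The core is
  that \<open>Z\<close> fills the whole interval between the first and the last \<open>k\<close>
  positions; its size \<open>n - 2 * k\<close> becomes the size of the twist.\<close>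

lemma rotation_if_i2_greater:
  assumes "j < i2"
  shows "\<exists>\<alpha>\<in>Av (n - 2 * k). 2 * k < n \<and> n < 3 * k \<and> p = skew k (n - k) \<alpha> (inv \<alpha>)"
proof -
  have s_less: "s < p y" if "j < y" "y \<le> n" for y
    using above_i2[of n y] that i2_range p_n by (simp add: s_def)
  have sk: "s \<le> k" using s_less[of i2] assms i2_range p_i2 i_le_k by simp
  have ps: "j < p s" using top_iff[of s] s_range sk by simp
  \<comment> \<open>Write \<open>y' = p x\<close> with \<open>x \<le> k\<close>. Since
    \<open>p \<circ> p\<close> sends \<open>j\<close> to \<open>p s > j\<close> and \<open>y\<close>
    to at most \<open>j\<close>, a smaller value at \<open>x\<close> than at \<open>y\<close> would
    make \<open>x\<close>, \<open>j\<close>, \<open>y\<close> a 132.\<close>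
  have C1: "p (p y) < p y'" if y: "j < y" "y \<le> n" "k < p y" and y': "j < y'" "y' \<le> n" for y y'
  proof -
    obtain x where x: "1 \<le> x" "x \<le> k" "p x = y'" using image_top y' by blast
    have "p (p y) \<le> j"
      using top_iff[of "p y"] p_ge[of y] p_le[of y] y by linarith
    hence "\<not> p y' < p (p y)"
      using Av_mono[OF Av2, of x j y] x y k_less_j ps by (auto simp: s_def)
    moreover have "p y \<noteq> y'" using p_top_le[of y] y y' by simp
    hence "p (p y) \<noteq> p y'" by (simp add: p_eq)
    ultimately show ?thesis by simp
  qed
  define Y1 where "Y1 = {y \<in> {1..n}. j < y \<and> p y \<le> k}"
  define Y2 where "Y2 = {y \<in> {1..n}. j < y \<and> k < p y}"
  define Z where "Z = {z \<in> {1..n}. z \<le> j \<and> p z \<le> k}"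
  define k2 where "k2 = card Z"
  have fin: "finite Y1" "finite Y2" "finite Z" by (auto simp: Y1_def Y2_def Z_def)
  have i2Y1: "i2 \<in> Y1" using assms i2_range p_i2 i_le_k by (simp add: Y1_def)
  have jZ: "j \<in> Z" using j_range sk by (simp add: Z_def s_def)
  have sub: "p ` Y2 \<subseteq> Z"
  proof
    fix z assume "z \<in> p ` Y2"
    then obtain y where y: "z = p y" "1 \<le> y" "y \<le> n" "j < y" "k < p y" by (auto simp: Y2_def)
    have "p (p y) < i" using C1[of y i2] y assms i2_range p_i2 by simp
    thus "z \<in> Z" using y p_top_le[of y] p_ge p_le i_le_k by (auto simp: Z_def)
  qed
  have "Y1 \<union> Y2 = {j<..n}" by (auto simp: Y1_def Y2_def)
  moreover have "Y1 \<inter> Y2 = {}" by (auto simp: Y1_def Y2_def)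
  ultimately have card12: "card Y1 + card Y2 = k"
    using card_Un_disjoint[OF fin(1,2)] n_eq by simp
  have "Y1 \<union> Z = {x \<in> {1..n}. p x \<le> k}" by (auto simp: Y1_def Z_def)
  moreover have "Y1 \<inter> Z = {}" by (auto simp: Y1_def Z_def)
  ultimately have "card Y1 + card Z = card {x \<in> {1..n}. p x \<le> k}"
    using card_Un_disjoint[OF fin(1,3)] by simp
  hence card1Z: "card Y1 + k2 = k" using card_le_value[of k] n_eq by (simp add: k2_def)
  \<comment> \<open>Together with \<open>Y1\<close>, both \<open>Y2\<close> (by positions) and
    \<open>Z\<close> (by values) complete a set of size \<open>k\<close>, so they are
    equinumerous.\<close>
  have Z_eq: "p ` Y2 = Z"
    by (rule card_seteq[OF fin(3) sub]) (use card12 card1Z card_image[OF inj_on_p, of Y2] in \<open>simp add: k2_def\<close>)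
  have C2: "p z < p y" if "z \<in> Z" "y \<in> Y1" for z y
  proof -
    obtain y2 where "y2 \<in> Y2" "z = p y2" using \<open>z \<in> Z\<close> Z_eq by blast
    thus ?thesis using C1[of y2 y] \<open>y \<in> Y1\<close> by (auto simp: Y1_def Y2_def)
  qed
  have pZ: "p ` Z = {1..k2}"
  proof -
    have "p ` Z = {1..card (p ` Z)}"
    proof (rule down_closed_nat[of _ k])
      show "p ` Z \<subseteq> {1..k}"
      proof
        fix y assume "y \<in> p ` Z"
        then obtain z where "y = p z" "1 \<le> z" "p z \<le> k" by (auto simp: Z_def)
        thus "y \<in> {1..k}" using p_ge[of z] by simp
      qed
      fix x y assume y: "y \<in> p ` Z" and x: "1 \<le> x" "x < y"
      let ?u = "inv p x"
      have y': "y \<le> k" using y by (auto simp: Z_def)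
      have u: "p ?u = x" by (rule p_inverses)
      hence "1 \<le> ?u" "?u \<le> n" using p_ge[of ?u] p_le[of ?u] x y' n_eq by auto
      moreover have "?u \<notin> Y1" using C2[of _ ?u] y x u by force
      ultimately have "?u \<in> Z" using u x y' unfolding Z_def Y1_def by simp
      thus "x \<in> p ` Z" using u by (metis imageI)
    qed
    thus ?thesis using card_image[OF inj_on_p, of Z] by (simp add: k2_def)
  qed
  have k2_less: "k2 < p y" if "y \<in> Y1" for y
  proof (rule ccontr)
    assume "\<not> k2 < p y"
    hence "p y \<in> p ` Z" unfolding pZ using that p_ge by (auto simp: Y1_def)
    then obtain z where "z \<in> Z" "p y = p z" by blast
    thus False using C2[OF _ that, of z] by simp
  qed
  have k2_pos: "1 \<le> k2" using jZ fin by (auto simp: k2_def Suc_le_eq card_gt_0_iff)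
  have k2_k: "k2 < k" using k2_less[OF i2Y1] p_i2 i_le_k by simp
  have low: "p m \<le> k" if m: "k < m" "m \<le> j" for m
  proof (rule ccontr)
    assume pm: "\<not> p m \<le> k"
    have m1: "1 \<le> m" "m \<le> n" using m n_eq by auto
    have pmj: "p m \<le> j" using top_iff[OF m1] m by simp
    have "p m \<notin> Z"
    proof
      assume "p m \<in> Z"
      then obtain y where "y \<in> Y2" "p m = p y" using Z_eq by blast
      thus False using m p_eq by (auto simp: Y2_def)
    qed
    hence ppm: "k < p (p m)" using pmj p_ge[of m] p_le[of m] m1 by (simp add: Z_def)
    have "p (p m) \<le> j"
      using top_iff[of "p m"] pm p_ge[of m] p_le[of m] m1 by linarith
    \<comment> \<open>An offending \<open>m\<close> forces all preimages of \<open>Y1\<close> behind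
      \<open>i\<close>: an \<open>x < i\<close> among them would give the 132 \<open>x\<close>,
      \<open>i\<close>, \<open>m\<close> in \<open>p \<circ> p\<close>. Then
      \<open>card Y1 \<le> k - i\<close>, against \<open>card Y1 = k - k2\<close> and
      \<open>k2 < i\<close>.\<close>
    define V where "V = {x \<in> {1..n}. p x \<in> Y1}"
    have "V \<subseteq> {i<..k}"
    proof
      fix x assume "x \<in> V"
      hence x: "1 \<le> x" "x \<le> n" "j < p x" "p (p x) \<le> k" by (auto simp: V_def Y1_def)
      have "x \<noteq> i" using x p_i p_n k_less_j by auto
      moreover have "\<not> x < i"
        using Av_mono[OF Av2, of x i m] x m i_le_k ppm \<open>p (p m) \<le> j\<close> m1 p_i p_n by auto
      ultimately show "x \<in> {i<..k}" using top_iff[of x] x by simp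
    qed
    hence "card V \<le> k - i" using card_mono[of "{i<..k}" V] by simp
    moreover have "p ` V = Y1"
    proof (intro equalityI subsetI)
      fix y assume y: "y \<in> Y1"
      hence "inv p y \<in> V"
        using p_inverses(1)[of y] p_ge[of "inv p y"] p_le[of "inv p y"] by (simp add: V_def Y1_def)
      thus "y \<in> p ` V" using p_inverses(1) by (metis imageI)
    qed (auto simp: V_def)
    hence "card V = card Y1" using card_image[OF inj_on_p, of V] by simp
    moreover have "k2 < i" using k2_less[OF i2Y1] p_i2 by simp
    ultimately show False using card1Z k2_k i_le_k by simp
  qed
  have "z \<in> Z \<longleftrightarrow> z \<in> {k<..j}" for z
    using low[of z] low_range(1)[of z] n_eq unfolding Z_def by force
  hence "Z = {k<..j}" by blast
  hence k2_eq: "k2 + k = j" using k_less_j by (simp add: k2_def)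
  have shift: "p v = v - k" if v: "j < v" "v \<le> n" for v
  proof -
    have "p v + (j + 1) = v + (k2 + 1)"
    proof (rule strict_mono_on_interval_shift[where l = k])
      fix x assume x: "j + 1 \<le> x" "x < j + 1 + k"
      have "k2 < p x"
        using k2_less[of x] k2_k x n_eq by (cases "p x \<le> k") (auto simp: Y1_def)
      moreover have "p x \<le> j" using p_top_le[of x] x n_eq by simp
      ultimately show "k2 + 1 \<le> p x \<and> p x < k2 + 1 + k" using k2_eq by simp
      fix y assume y: "x < y" "y < j + 1 + k"
      show "p x < p y"
        using Av_mono[OF Av, of j x y] s_less[of y] x y j_range n_eq by (simp add: s_def)
    qed (use v n_eq in auto)
    thus ?thesis using k2_eq v by simp
  qed
  have low': "p (k + t) \<le> k" if "1 \<le> t" "t \<le> k" for t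
    using low[of "k + t"] shift[of "k + t"] that k2_eq n_eq k2_k k_less_j by (cases "k + t \<le> j") auto
  have "\<exists>\<alpha>\<in>Av (n - 2 * k). p = skew k (n - k) \<alpha> (inv \<alpha>)"
  proof (rule rotation_form[OF Av k_pos])
    show "p (p (k + t)) = n - k + t" if "1 \<le> t" "t \<le> k" for t
      using p2_shift[OF low' that] n_eq by simp
  qed (use shift k2_eq k2_k k2_pos p_n n_eq in auto)
  thus ?thesis using k2_eq k2_k k2_pos n_eq by auto
qed

text \<open>Here \<open>i\<close>, \<open>n\<close>, \<open>j\<close> form a three-cycle and
  \<open>s = i\<close>. On the top \<open>i\<close> points \<open>p\<close> is increasing, its
  square lands in \<open>{1..i}\<close>, and \<open>p\<close> returns these to the top; the cube is
  an increasing self-map of a window, hence the identity there.\<close>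

lemma i_in_cuts:
  assumes "i2 = j"
  shows "i \<in> cuts n p"
proof -
  have s: "s = i" using assms p_i2 by (simp add: s_def)
  have mono: "p x < p y" if "j < x" "x < y" "y \<le> n" for x y
  proof -
    \<comment> \<open>Values at most \<open>k\<close> occur only up to \<open>i2 = j\<close>, so
      \<open>j\<close>, with \<open>p j = i \<le> k\<close>, can play the smallest entry of a
      132.\<close>
    have "k < p y" using low_le_i2[of y] that assms by fastforce
    thus ?thesis
      using Av_mono[OF Av, of j x y] that j_range i_le_k s by (simp add: s_def)
  qed
  have top: "j < x" if "n - i < x" for x using that i_le_k n_eq by simp
  have low: "p (p x) \<le> i" if "n - i < x" "x \<le> n" for x
    using top2_iff[of x] that s by simp
  have "p (p (p x)) = x" if x: "n - i < x" "x \<le> n" for x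
  proof -
    have "p (p (p x)) + (n - i + 1) = x + (n - i + 1)"
    proof (rule strict_mono_on_interval_shift[where f = "\<lambda>x. p (p (p x))" and l = i])
      fix x assume x: "n - i + 1 \<le> x" "x < n - i + 1 + i"
      hence "1 \<le> p (p x)" "p (p x) \<le> i" using low[of x] p_ge p_le i_range by auto
      thus "n - i + 1 \<le> p (p (p x)) \<and> p (p (p x)) < n - i + 1 + i"
        using top_i_iff[of "p (p x)"] i_range p_le[of "p (p x)"] by auto
      fix y :: nat assume y: "x < y" "y < n - i + 1 + i"
      have "p x < p y" using mono[of x y] top[of x] x y i_range by simp
      moreover have "p (p x) \<le> k" "p (p y) \<le> k"
        using low[of x] low[of y] x y i_le_k i_range by simp_all
      ultimately show "p (p (p x)) < p (p (p y))"
        using p2_mono_low[of "p x" "p y"] p_ge p_le x y i_range by simp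
    qed (use x i_range in auto)
    thus ?thesis by simp
  qed
  moreover have "p x \<le> n - i" if "n - i < x" "x \<le> n" for x
    using p_top_le[of x] top[of x] that i_le_k n_eq by simp
  ultimately show ?thesis
    using top_i_iff mono top i_range by (auto simp: cuts_def)
qed

text \<open>The three orders of \<open>i2\<close> and \<open>j\<close> give a three-cycle through
  \<open>n\<close>, a rotation with \<open>3 * k < n\<close>, and one with
  \<open>2 * k < n < 3 * k\<close>; the minimum in the statement covers the twist sizes
  \<open>k\<close> and \<open>n - 2 * k\<close> of the last two at once.\<close>

theorem rising_classification:
  "(\<exists>q\<in>cuts n p. 1 \<le> q) \<or>
   (\<exists>k \<alpha>. 1 \<le> k \<and> 2 * k < n \<and> n \<noteq> 3 * k \<and> \<alpha> \<in> Av (min k (n - 2 * k)) \<and>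
     p = skew k (n - k) \<alpha> (inv \<alpha>))"
proof -
  consider "i2 = j" | "i2 < j" | "j < i2" by linarith
  thus ?thesis
  proof cases
    case 1
    thus ?thesis using i_in_cuts i_range by blast
  next
    case 2
    then obtain \<alpha> where "\<alpha> \<in> Av k" "3 * k < n" "p = skew k (n - k) \<alpha> (inv \<alpha>)"
      using rotation_if_i2_less by blast
    moreover from this have "min k (n - 2 * k) = k" by simp
    ultimately show ?thesis using k_pos by (intro disjI2 exI[of _ k] exI[of _ \<alpha>]) simp
  next
    case 3
    then obtain \<alpha> where "\<alpha> \<in> Av (n - 2 * k)" "2 * k < n" "n < 3 * k"
      "p = skew k (n - k) \<alpha> (inv \<alpha>)"
      using rotation_if_i2_greater by blast
    moreover from this have "min k (n - 2 * k) = n - 2 * k" by simp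
    ultimately show ?thesis using k_pos by (intro disjI2 exI[of _ k] exI[of _ \<alpha>]) simp
  qed
qed

end

lemma cutsD:
  assumes "q \<in> cuts n p"
  shows "q \<le> n"
    and "\<lbrakk>1 \<le> x; x \<le> n\<rbrakk> \<Longrightarrow> n - q < p x \<longleftrightarrow> x \<le> q"
    and "\<lbrakk>n - q < x; x < y; y \<le> n\<rbrakk> \<Longrightarrow> p x < p y"
    and "\<lbrakk>n - q < x; x \<le> n\<rbrakk> \<Longrightarrow> p x \<le> n - q"
    and "\<lbrakk>n - q < x; x \<le> n\<rbrakk> \<Longrightarrow> p (p (p x)) = x"
  using assms by (auto simp: cuts_def)

lemma zero_in_cuts: "p permutes {1..n} \<Longrightarrow> 0 \<in> cuts n p"
  using permutes_interval(2)[of p n] by (auto simp: cuts_def not_less)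

lemma finite_cuts: "finite (cuts n p)"
  by (rule finite_subset[of _ "{..n}"]) (auto simp: cuts_def)

lemma cut_le_half:
  assumes "p permutes {1..n}" "q \<in> cuts n p"
  shows "2 * q \<le> n"
proof -
  have "p ` {n - q<..n} \<subseteq> {1..n - q}"
    using cutsD(4)[OF assms(2)] permutes_interval(1)[OF assms(1)] by fastforce
  hence "card {n - q<..n} \<le> card {1..n - q}"
    using inj_on_subset[OF permutes_inj[OF assms(1)]] by (intro card_inj_on_le) auto
  thus ?thesis using cutsD(1)[OF assms(2)] by auto
qed

section \<open>Shells of three-cycles\<close>

text \<open>
  The three-cycles \<open>w \<mapsto> m + 2k + \<alpha> w \<mapsto> m - q + k + \<alpha> w \<mapsto> w\<close> are wrapped around a permutation of \<open>[m]\<close>,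
  whose top \<open>q\<close> points end up above the middle block of the cycles.
\<close>

definition shell_lift :: "nat \<Rightarrow> nat \<Rightarrow> nat \<Rightarrow> nat \<Rightarrow> nat" where
  "shell_lift m k q v = (if v \<le> m - q then v + k else v + 2 * k)"

text \<open>Equations in place of a definition let the same facts serve a permutation built by
  \<open>make_shell\<close> and one recognised as a shell in \<open>shell_exists\<close>. The
  condition \<open>\<alpha> k = k\<close> is added only where an indecomposable shell is
  meant.\<close>

locale shell =
  fixes m k q :: nat and \<alpha> p P :: "nat \<Rightarrow> nat"
  assumes \<alpha>_perm: "\<alpha> permutes {1..k}" and p_perm: "p permutes {1..m}"
    and P_perm: "P permutes {1..m + 3 * k}" and q_le: "q \<le> m"
    and P_low: "\<And>w. \<lbrakk>1 \<le> w; w \<le> k\<rbrakk> \<Longrightarrow> P w = m + 2 * k + \<alpha> w"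
    and P_lift: "\<And>v. \<lbrakk>1 \<le> v; v \<le> m\<rbrakk> \<Longrightarrow> P (shell_lift m k q v) = shell_lift m k q (p v)"
    and P_mid: "\<And>w. \<lbrakk>1 \<le> w; w \<le> k\<rbrakk> \<Longrightarrow> P (m - q + k + w) = inv \<alpha> w"
    and P_top: "\<And>w. \<lbrakk>1 \<le> w; w \<le> k\<rbrakk> \<Longrightarrow> P (m + 2 * k + w) = m - q + k + w"
begin

abbreviation n where "n \<equiv> m + 3 * k"
abbreviation lift where "lift \<equiv> shell_lift m k q"

lemmas lift_def = shell_lift_def
lemmas \<alpha>_inverses = permutes_inverses[OF \<alpha>_perm]

lemma position_cases:
  assumes "1 \<le> t" "t \<le> n"
  obtains (low) "1 \<le> t" "t \<le> k"
  | (lift) v where "1 \<le> v" "v \<le> m" "t = lift v"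
  | (mid) w where "1 \<le> w" "w \<le> k" "t = m - q + k + w"
  | (top) w where "1 \<le> w" "w \<le> k" "t = m + 2 * k + w"
proof -
  consider "t \<le> k" | "k < t" "t \<le> m - q + k" | "m - q + k < t" "t \<le> m - q + 2 * k"
    | "m - q + 2 * k < t" "t \<le> m + 2 * k" | "m + 2 * k < t" by linarith
  thus thesis
  proof cases
    case 1 thus thesis using low assms by simp
  next
    case 2
    hence "t - k \<le> m - q" by linarith
    hence "t = lift (t - k)" using 2 by (simp add: lift_def)
    thus thesis using lift[of "t - k"] 2 by simp
  next
    case 3 thus thesis using mid[of "t - (m - q + k)"] by simp
  next
    case 4
    hence "t = lift (t - 2 * k)" by (simp add: lift_def)
    thus thesis using lift[of "t - 2 * k"] 4 by simp
  next
    case 5 thus thesis using top[of "t - (m + 2 * k)"] assms by simp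
  qed
qed

lemma lift_less_iff: "lift v < lift v' \<longleftrightarrow> v < v'"
  by (auto simp: lift_def)

lemma lift_gt: "1 \<le> v \<Longrightarrow> k < lift v"
  by (auto simp: lift_def)

lemma lift_le: "v \<le> m \<Longrightarrow> lift v \<le> m + 2 * k"
  by (auto simp: lift_def)

lemma lift_mid:
  assumes "1 \<le> w" "w \<le> k"
  shows "lift v < m - q + k + w \<longleftrightarrow> v \<le> m - q" "m - q + k + w < lift v \<longleftrightarrow> m - q < v"
  using assms by (auto simp: lift_def)

lemma \<alpha>_range: "1 \<le> w \<Longrightarrow> w \<le> k \<Longrightarrow> 1 \<le> \<alpha> w \<and> \<alpha> w \<le> k"
  and \<alpha>_inv_range: "1 \<le> w \<Longrightarrow> w \<le> k \<Longrightarrow> 1 \<le> inv \<alpha> w \<and> inv \<alpha> w \<le> k"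
  and p_range: "1 \<le> v \<Longrightarrow> v \<le> m \<Longrightarrow> 1 \<le> p v \<and> p v \<le> m"
  using permutes_interval[OF \<alpha>_perm] permutes_interval[OF permutes_inv[OF \<alpha>_perm]]
    permutes_interval[OF p_perm] by auto

lemma P2_low: "1 \<le> w \<Longrightarrow> w \<le> k \<Longrightarrow> P (P w) = m - q + k + \<alpha> w"
  using P_low[of w] P_top[of "\<alpha> w"] \<alpha>_range[of w] by simp

lemma P2_lift: "1 \<le> v \<Longrightarrow> v \<le> m \<Longrightarrow> P (P (lift v)) = lift (p (p v))"
  using P_lift[of v] P_lift[of "p v"] p_range[of v] by simp

lemma P2_mid: "1 \<le> w \<Longrightarrow> w \<le> k \<Longrightarrow> P (P (m - q + k + w)) = m + 2 * k + w"
  using P_mid[of w] P_low[of "inv \<alpha> w"] \<alpha>_inv_range[of w] \<alpha>_inverses by simp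

lemma P2_top: "1 \<le> w \<Longrightarrow> w \<le> k \<Longrightarrow> P (P (m + 2 * k + w)) = inv \<alpha> w"
  using P_top[of w] P_mid[of w] by simp

text \<open>Patterns within one kind of block are excluded by \<open>\<alpha>\<close>, its inverse
  or \<open>p\<close>. The cut enters for the mixed ones: its position condition excludes two lifted
  points followed by a top point, and its conditions on growth and size exclude a middle point
  followed by lifted ones.\<close>

lemma Av_shell:
  assumes p: "p \<in> Av m" and \<alpha>: "\<alpha> \<in> Av k" and q: "q \<in> cuts m p"
  shows "P \<in> Av n"
proof (rule AvI[OF P_perm])
  note inv\<alpha> = inv_in_Av[OF \<alpha>]
  fix a b c assume *: "1 \<le> a" "a < b" "b < c" "c \<le> n" "P a < P c" "P c < P b"
  have ab: "a \<le> n" "1 \<le> b" "b \<le> n" "1 \<le> c" using * by auto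
  from *(1) ab(1) show False
  proof (cases rule: position_cases)
    case low
    have small: "P t \<le> m + 2 * k" if "k < t" "t \<le> n" for t
    proof -
      have "1 \<le> t" using that by simp
      from this that(2) show ?thesis
      proof (cases rule: position_cases)
        case (lift v) thus ?thesis using P_lift[of v] lift_le p_range[of v] by simp
      next
        case (mid w) thus ?thesis using P_mid[of w] \<alpha>_inv_range[of w] by simp
      next
        case (top w) thus ?thesis using P_top[of w] by simp
      qed (use that in simp)
    qed
    have "m + 2 * k < P a" using low P_low[of a] \<alpha>_range[of a] by simp
    hence "b \<le> k" "c \<le> k" using small[of b] small[of c] * ab by (meson leD le_less_trans not_less order.strict_trans)+
    thus False using Av_mono[OF \<alpha>, of a b c] P_low[of a] P_low[of b] P_low[of c] * ab by simp
  next
    case (lift v)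
    have Pa: "P a = lift (p v)" "k < P a" using lift P_lift[of v] lift_gt p_range[of v] by auto
    have "k < b" "k < c" using lift lift_gt[of v] * by auto
    from ab(2,3) show False
    proof (cases rule: position_cases)
      case b: (lift v')
      have vv: "v < v'" using lift b * lift_less_iff by simp
      from ab(4) *(4) show False
      proof (cases rule: position_cases)
        case c: (lift v'')
        have "v' < v''" using c b * lift_less_iff by simp
        moreover have "p v < p v''" "p v'' < p v'"
          using *(5,6) P_lift lift b c lift_less_iff by simp_all
        ultimately show False using Av_mono[OF p, of v v' v''] vv lift c by simp
      next
        case c: (top w)
        have "p v \<le> m - q" "m - q < p v'"
          using *(5,6) P_lift lift b c P_top[of w] lift_mid[of w] by simp_all
        thus False using cutsD(2)[OF q, of v] cutsD(2)[OF q, of v'] vv lift b by simp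
      qed (use \<open>k < c\<close> Pa * P_mid \<alpha>_inv_range in \<open>fastforce+\<close>)
    next
      case b: (top w)
      from ab(4) *(4) show False
      proof (cases rule: position_cases)
        case (lift v) thus False using lift_le[of v] b * by simp
      next
        case (mid w') thus False using b * by simp
      next
        case (top w') thus False using b * P_top[of w] P_top[of w'] by simp
      qed (use \<open>k < c\<close> in simp)
    qed (use \<open>k < b\<close> Pa * P_mid \<alpha>_inv_range in \<open>fastforce+\<close>)
  next
    case (mid w)
    have "k < b" "k < c" using mid * by auto
    from ab(2,3) show False
    proof (cases rule: position_cases)
      case b: (lift v)
      have v: "m - q < v" using lift_mid(2)[of w v] b mid * by simp
      have Pb: "P b = lift (p v)" "p v \<le> m - q" using b P_lift cutsD(4)[OF q v] by auto
      from ab(4) *(4) show False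
      proof (cases rule: position_cases)
        case c: (lift v')
        have "v < v'" using c b * lift_less_iff by simp
        hence "p v < p v'" using cutsD(3)[OF q v] c by simp
        thus False using Pb c P_lift[of v'] * lift_less_iff[of "p v" "p v'"] by simp
      next
        case (mid w') thus False using lift_mid(1)[of w' v] b v * by simp
      next
        case (top w') thus False using Pb P_top[of w'] lift_mid(1)[of w' "p v"] * by simp
      qed (use \<open>k < c\<close> in simp)
    next
      case b: (mid w')
      hence Pb: "P b \<le> k" using P_mid[of w'] \<alpha>_inv_range[of w'] by simp
      from ab(4) *(4) show False
      proof (cases rule: position_cases)
        case (lift v) thus False using Pb * P_lift[of v] lift_gt[of "p v"] p_range[of v] by simp
      next
        case c: (mid w'')
        thus False using Av_mono[OF inv\<alpha>, of w w' w''] mid b * P_mid by simp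
      next
        case (top w'') thus False using Pb * P_top[of w''] by simp
      qed (use \<open>k < c\<close> in simp)
    next
      case b: (top w')
      from ab(4) *(4) show False
      proof (cases rule: position_cases)
        case (lift v) thus False using lift_le[of v] b * by simp
      next
        case (mid w'') thus False using b * by simp
      next
        case (top w'') thus False using b * P_top[of w'] P_top[of w''] by simp
      qed (use \<open>k < c\<close> in simp)
    qed (use \<open>k < b\<close> in simp)
  next
    case (top w)
    have "b = m + 2 * k + (b - (m + 2 * k))" "c = m + 2 * k + (c - (m + 2 * k))" using top * by auto
    thus False using P_top[of "b - (m + 2 * k)"] P_top[of "c - (m + 2 * k)"] top * by simp
  qed
qed

text \<open>The square runs the three-cycles backwards: low to middle, middle to top, top to low.
  Here the cube condition of a cut is essential, since the middle block now carries large values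
  between the two parts of the lifted permutation.\<close>

lemma Av_shell2:
  assumes p: "p \<circ> p \<in> Av m" and \<alpha>: "\<alpha> \<in> Av k" and q: "q \<in> cuts m p"
  shows "P \<circ> P \<in> Av n"
proof (rule AvI[OF permutes_compose[OF P_perm P_perm]])
  note inv\<alpha> = inv_in_Av[OF \<alpha>]
  \<comment> \<open>The cube fixes \<open>p (p v)\<close>, which lies among the top \<open>q\<close>
    points; cancelling \<open>p\<close> twice moves this to \<open>v\<close>.\<close>
  have cube: "v = p (p (p v))" if "1 \<le> v" "v \<le> m" "m - q < p (p v)" for v
  proof -
    have "p (p v) \<le> m" using p_range that by blast
    hence "p (p (p (p (p v)))) = p (p v)" using cutsD(5)[OF q that(3)] by simp
    thus ?thesis using permutes_eq_iff[OF p_perm] by metis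
  qed
  have image_low: "p (p v) \<le> m - q" if "m - q < v" "v \<le> m" for v
  proof (rule ccontr)
    assume "\<not> p (p v) \<le> m - q"
    hence "p (p (p v)) \<le> m - q" using cutsD(4)[OF q, of "p (p v)"] p_range that by simp
    thus False using cutsD(5)[OF q that] that by simp
  qed
  fix a b c assume *: "1 \<le> a" "a < b" "b < c" "c \<le> n" "(P \<circ> P) a < (P \<circ> P) c" "(P \<circ> P) c < (P \<circ> P) b"
  have PP: "P (P a) < P (P c)" "P (P c) < P (P b)" using *(5,6) by simp_all
  have ab: "a \<le> n" "1 \<le> b" "b \<le> n" "1 \<le> c" using * by auto
  from *(1) ab(1) show False
  proof (cases rule: position_cases)
    case low
    have Pa: "P (P a) = m - q + k + \<alpha> a" "1 \<le> \<alpha> a" "\<alpha> a \<le> k" using P2_low[OF low] \<alpha>_range[OF low] by auto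
    from ab(4) *(4) show False
    proof (cases rule: position_cases)
      case c: low
      thus False using Av_mono[OF \<alpha>, of a b c] P2_low[of a] P2_low[of b] P2_low[of c] PP * ab by simp
    next
      case c: (lift v')
      have pv': "m - q < p (p v')" using PP(1) Pa c P2_lift[of v'] lift_mid(2)[of "\<alpha> a"] by simp
      have v': "v' \<le> m - q" using image_low[of v'] pv' c by linarith
      from ab(2,3) show False
      proof (cases rule: position_cases)
        case b: low
        thus False using PP(2) c pv' P2_low[of b] P2_lift[of v'] lift_mid(1)[of "\<alpha> b" "p (p v')"] \<alpha>_range[of b] by simp
      next
        case b: (lift v)
        have "v < v'" using b c * lift_less_iff by simp
        have less: "p (p v') < p (p v)" using PP(2) b c P2_lift lift_less_iff by simp
        have "p (p v) \<le> m" using p_range b by blast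
        \<comment> \<open>Both squares are top points, where \<open>p\<close> is increasing; as the
          cubes fix \<open>v\<close> and \<open>v'\<close>, this reverses
          \<open>v < v'\<close>.\<close>
        hence "p (p (p v')) < p (p (p v))" using cutsD(3)[OF q pv' less] by simp
        thus False using cube[of v] cube[of v'] b c less pv' \<open>v < v'\<close> by simp
      next
        case b: (mid w)
        thus False using v' lift_mid(1)[of w v'] c * by simp
      next
        case b: (top w)
        thus False using c * lift_le[of v'] by simp
      qed
    next
      case c: (mid w)
      have "P (P b) \<le> m + 2 * k + w" using ab(2,3)
      proof (cases rule: position_cases)
        case b: low thus ?thesis using P2_low[of b] \<alpha>_range[of b] by linarith
      next
        case b: (lift v)
        have "p (p v) \<le> m" using p_range b by blast
        thus ?thesis using P2_lift[of v] lift_le[of "p (p v)"] b by simp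
      next
        case b: (mid w') thus ?thesis using c P2_mid[of w'] * by simp
      next
        case b: (top w') thus ?thesis using P2_top[of w'] \<alpha>_inv_range[of w'] by simp
      qed
      thus False using PP(2) c P2_mid[of w] by simp
    next
      case c: (top w)
      thus False using PP(1) Pa P2_top[of w] \<alpha>_inv_range[of w] by simp
    qed
  next
    case a: (lift v)
    have "k < b" "k < c" using a lift_gt[of v] * by auto
    have ppv: "1 \<le> p (p v)" "p (p v) \<le> m" using p_range a by blast+
    have Pa: "P (P a) = lift (p (p v))" "k < P (P a)" using a P2_lift[of v] lift_gt ppv by auto
    from ab(4) *(4) show False
    proof (cases rule: position_cases)
      case c: (lift v')
      have lessc: "p (p v) < p (p v')" using PP(1) Pa c P2_lift lift_less_iff by simp
      from ab(2,3) show False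
      proof (cases rule: position_cases)
        case b: (lift u)
        have "p (p v') < p (p u)" using PP(2) b c P2_lift lift_less_iff by simp
        moreover have "v < u" "u < v'" using a b c * lift_less_iff by simp_all
        ultimately show False using Av_mono[OF p, of v u v'] a c lessc by simp
      next
        case b: (mid w)
        have v: "v \<le> m - q" "m - q < v'" using lift_mid[of w] a b c * by simp_all
        have ppv': "1 \<le> p (p v')" "p (p v') \<le> m" using p_range c by blast+
        \<comment> \<open>The square of the top point \<open>v'\<close> is at most \<open>q\<close>,
          hence so is the smaller square of \<open>v\<close>. Then the cube of \<open>v\<close> is a
          top point, is fixed by the cube, and therefore equals \<open>v\<close>, which is not a top
          point.\<close>
        have "p (p (p v')) = v'" using cutsD(5)[OF q v(2)] c by simp
        hence "p (p v') \<le> q" using cutsD(2)[OF q ppv'] v(2) by simp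
        hence t: "m - q < p (p (p v))" using cutsD(2)[OF q ppv] lessc by simp
        hence "p (p (p (p (p (p v))))) = p (p (p v))" using cutsD(5)[OF q t] ppv p_range by blast
        hence "p (p (p v)) = v" using permutes_eq_iff[OF p_perm] by metis
        thus False using t v(1) by simp
      next
        case b: (top w)
        thus False using c * lift_le[of v'] by simp
      qed (use \<open>k < b\<close> in simp)
    next
      case c: (mid w)
      have "P (P b) \<le> m + 2 * k + w" using ab(2,3)
      proof (cases rule: position_cases)
        case b: (lift v)
        have "p (p v) \<le> m" using p_range b by blast
        thus ?thesis using P2_lift[of v] lift_le[of "p (p v)"] b by simp
      next
        case b: (mid w') thus ?thesis using c P2_mid[of w'] * by simp
      next
        case b: (top w') thus ?thesis using P2_top[of w'] \<alpha>_inv_range[of w'] by simp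
      qed (use \<open>k < b\<close> in simp)
      thus False using PP(2) c P2_mid[of w] by simp
    next
      case c: (top w)
      thus False using PP(1) Pa P2_top[of w] \<alpha>_inv_range[of w] by simp
    qed (use \<open>k < c\<close> in simp)
  next
    case a: (mid w)
    have "k < b" "k < c" using a * by auto
    have Pa: "m + 2 * k + w = P (P a)" using a P2_mid[of w] by simp
    have only_mid: "\<exists>u. 1 \<le> u \<and> u \<le> k \<and> t = m - q + k + u"
      if "1 \<le> t" "t \<le> n" "k < t" "P (P a) < P (P t)" for t
      using that(1,2)
    proof (cases rule: position_cases)
      case (lift v)
      have "p (p v) \<le> m" using p_range lift by blast
      thus ?thesis using P2_lift[of v] lift_le[of "p (p v)"] lift that Pa by simp
    next
      case (top w') thus ?thesis using P2_top[of w'] \<alpha>_inv_range[of w'] that Pa by simp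
    qed (use that in auto)
    obtain u u' where "1 \<le> u" "u \<le> k" "b = m - q + k + u" "1 \<le> u'" "u' \<le> k" "c = m - q + k + u'"
      using only_mid[of b] only_mid[of c] ab * PP \<open>k < b\<close> \<open>k < c\<close> by auto
    thus False using P2_mid[of u] P2_mid[of u'] PP * by simp
  next
    case a: (top w)
    define u u' where "u = b - (m + 2 * k)" and "u' = c - (m + 2 * k)"
    have u: "b = m + 2 * k + u" "c = m + 2 * k + u'" "w < u" "u < u'" "u' \<le> k"
      using a * by (auto simp: u_def u'_def)
    thus False
      using P2_top[of w] P2_top[of u] P2_top[of u'] a PP Av_mono[OF inv\<alpha>, of w u u'] by simp
  qed
qed

lemma SAv_shell:
  assumes "p \<in> SAv m" "\<alpha> \<in> Av k" "q \<in> cuts m p"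
  shows "P \<in> SAv n"
  using Av_shell Av_shell2 assms by (simp add: SAv_iff)

end

section \<open>Necessity of the shell conditions, and the cuts of a shell\<close>

context shell
begin

lemma P_n: "1 \<le> k \<Longrightarrow> P n = m - q + 2 * k"
  using P_top[of k] by (simp add: algebra_simps)

lemma lift_range: "1 \<le> v \<Longrightarrow> v \<le> m \<Longrightarrow> 1 \<le> lift v \<and> lift v \<le> n"
  using lift_gt[of v] lift_le[of v] by simp

lemma Av_inner: "P \<in> Av n \<Longrightarrow> p \<in> Av m"
proof (rule AvI[OF p_perm])
  fix a b c assume "P \<in> Av n" "1 \<le> a" "a < b" "b < c" "c \<le> m" "p a < p c" "p c < p b"
  thus False
    using Av_mono[of P n "lift a" "lift b" "lift c"] lift_less_iff lift_range[of a] lift_range[of c] P_lift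
    by simp
qed

lemma Av_inner2: "P \<circ> P \<in> Av n \<Longrightarrow> p \<circ> p \<in> Av m"
proof (rule AvI[OF permutes_compose[OF p_perm p_perm]])
  fix a b c
  assume "P \<circ> P \<in> Av n" "1 \<le> a" "a < b" "b < c" "c \<le> m" "(p \<circ> p) a < (p \<circ> p) c" "(p \<circ> p) c < (p \<circ> p) b"
  thus False
    using Av_mono[of "P \<circ> P" n "lift a" "lift b" "lift c"] lift_less_iff lift_range[of a] lift_range[of c] P2_lift
    by simp
qed

lemma Av_outer: "P \<in> Av n \<Longrightarrow> \<alpha> \<in> Av k"
proof (rule AvI[OF \<alpha>_perm])
  fix a b c assume "P \<in> Av n" "1 \<le> a" "a < b" "b < c" "c \<le> k" "\<alpha> a < \<alpha> c" "\<alpha> c < \<alpha> b"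
  thus False using Av_mono[of P n a b c] P_low by simp
qed

text \<open>Each condition on a cut is forced by a test pattern formed by lifted points with a
  position of the shell: the first middle position, position 1, or the last position.\<close>

lemma cut_of_shell:
  assumes P: "P \<in> SAv n" and k: "1 \<le> k"
  shows "q \<in> cuts m p"
proof -
  have Av: "P \<in> Av n" and Av2: "P \<circ> P \<in> Av n" using P by (auto simp: SAv_iff)
  \<comment> \<open>The first middle position lies between the two parts of the lifted positions.
    Its value is below all lifted values under \<open>P\<close> and above them under
    \<open>P \<circ> P\<close>, so it acts as the 1 of a pattern in \<open>P\<close> and as the 3 of
    a pattern in \<open>P \<circ> P\<close>.\<close>
  let ?z = "m - q + k + 1"
  have Pz: "P ?z \<le> k" using P_mid[of 1] \<alpha>_inv_range[of 1] k by simp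
  have PPz: "P (P ?z) = m + 2 * k + 1" using P2_mid[of 1] k by simp
  have PP1: "P (P 1) = m - q + k + \<alpha> 1" "1 \<le> \<alpha> 1" "\<alpha> 1 \<le> k"
    using P2_low[of 1] \<alpha>_range[of 1] k by auto
  have above: "?z < lift v" if "m - q < v" for v using lift_mid(2)[of 1 v] that k by simp
  have mono: "p x < p y" if "m - q < x" "x < y" "y \<le> m" for x y
  proof -
    have "k < lift (p y)" using lift_gt[of "p y"] p_range[of y] that by simp
    thus ?thesis
      using Av_mono[OF Av, of ?z "lift x" "lift y"] above[of x] Pz P_lift[of x] P_lift[of y]
        lift_less_iff lift_range[of y] that by simp
  qed
  have out: "p x \<le> m - q" if "m - q < x" "x \<le> m" for x
  proof -
    have "P (lift x) < P n"
      using Av_mono[OF Av, of ?z "lift x" n] above[of x] Pz P_n[OF k] lift_le[of x] k that by simp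
    thus ?thesis using P_lift[of x] P_n[OF k] lift_mid(1)[of k "p x"] k that by (simp add: lift_def split: if_splits)
  qed
  have first: "m - q < p x \<longleftrightarrow> x \<le> q" if x: "1 \<le> x" "x \<le> m" for x
  proof -
    define U where "U = {x \<in> {1..m}. p x \<in> {m - q<..m}}"
    have "U = {1..card U}"
    proof (rule down_closed_nat[of _ m])
      fix x y assume y: "y \<in> U" and x: "1 \<le> x" "x < y"
      show "x \<in> U"
      proof (rule ccontr)
        assume "x \<notin> U"
        hence "p x \<le> m - q" using x y p_range[of x] by (auto simp: U_def)
        hence "P (lift x) < P n"
          using P_lift[of x] P_n[OF k] x y k by (simp add: lift_def U_def)
        hence "P (lift y) < P n"
          using Av_mono[OF Av, of "lift x" "lift y" n] lift_less_iff[of x y] lift_range[of x]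
            lift_le[of y] x y k by (simp add: U_def)
        thus False using P_lift[of y] P_n[OF k] y by (simp add: lift_def U_def)
      qed
    qed (auto simp: U_def)
    moreover have "card U = card {m - q<..m}"
      unfolding U_def by (rule card_preimage_permutes[OF p_perm]) auto
    hence "card U = q" using q_le by simp
    ultimately have "x \<in> U \<longleftrightarrow> x \<in> {1..q}" by simp
    thus ?thesis using x p_range[of x] by (simp add: U_def)
  qed
  have square_low: "p (p x) \<le> m - q" if "m - q < x" "x \<le> m" for x
  proof (rule ccontr)
    assume *: "\<not> p (p x) \<le> m - q"
    have "p (p x) \<le> m" using p_range[of x] p_range[of "p x"] that by simp
    hence "lift (p (p x)) \<le> m + 2 * k" by (rule lift_le)
    moreover have "P (P 1) < P (P (lift x))"
      using PP1 P2_lift[of x] * lift_mid(2)[of "\<alpha> 1" "p (p x)"] that by simp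
    ultimately show False
      using Av_mono[OF Av2, of 1 ?z "lift x"] above[of x] PPz P2_lift[of x] lift_range[of x] that k by simp
  qed
  \<comment> \<open>The squares of the top points form an initial segment: a smaller missing value
    would come from some \<open>v \<le> m - q\<close>, and then \<open>lift v\<close>,
    \<open>?z\<close>, \<open>lift x\<close> is a 132 in \<open>P \<circ> P\<close>.\<close>
  have square_first: "p (p x) \<le> q" if x: "m - q < x" "x \<le> m" for x
  proof -
    define U where "U = (\<lambda>x. p (p x)) ` {m - q<..m}"
    have "U = {1..card U}"
    proof (rule down_closed_nat[of _ m])
      have "1 \<le> p (p x) \<and> p (p x) \<le> m" if "x \<in> {m - q<..m}" for x
        using p_range[of x] p_range[of "p x"] that by simp
      thus "U \<subseteq> {1..m}" by (auto simp: U_def)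
      fix u y assume y: "y \<in> U" and u: "1 \<le> u" "u < y"
      then obtain x where x: "y = p (p x)" "m - q < x" "x \<le> m" by (auto simp: U_def)
      have y_le: "y \<le> m" using p_range[of x] p_range[of "p x"] x by simp
      define v where "v = inv p (inv p u)"
      have ppv: "p (p v) = u" using permutes_inverses[OF p_perm] by (simp add: v_def)
      have v: "1 \<le> v" "v \<le> m"
        using permutes_interval[OF p_perm, of v] permutes_interval[OF p_perm, of "p v"] ppv u y_le by auto
      have "m - q < v"
      proof (rule ccontr)
        assume nv: "\<not> m - q < v"
        hence less: "lift v < ?z" using lift_mid(1)[of 1 v] k by simp
        have "P (P (lift v)) < P (P (lift x))"
          using P2_lift[of v] P2_lift[of x] v x ppv u lift_less_iff by simp
        hence "P (P ?z) < P (P (lift x))"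
          using Av_mono[OF Av2, of "lift v" ?z "lift x"] less above[of x] lift_range[of v] lift_range[of x] v x
          by simp
        thus False using PPz P2_lift[of x] lift_le[OF y_le] x by simp
      qed
      thus "u \<in> U" using ppv v by (force simp: U_def)
    qed
    moreover have "card U = q"
    proof -
      have "inj_on (\<lambda>x. p (p x)) {m - q<..m}"
        by (rule inj_onI) (simp add: permutes_eq_iff[OF p_perm])
      thus ?thesis using q_le by (simp add: U_def card_image)
    qed
    ultimately show ?thesis using x by (auto simp: U_def)
  qed
  have cube: "p (p (p x)) = x" if x: "m - q < x" "x \<le> m" for x
  proof -
    have range: "m - q < p (p (p x)) \<and> p (p (p x)) \<le> m" if "m - q < x" "x \<le> m" for x
      using first[of "p (p x)"] square_first[OF that] p_range[of x] p_range[of "p x"] p_range[of "p (p x)"] that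
      by simp
    have "p (p (p x)) + (m - q + 1) = x + (m - q + 1)"
    proof (rule strict_mono_on_interval_shift[where f = "\<lambda>x. p (p (p x))" and l = q])
      fix x assume x: "m - q + 1 \<le> x" "x < m - q + 1 + q"
      show "m - q + 1 \<le> p (p (p x)) \<and> p (p (p x)) < m - q + 1 + q"
        using range[of x] x q_le by simp
      fix y assume y: "x < y" "y < m - q + 1 + q"
      have p_le: "1 \<le> p x" "p y \<le> m" using p_range[of x] p_range[of y] x y q_le by auto
      have "p x < p y" using mono[of x y] x y q_le by simp
      moreover have "P (P 1) < P (P (lift (p y)))"
        using PP1 P2_lift[of "p y"] p_range[of y] range[of y] x y q_le
          lift_mid(2)[of "\<alpha> 1" "p (p (p y))"] by simp
      ultimately have "P (P (lift (p x))) < P (P (lift (p y)))"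
        using Av_mono[OF Av2, of 1 "lift (p x)" "lift (p y)"] lift_less_iff lift_gt[of "p x"]
          lift_range[of "p y"] p_le k by simp
      thus "p (p (p x)) < p (p (p y))"
        using P2_lift[of "p x"] P2_lift[of "p y"] \<open>p x < p y\<close> p_le lift_less_iff by simp
    qed (use x q_le in auto)
    thus ?thesis by simp
  qed
  show ?thesis using q_le first mono out cube by (auto simp: cuts_def)
qed

lemma shell_SAv_iff:
  assumes "1 \<le> k"
  shows "P \<in> SAv n \<longleftrightarrow> p \<in> SAv m \<and> \<alpha> \<in> Av k \<and> q \<in> cuts m p"
proof
  assume P: "P \<in> SAv n"
  hence "P \<in> Av n" "P \<circ> P \<in> Av n" by (simp_all add: SAv_iff)
  hence "p \<in> Av m" "p \<circ> p \<in> Av m" "\<alpha> \<in> Av k"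
    using Av_inner Av_inner2 Av_outer by blast+
  thus "p \<in> SAv m \<and> \<alpha> \<in> Av k \<and> q \<in> cuts m p"
    using cut_of_shell[OF P assms] by (simp add: SAv_iff)
qed (use SAv_shell in blast)

text \<open>
  This is the succession rule of the Catalan generating tree: wrapping an indecomposable shell
  around \<open>p\<close> at its \<open>c\<close>-th cut produces a permutation with \<open>c + 1\<close> cuts.
\<close>

lemma cuts_shell:
  assumes q: "q \<in> cuts m p" and k: "1 \<le> k" and \<alpha>_k: "\<alpha> k = k"
  shows "cuts n P = insert 0 ((\<lambda>q'. k + q') ` {q' \<in> cuts m p. q' \<le> q})"
proof -
  have half: "2 * q \<le> m" by (rule cut_le_half[OF p_perm q])
  have lift_above: "m + 2 * k - q' < lift u \<longleftrightarrow> m - q' < u" if "q' \<le> q" "u \<le> m" for q' u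
    using that q_le k by (cases "u \<le> m - q") (auto simp: lift_def)
  have lift_below: "lift x \<le> k + q' \<longleftrightarrow> x \<le> q'" if "q' \<le> q" for q' x
    using that half by (cases "x \<le> m - q") (auto simp: lift_def)
  have cut_iff: "k + q' \<in> cuts n P \<longleftrightarrow> q' \<in> cuts m p" if q': "q' \<le> q" for q'
  proof
    assume Q: "k + q' \<in> cuts n P"
    have nQ: "n - (k + q') = m + 2 * k - q'" by simp
    have mq: "m - q \<le> m - q'" using q' by simp
    have deep: "m - q < x" if "m - q' < x" for x using mq that by linarith
    have "m - q' < p x \<longleftrightarrow> x \<le> q'" if x: "1 \<le> x" "x \<le> m" for x
      using cutsD(2)[OF Q, of "lift x"] lift_range[OF x] P_lift[OF x] lift_above[OF q', of "p x"]
        lift_below[OF q', of x] p_range[OF x] nQ by simp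
    moreover have "p x < p y" if "m - q' < x" "x < y" "y \<le> m" for x y
      using cutsD(3)[OF q deep] that by blast
    moreover have "p x \<le> m - q'" if "m - q' < x" "x \<le> m" for x
      using cutsD(4)[OF q deep[OF that(1)] that(2)] mq by linarith
    moreover have "p (p (p x)) = x" if "m - q' < x" "x \<le> m" for x
      by (rule cutsD(5)[OF q deep[OF that(1)] that(2)])
    ultimately show "q' \<in> cuts m p" using q' q_le by (auto simp: cuts_def)
  next
    assume Q: "q' \<in> cuts m p"
    have nQ: "n - (k + q') = m + 2 * k - q'" by simp
    have q'm: "q' \<le> m - q" "q' \<le> m" using q' half by auto
    have first: "m + 2 * k - q' < P t \<longleftrightarrow> t \<le> k + q'" if "1 \<le> t" "t \<le> n" for t
      using that
    proof (cases rule: position_cases)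
      case low
      hence "m + 2 * k - q' < P t" using P_low[of t] \<alpha>_range[of t] by linarith
      thus ?thesis using low by simp
    next
      case (lift v)
      thus ?thesis
        using cutsD(2)[OF Q, of v] P_lift[of v] lift_above[OF q', of "p v"] lift_below[OF q', of v] p_range[of v]
        by simp
    next
      case (mid w)
      have "inv \<alpha> w \<le> m + 2 * k - q'" using \<alpha>_inv_range[of w] mid q'm by linarith
      thus ?thesis using mid P_mid[of w] q'm by simp
    next
      case (top w)
      have "m - q + k + w \<le> m + 2 * k - q'" using top q' q_le by linarith
      thus ?thesis using top P_top[of w] q'm by simp
    qed
    have tops: "(\<exists>v. m - q' < v \<and> v \<le> m \<and> t = lift v) \<or> (\<exists>w. 1 \<le> w \<and> w \<le> k \<and> t = m + 2 * k + w)"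
      if "m + 2 * k - q' < t" "t \<le> n" for t
    proof -
      have "1 \<le> t" using that by simp
      from this that(2) show ?thesis
      proof (cases rule: position_cases)
        case low thus ?thesis using that q'm by simp
      next
        case (lift v) thus ?thesis using that lift_above[OF q', of v] by auto
      next
        case (mid w)
        have "t \<le> m + 2 * k - q'" using mid q' q_le by linarith
        thus ?thesis using that by simp
      qed auto
    qed
    have P_tops: "P (lift v) = lift (p v) \<and> p v \<le> m - q" if "m - q' < v" "v \<le> m" for v
    proof -
      have "m - q < v" using that q' by linarith
      thus ?thesis using P_lift[of v] cutsD(4)[OF q, of v] that by simp
    qed
    have "P x < P y" if xy: "m + 2 * k - q' < x" "x < y" "y \<le> n" for x y
    proof -
      have "x \<le> n" "m + 2 * k - q' < y" using xy by auto
      then consider v v' where "m - q' < v" "v' \<le> m" "x = lift v" "y = lift v'" "v \<le> m" "m - q' < v'"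
        | v w where "m - q' < v" "v \<le> m" "1 \<le> w" "w \<le> k" "x = lift v" "y = m + 2 * k + w"
        | w w' where "1 \<le> w" "w \<le> k" "1 \<le> w'" "w' \<le> k" "x = m + 2 * k + w" "y = m + 2 * k + w'"
        | w v where "1 \<le> w" "v \<le> m" "x = m + 2 * k + w" "y = lift v"
        using tops[of x] tops[of y] xy(1,3) by metis
      thus ?thesis
      proof cases
        case 1
        hence "p v < p v'" using cutsD(3)[OF Q, of v v'] xy lift_less_iff by simp
        thus ?thesis using 1 P_tops[of v] P_tops[of v'] lift_less_iff by simp
      next
        case 2 thus ?thesis using P_tops[of v] P_top[of w] lift_mid(1)[of w "p v"] by simp
      next
        case 3 thus ?thesis using P_top[of w] P_top[of w'] xy by simp
      next
        case 4 thus ?thesis using lift_le[of v] xy by simp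
      qed
    qed
    moreover have "P x \<le> m + 2 * k - q' \<and> P (P (P x)) = x" if x: "m + 2 * k - q' < x" "x \<le> n" for x
      using tops[OF x]
    proof (elim disjE exE conjE)
      fix v assume v: "m - q' < v" "v \<le> m" "x = lift v"
      have "p (p (p v)) = v" by (rule cutsD(5)[OF Q v(1,2)])
      moreover have "P (P (lift v)) = lift (p (p v))" using P2_lift[of v] v by simp
      moreover have "P (lift (p (p v))) = lift (p (p (p v)))"
        using P_lift[of "p (p v)"] p_range[of v] p_range[of "p v"] v by simp
      moreover have "lift (p v) \<le> m + 2 * k - q'"
      proof -
        have "p v \<le> m - q" "lift (p v) = p v + k" using P_tops[of v] v by (auto simp: lift_def)
        thus ?thesis using q' q_le by linarith
      qed
      ultimately show ?thesis using P_tops[of v] v by simp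
    next
      fix w assume w: "1 \<le> w" "w \<le> k" "x = m + 2 * k + w"
      have "m - q + k + w \<le> m + 2 * k - q'" using w q' q_le by linarith
      moreover have "P (P (P x)) = x"
        using P2_top[of w] P_low[of "inv \<alpha> w"] \<alpha>_inv_range[of w] \<alpha>_inverses w by simp
      ultimately show ?thesis using w P_top[of w] by simp
    qed
    ultimately show "k + q' \<in> cuts n P"
      using first nQ q'm by (auto simp: cuts_def)
  qed
  show ?thesis
  proof (intro equalityI subsetI)
    fix Q assume Q: "Q \<in> cuts n P"
    show "Q \<in> insert 0 ((\<lambda>q'. k + q') ` {q' \<in> cuts m p. q' \<le> q})"
    proof (cases "Q = 0")
      case False
      \<comment> \<open>The maximum sits at position \<open>k\<close>, so a nonzero cut is at least
        \<open>k\<close>; and the value \<open>P n = m - q + 2 * k\<close> bounds it by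
        \<open>k + q\<close>.\<close>
      have "P k = n" using P_low[of k] k \<alpha>_k by simp
      hence kQ: "k \<le> Q" using cutsD(2)[OF Q, of k] False k by simp
      have "P n \<le> n - Q" using cutsD(4)[OF Q, of n] False k by simp
      hence le: "Q - k \<le> q" using P_n[OF k] cutsD(1)[OF Q] q_le kQ by simp
      hence "Q - k \<in> cuts m p" using cut_iff[OF le] Q kQ by simp
      thus ?thesis using le kQ by (intro insertI2 image_eqI[of _ _ "Q - k"]) auto
    qed simp
  qed (use cut_iff zero_in_cuts[OF P_perm] in auto)
qed

end

section \<open>Existence, uniqueness and recognition of shells\<close>

definition make_shell :: "nat \<Rightarrow> nat \<Rightarrow> nat \<Rightarrow> (nat \<Rightarrow> nat) \<Rightarrow> (nat \<Rightarrow> nat) \<Rightarrow> nat \<Rightarrow> nat" where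
  "make_shell m k q \<alpha> p t =
     (if t = 0 \<or> m + 3 * k < t then t
      else if t \<le> k then m + 2 * k + \<alpha> t
      else if t \<le> m - q + k then shell_lift m k q (p (t - k))
      else if t \<le> m - q + 2 * k then inv \<alpha> (t - (m - q + k))
      else if t \<le> m + 2 * k then shell_lift m k q (p (t - 2 * k))
      else t - (m + 2 * k) + (m - q + k))"

text \<open>Injectivity is obtained from surjectivity on a finite set, with one explicit preimage
  per block.\<close>

lemma shell_make_shell:
  assumes \<alpha>: "\<alpha> permutes {1..k}" and p: "p permutes {1..m}" and q: "q \<le> m"
  shows "shell m k q \<alpha> p (make_shell m k q \<alpha> p)"
proof -
  let ?P = "make_shell m k q \<alpha> p" and ?l = "shell_lift m k q"
  define d where "d = m - q"
  have dm: "d \<le> m" by (simp add: d_def)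
  note \<alpha>_int = permutes_interval[OF \<alpha>] and \<alpha>i_int = permutes_interval[OF permutes_inv[OF \<alpha>]]
  note p_int = permutes_interval[OF p]
  have low: "?P w = m + 2 * k + \<alpha> w" if "1 \<le> w" "w \<le> k" for w
    using that dm by (simp add: make_shell_def flip: d_def)
  have lift: "?P (?l v) = ?l (p v)" if "1 \<le> v" "v \<le> m" for v
    using that dm by (auto simp: make_shell_def shell_lift_def simp flip: d_def)
  have mid: "?P (m - q + k + w) = inv \<alpha> w" if "1 \<le> w" "w \<le> k" for w
    using that dm by (simp add: make_shell_def flip: d_def)
  have top: "?P (m + 2 * k + w) = m - q + k + w" if "1 \<le> w" "w \<le> k" for w
    using that dm by (simp add: make_shell_def flip: d_def)
  have "inj_on ?P {1..m + 3 * k}"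
  proof (rule finite_surj_inj)
    show "{1..m + 3 * k} \<subseteq> ?P ` {1..m + 3 * k}"
    proof
      fix t assume t: "t \<in> {1..m + 3 * k}"
      consider "t \<le> k" | v where "1 \<le> v" "v \<le> m" "t = ?l v"
        | w where "1 \<le> w" "w \<le> k" "t = m - q + k + w" | w where "1 \<le> w" "w \<le> k" "t = m + 2 * k + w"
      proof -
        assume *: "t \<le> k \<Longrightarrow> thesis" "\<And>v. \<lbrakk>1 \<le> v; v \<le> m; t = ?l v\<rbrakk> \<Longrightarrow> thesis"
          "\<And>w. \<lbrakk>1 \<le> w; w \<le> k; t = m - q + k + w\<rbrakk> \<Longrightarrow> thesis"
          "\<And>w. \<lbrakk>1 \<le> w; w \<le> k; t = m + 2 * k + w\<rbrakk> \<Longrightarrow> thesis"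
        consider "t \<le> k" | "k < t" "t \<le> m - q + k" | "m - q + k < t" "t \<le> m - q + 2 * k"
          | "m - q + 2 * k < t" "t \<le> m + 2 * k" | "m + 2 * k < t" by linarith
        thus thesis
        proof cases
          case 2
          hence "t - k \<le> m - q" by linarith
          thus thesis using *(2)[of "t - k"] 2 by (simp add: shell_lift_def)
        next
          case 4
          hence "\<not> t - 2 * k \<le> m - q" by linarith
          thus thesis using *(2)[of "t - 2 * k"] 4 by (simp add: shell_lift_def)
        next
          case 3 thus thesis using *(3)[of "t - (m - q + k)"] by simp
        next
          case 5 thus thesis using *(4)[of "t - (m + 2 * k)"] t by simp
        qed (use *(1) in simp)
      qed
      thus "t \<in> ?P ` {1..m + 3 * k}"
      proof cases
        case 1
        have "?P (m - q + k + \<alpha> t) = t"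
          using mid[of "\<alpha> t"] \<alpha>_int[of t] 1 t permutes_inverses[OF \<alpha>] by simp
        moreover have "m - q + k + \<alpha> t \<in> {1..m + 3 * k}" using \<alpha>_int[of t] 1 t by simp
        ultimately show ?thesis by (metis imageI)
      next
        case (2 v)
        have v': "1 \<le> inv p v" "inv p v \<le> m" using permutes_interval[OF permutes_inv[OF p]] 2 by auto
        hence "?P (?l (inv p v)) = t" using lift[of "inv p v"] 2 permutes_inverses[OF p] by simp
        moreover have "?l (inv p v) \<in> {1..m + 3 * k}" using v' by (simp add: shell_lift_def)
        ultimately show ?thesis by (metis imageI)
      next
        case (3 w)
        have "m + 2 * k + w \<in> {1..m + 3 * k}" using 3 by simp
        thus ?thesis using top[of w] 3 by (metis imageI)
      next
        case (4 w)
        have "?P (inv \<alpha> w) = t" using low[of "inv \<alpha> w"] \<alpha>i_int[of w] 4 permutes_inverses[OF \<alpha>] by simp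
        moreover have "inv \<alpha> w \<in> {1..m + 3 * k}" using \<alpha>i_int[of w] 4 by simp
        ultimately show ?thesis by (metis imageI)
      qed
    qed
  qed simp
  moreover have "?P t \<in> {1..m + 3 * k}" if t: "t \<in> {1..m + 3 * k}" for t
  proof -
    have "?l u \<in> {1..m + 3 * k}" if "1 \<le> u" "u \<le> m" for u
      using that by (simp add: shell_lift_def)
    hence lp: "?l (p u) \<in> {1..m + 3 * k}" if "1 \<le> u" "u \<le> m" for u using p_int[of u] that by simp
    consider "t \<le> k" | "k < t" "t \<le> m - q + k" | "m - q + k < t" "t \<le> m - q + 2 * k"
      | "m - q + 2 * k < t" "t \<le> m + 2 * k" | "m + 2 * k < t" by linarith
    thus ?thesis
    proof cases
      case 1 thus ?thesis using low[of t] \<alpha>_int[of t] t by simp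
    next
      case 2
      thus ?thesis using lp[of "t - k"] t dm by (simp add: make_shell_def flip: d_def)
    next
      case 3
      define w where "w = t - (m - q + k)"
      have w: "1 \<le> w" "w \<le> k" "t = m - q + k + w" using 3 by (auto simp: w_def)
      thus ?thesis using \<alpha>i_int[of w] mid[of w] by simp
    next
      case 4
      thus ?thesis using lp[of "t - 2 * k"] t dm by (simp add: make_shell_def flip: d_def)
    next
      case 5
      define w where "w = t - (m + 2 * k)"
      have w: "1 \<le> w" "w \<le> k" "t = m + 2 * k + w" using 5 t by (auto simp: w_def)
      thus ?thesis using top[of w] by simp
    qed
  qed
  ultimately have "?P permutes {1..m + 3 * k}"
    by (intro inj_imp_permutes) (auto simp: make_shell_def)
  thus ?thesis using \<alpha> p q low lift mid top by unfold_locales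
qed

lemma shell_unique:
  assumes "shell m k q \<alpha> p P" "shell m k q \<alpha> p P'"
  shows "P = P'"
proof
  fix t
  interpret A: shell m k q \<alpha> p P by fact
  interpret B: shell m k q \<alpha> p P' by fact
  show "P t = P' t"
  proof (cases "1 \<le> t \<and> t \<le> m + 3 * k")
    case True
    hence "1 \<le> t" "t \<le> m + 3 * k" by auto
    thus ?thesis
    proof (cases rule: A.position_cases)
      case low thus ?thesis using A.P_low B.P_low by simp
    next
      case lift thus ?thesis using A.P_lift B.P_lift by simp
    next
      case mid thus ?thesis using A.P_mid B.P_mid by simp
    next
      case top thus ?thesis using A.P_top B.P_top by simp
    qed
  next
    case False
    thus ?thesis using permutes_not_in[OF A.P_perm, of t] permutes_not_in[OF B.P_perm, of t] by simp
  qed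
qed

text \<open>Since \<open>\<alpha> k = k\<close>, the maximum of \<open>P\<close> sits at position
  \<open>k\<close>. Then the size fixes \<open>m\<close>, the last value fixes \<open>q\<close>, and
  the blocks fix \<open>\<alpha>\<close> and \<open>p\<close>.\<close>

lemma shell_inj:
  assumes "shell m k q \<alpha> p P" "shell m' k' q' \<alpha>' p' P" "m + 3 * k = m' + 3 * k'"
    and "\<alpha> k = k" "\<alpha>' k' = k'" "1 \<le> k" "1 \<le> k'"
  shows "m = m' \<and> k = k' \<and> q = q' \<and> \<alpha> = \<alpha>' \<and> p = p'"
proof -
  interpret A: shell m k q \<alpha> p P by fact
  interpret B: shell m' k' q' \<alpha>' p' P by fact
  have "P k = P k'" using A.P_low[of k] B.P_low[of k'] assms by simp
  hence k: "k = k'" using permutes_eq_iff[OF A.P_perm] by blast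
  hence m: "m = m'" using assms by simp
  have q: "q = q'" using A.P_n B.P_n A.q_le B.q_le k m assms by simp
  have "\<alpha> w = \<alpha>' w" for w
    using A.P_low[of w] B.P_low[of w] k m permutes_not_in[OF A.\<alpha>_perm, of w]
      permutes_not_in[OF B.\<alpha>_perm, of w] by (cases "1 \<le> w \<and> w \<le> k") auto
  moreover have "p v = p' v" for v
  proof (cases "1 \<le> v \<and> v \<le> m")
    case True
    hence "shell_lift m k q (p v) = shell_lift m k q (p' v)"
      using A.P_lift[of v] B.P_lift[of v] k m q by simp
    thus ?thesis using A.lift_less_iff by (metis nat_neq_iff)
  next
    case False
    thus ?thesis using permutes_not_in[OF A.p_perm, of v] permutes_not_in[OF B.p_perm, of v] m by simp
  qed
  ultimately show ?thesis using k m q by auto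
qed

text \<open>
  The size of the outermost indecomposable shell and its cut are read off from the orbit
  \<open>i \<mapsto> n \<mapsto> j \<mapsto> i\<close> of the maximum.
\<close>

lemma shell_exists:
  assumes P: "P \<in> Av n" and Q: "Q \<in> cuts n P" "1 \<le> Q"
  obtains m k q \<alpha> p where "n = m + 3 * k" "1 \<le> k" "\<alpha> k = k" "shell m k q \<alpha> p P"
proof -
  note perm = Av_permutes[OF P]
  note P_inverses = permutes_inverses[OF perm]
  note P_eq = permutes_eq_iff[OF perm]
  define k where "k = inv P n"
  define j where "j = P n"
  have n: "1 \<le> n" using cutsD(1)[OF Q(1)] Q(2) by simp
  have Pk: "P k = n" using P_inverses by (simp add: k_def)
  have k: "1 \<le> k" "k \<le> n" using permutes_interval[OF perm, of k] Pk n by auto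
  have kQ: "k \<le> Q" using cutsD(2)[OF Q(1) k] Pk Q n by simp
  have half: "2 * Q \<le> n" by (rule cut_le_half[OF perm Q(1)])
  have jQ: "j \<le> n - Q" using cutsD(4)[OF Q(1), of n] Q(2) n by (simp add: j_def)
  have low: "n - k < P x \<longleftrightarrow> x \<le> k" if "1 \<le> x" "x \<le> n" for x
    using Av_max[OF P Pk that] .
  have top: "n - Q < x" if "n - k < x" for x using that kQ by linarith
  have cube: "P (P (P x)) = x" if "n - k < x" "x \<le> n" for x
    using cutsD(5)[OF Q(1) top] that by blast
  have Pj: "P j = k" using cube[of n] Pk k n P_eq by (metis diff_less j_def le_refl less_le_trans zero_less_one)
  have j: "1 \<le> j" "j \<le> n" using permutes_interval[OF perm, of n] n by (auto simp: j_def)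
  \<comment> \<open>The images of the last \<open>k\<close> positions run from \<open>z\<close> to
    \<open>j\<close>; this interval is going to be the middle block.\<close>
  define z where "z = P (n - k + 1)"
  have z: "1 \<le> z" "z \<le> n" using permutes_interval[OF perm, of "n - k + 1"] k by (auto simp: z_def)
  have Pz: "P z \<le> k"
    using low[of "P z"] cube[of "n - k + 1"] k permutes_interval[OF perm, of z] z by (simp add: z_def)
  have z_le_P: "z \<le> P x \<and> P x \<le> j" if "n - k < x" "x \<le> n" for x
    using cutsD(3)[OF Q(1) top, of "n - k + 1" x] cutsD(3)[OF Q(1) top, of x n] that k
    by (cases "x = n - k + 1"; cases "x = n") (auto simp: z_def j_def)
  have z_j: "z \<le> j" using z_le_P[of n] k n by simp
  have between: "P v \<le> k" if "z \<le> v" "v \<le> j" for v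
  proof (cases "v = z \<or> v = j")
    case False
    hence "P z < P j" using Pz Pj P_eq that by (metis le_neq_implies_less order.antisym)
    thus ?thesis using Av_mono[OF P, of z v j] False that z j Pj by simp
  qed (use Pz Pj in auto)
  \<comment> \<open>All positions from \<open>z\<close> to \<open>j\<close> carry values at most
    \<open>k\<close>, so there are at most \<open>k\<close> of them; they also contain the
    \<open>k\<close> images of the last positions, so there are exactly \<open>k\<close>.\<close>
  have "card {z..j} \<le> card {x \<in> {1..n}. P x \<in> {1..k}}"
    by (rule card_mono) (use between z j permutes_interval[OF perm] in auto)
  also have "\<dots> = k" using card_preimage_permutes[OF perm, of "{1..k}"] k by simp
  finally have zk: "j + 1 \<le> z + k" using z_j by simp
  have shift: "P x + (n - k + 1) = x + z" if "n - k < x" "x \<le> n" for x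
  proof (rule strict_mono_on_interval_shift[where l = k])
    fix x assume x: "n - k + 1 \<le> x" "x < n - k + 1 + k"
    show "z \<le> P x \<and> P x < z + k" using z_le_P[of x] x zk k by simp
    fix y assume "x < y" "y < n - k + 1 + k"
    thus "P x < P y" using cutsD(3)[OF Q(1) top, of x y] x k by simp
  qed (use that k in auto)
  have zj: "z + k = j + 1" using shift[of n] k n by (simp add: j_def)
  have k_less_z: "k < z"
  proof (rule ccontr)
    assume "\<not> k < z"
    thus False using low[of z] z Pz kQ half by simp
  qed
  define m where "m = n - 3 * k"
  \<comment> \<open>Obtained by solving \<open>j = m - q + 2 * k\<close>, the last value of a shell,
    for \<open>q\<close>.\<close>
  define q where "q = n - k - j"
  have nk: "3 * k \<le> n" "2 * k \<le> j" using k_less_z zj jQ kQ half k by simp_all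
  have mq: "m - q = j - 2 * k" "q \<le> m" using nk jQ kQ by (auto simp: m_def q_def)
  have n_eq: "n = m + 3 * k" using nk by (simp add: m_def)
  have mqk: "m - q + k + 1 = z" "m - q + 2 * k = j" using mq zj nk by auto
  have P_top: "P (m + 2 * k + w) = m - q + k + w" if "1 \<le> w" "w \<le> k" for w
    using shift[of "m + 2 * k + w"] that n_eq mqk by simp
  define \<alpha> where "\<alpha> w = (if 1 \<le> w \<and> w \<le> k then P w - (m + 2 * k) else w)" for w
  have P_low: "P w = m + 2 * k + \<alpha> w" and \<alpha>_range: "1 \<le> \<alpha> w" "\<alpha> w \<le> k" if "1 \<le> w" "w \<le> k" for w
    using low[of w] permutes_interval[OF perm, of w] that k n_eq by (auto simp: \<alpha>_def)
  have \<alpha>_perm: "\<alpha> permutes {1..k}"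
  proof (rule inj_imp_permutes)
    show "inj_on \<alpha> {1..k}"
      by (rule inj_onI) (metis P_low P_eq atLeastAtMost_iff)
  qed (use \<alpha>_range in \<open>auto simp: \<alpha>_def\<close>)
  have \<alpha>_k: "\<alpha> k = k" using P_low[OF k(1)] Pk n_eq by simp
  have P_mid: "P (m - q + k + w) = inv \<alpha> w" if w: "1 \<le> w" "w \<le> k" for w
  proof -
    let ?u = "inv \<alpha> w"
    have u: "1 \<le> ?u" "?u \<le> k" using permutes_interval[OF permutes_inv[OF \<alpha>_perm]] w by auto
    have Pu: "P ?u = m + 2 * k + w" using P_low[OF u] permutes_inverses[OF \<alpha>_perm] by simp
    \<comment> \<open>The cube condition is available on the last \<open>k\<close> positions only,
      to which \<open>P ?u\<close> belongs; cancelling one \<open>P\<close> transfers it to the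
      first \<open>k\<close>.\<close>
    have "P (P (P (P ?u))) = P ?u" by (rule cube) (use Pu w n_eq in auto)
    hence "P (P (P ?u)) = ?u" using P_eq by blast
    thus ?thesis using Pu P_top[OF w] by simp
  qed
  let ?l = "shell_lift m k q"
  define unlift where "unlift t = (if t \<le> m - q + k then t - k else t - 2 * k)" for t
  define p where "p v = (if 1 \<le> v \<and> v \<le> m then unlift (P (?l v)) else v)" for v
  have lift_p: "P (?l v) = ?l (p v) \<and> 1 \<le> p v \<and> p v \<le> m" if v: "1 \<le> v" "v \<le> m" for v
  proof -
    let ?t = "P (?l v)"
    have lv: "1 \<le> ?l v" "?l v \<le> n" "k < ?l v" "?l v \<le> m + 2 * k" using v n_eq by (auto simp: shell_lift_def)
    have not_mid: "?l v \<noteq> m - q + k + w" if "1 \<le> w" "w \<le> k" for w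
      using that by (auto simp: shell_lift_def)
    have t: "1 \<le> ?t" "?t \<le> n" using permutes_interval[OF perm, of "?l v"] lv by auto
    have "k < ?t"
    proof (rule ccontr)
      assume "\<not> k < ?t"
      hence tk: "1 \<le> ?t" "?t \<le> k" using t by auto
      have "P (m - q + k + \<alpha> ?t) = ?t"
        using P_mid[of "\<alpha> ?t"] \<alpha>_range[OF tk] permutes_inverses[OF \<alpha>_perm] by simp
      hence "m - q + k + \<alpha> ?t = ?l v" using P_eq by blast
      thus False using not_mid[of "\<alpha> ?t"] \<alpha>_range[OF tk] by simp
    qed
    moreover have "?t \<le> m + 2 * k"
      using low[OF lv(1,2)] lv n_eq by linarith
    moreover have "?t \<le> m - q + k \<or> m - q + 2 * k < ?t"
    proof (rule ccontr)
      assume *: "\<not> ?thesis"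
      define w where "w = ?t - (m - q + k)"
      have w: "1 \<le> w" "w \<le> k" "?t = m - q + k + w" using * by (auto simp: w_def)
      hence "P (m + 2 * k + w) = ?t" using P_top by simp
      hence "m + 2 * k + w = ?l v" using P_eq by blast
      thus False using lv w by simp
    qed
    ultimately show ?thesis using v by (auto simp: p_def unlift_def shell_lift_def)
  qed
  have p_perm: "p permutes {1..m}"
  proof (rule inj_imp_permutes)
    show "inj_on p {1..m}"
    proof (rule inj_onI)
      fix x y assume xy: "x \<in> {1..m}" "y \<in> {1..m}" "p x = p y"
      hence "P (?l x) = P (?l y)" using lift_p[of x] lift_p[of y] by simp
      hence "?l x = ?l y" using P_eq by blast
      thus "x = y" by (auto simp: shell_lift_def split: if_splits)
    qed
  qed (use lift_p in \<open>auto simp: p_def\<close>)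
  have "shell m k q \<alpha> p P"
    using \<alpha>_perm p_perm perm n_eq mq(2) P_low lift_p P_mid P_top by unfold_locales auto
  thus thesis using that n_eq k(1) \<alpha>_k by blast
qed

section \<open>Counting\<close>

lemma skew_simps:
  assumes "1 \<le> t"
  shows "t \<le> a \<Longrightarrow> skew a b \<alpha> \<beta> t = b + \<alpha> t"
    and "t \<le> b \<Longrightarrow> skew a b \<alpha> \<beta> (a + t) = \<beta> t"
  using assms by (auto simp: skew_def)

lemma skew_in_Av:
  assumes \<alpha>: "\<alpha> \<in> Av a" and \<beta>: "\<beta> \<in> Av b"
  shows "skew a b \<alpha> \<beta> \<in> Av (a + b)"
proof (rule AvI)
  note \<alpha>p = Av_permutes[OF \<alpha>] and \<beta>p = Av_permutes[OF \<beta>]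
  let ?p = "skew a b \<alpha> \<beta>"
  have low: "?p t = b + \<alpha> t" "b < ?p t" "?p t \<le> a + b" if "1 \<le> t" "t \<le> a" for t
    using permutes_interval[OF \<alpha>p, of t] that by (auto simp: skew_def)
  have high: "?p t = \<beta> (t - a)" "1 \<le> ?p t" "?p t \<le> b" if "a < t" "t \<le> a + b" for t
    using permutes_interval[OF \<beta>p, of "t - a"] that by (auto simp: skew_def)
  show "?p permutes {1..a + b}"
  proof (rule inj_imp_permutes)
    show "inj_on ?p {1..a + b}"
    proof (rule inj_onI)
      fix x y assume xy: "x \<in> {1..a + b}" "y \<in> {1..a + b}" "?p x = ?p y"
      hence "x \<le> a \<longleftrightarrow> y \<le> a"
        using low(2)[of x] low(2)[of y] high(3)[of x] high(3)[of y] by fastforce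
      thus "x = y"
        using xy low(1)[of x] low(1)[of y] high(1)[of x] high(1)[of y]
          permutes_eq_iff[OF \<alpha>p, of x y] permutes_eq_iff[OF \<beta>p, of "x - a" "y - a"]
        by (cases "x \<le> a") auto
    qed
    show "?p x \<in> {1..a + b}" if "x \<in> {1..a + b}" for x
      using low(2,3)[of x] high(2,3)[of x] that by (cases "x \<le> a") auto
  qed (auto simp: skew_def)
  fix x y z assume *: "1 \<le> x" "x < y" "y < z" "z \<le> a + b" "?p x < ?p z" "?p z < ?p y"
  show False
  proof (cases "x \<le> a")
    case True
    hence "z \<le> a" using low(2)[of x] high(3)[of z] * by fastforce
    thus False using low(1)[of x] low(1)[of y] low(1)[of z] Av_mono[OF \<alpha>, of x y z] * by simp
  next
    case False
    hence "1 \<le> x - a" "x - a < y - a" "y - a < z - a" "z - a \<le> b" using * by auto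
    thus False
      using high(1)[of x] high(1)[of y] high(1)[of z] Av_mono[OF \<beta>, of "x - a" "y - a" "z - a"] * False
      by simp
  qed
qed

lemma skew_inj:
  assumes "\<alpha> permutes {1..a}" "\<beta> permutes {1..b}" "\<alpha>' permutes {1..a}" "\<beta>' permutes {1..b}"
    and eq: "skew a b \<alpha> \<beta> = skew a b \<alpha>' \<beta>'"
  shows "\<alpha> = \<alpha>' \<and> \<beta> = \<beta>'"
proof (intro conjI ext)
  fix t
  show "\<alpha> t = \<alpha>' t"
    using skew_simps(1)[of t a b \<alpha> \<beta>] skew_simps(1)[of t a b \<alpha>' \<beta>'] eq
      permutes_not_in[OF assms(1), of t] permutes_not_in[OF assms(3), of t]
    by (cases "1 \<le> t \<and> t \<le> a") auto
  show "\<beta> t = \<beta>' t"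
    using skew_simps(2)[of t b a \<alpha> \<beta>] skew_simps(2)[of t b a \<alpha>' \<beta>'] eq
      permutes_not_in[OF assms(2), of t] permutes_not_in[OF assms(4), of t]
    by (cases "1 \<le> t \<and> t \<le> b") auto
qed

text \<open>The hypothesis is supplied by \<open>Av_max\<close> or by \<open>Av_last\<close>, so the
  position of the maximum or the last value each splits a 132-avoider into a skew sum.\<close>

lemma skew_exists:
  assumes p: "p \<in> Av (a + b)"
    and split: "\<And>x. \<lbrakk>1 \<le> x; x \<le> a + b\<rbrakk> \<Longrightarrow> b < p x \<longleftrightarrow> x \<le> a"
  obtains \<alpha> \<beta> where "\<alpha> \<in> Av a" "\<beta> \<in> Av b" "p = skew a b \<alpha> \<beta>"
proof -
  note perm = Av_permutes[OF p]
  note p_eq = permutes_eq_iff[OF perm]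
  define \<alpha> where "\<alpha> t = (if 1 \<le> t \<and> t \<le> a then p t - b else t)" for t
  define \<beta> where "\<beta> t = (if 1 \<le> t \<and> t \<le> b then p (a + t) else t)" for t
  have \<alpha>: "p t = b + \<alpha> t" "1 \<le> \<alpha> t" "\<alpha> t \<le> a" if "1 \<le> t" "t \<le> a" for t
    using split[of t] permutes_interval[OF perm, of t] that by (auto simp: \<alpha>_def)
  have \<beta>: "p (a + t) = \<beta> t" "1 \<le> \<beta> t" "\<beta> t \<le> b" if "1 \<le> t" "t \<le> b" for t
    using split[of "a + t"] permutes_interval[OF perm, of "a + t"] that by (auto simp: \<beta>_def)
  have "\<alpha> \<in> Av a"
  proof (rule AvI)
    show "\<alpha> permutes {1..a}"
    proof (rule inj_imp_permutes)
      show "inj_on \<alpha> {1..a}" by (rule inj_onI) (metis \<alpha>(1) p_eq atLeastAtMost_iff)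
    qed (use \<alpha> in \<open>auto simp: \<alpha>_def\<close>)
    fix x y z assume "1 \<le> x" "x < y" "y < z" "z \<le> a" "\<alpha> x < \<alpha> z" "\<alpha> z < \<alpha> y"
    thus False using \<alpha>(1)[of x] \<alpha>(1)[of y] \<alpha>(1)[of z] Av_mono[OF p, of x y z] by simp
  qed
  moreover have "\<beta> \<in> Av b"
  proof (rule AvI)
    show "\<beta> permutes {1..b}"
    proof (rule inj_imp_permutes)
      show "inj_on \<beta> {1..b}"
        by (rule inj_onI) (metis \<beta>(1) p_eq atLeastAtMost_iff add_left_cancel)
    qed (use \<beta> in \<open>auto simp: \<beta>_def\<close>)
    fix x y z assume "1 \<le> x" "x < y" "y < z" "z \<le> b" "\<beta> x < \<beta> z" "\<beta> z < \<beta> y"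
    thus False
      using \<beta>(1)[of x] \<beta>(1)[of y] \<beta>(1)[of z] Av_mono[OF p, of "a + x" "a + y" "a + z"] by simp
  qed
  moreover have "p = skew a b \<alpha> \<beta>"
  proof
    fix t
    consider "t = 0 \<or> a + b < t" | "1 \<le> t" "t \<le> a" | "a < t" "t \<le> a + b" by linarith
    thus "p t = skew a b \<alpha> \<beta> t"
    proof cases
      case 1 thus ?thesis using permutes_not_in[OF perm, of t] by (auto simp: skew_def)
    next
      case 2 thus ?thesis using \<alpha>(1)[of t] by (simp add: skew_def)
    next
      case 3 thus ?thesis using \<beta>(1)[of "t - a"] by (simp add: skew_def)
    qed
  qed
  ultimately show thesis using that by blast
qed

text \<open>A 132-avoider is skew-indecomposable exactly when its maximum comes last, since
  otherwise \<open>Av_max\<close> splits it. This is why indecomposable shapes of size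
  \<open>k\<close> are counted by \<open>Av (k - 1)\<close>.\<close>

lemma Av_pred:
  assumes "\<alpha> \<in> Av (k - 1)" "1 \<le> k"
  shows "\<alpha> \<in> Av k" "\<alpha> k = k"
  using Av_fix_last[OF assms(2)] assms(1) by blast+

lemma Av_predI: "\<alpha> \<in> Av k \<Longrightarrow> \<alpha> k = k \<Longrightarrow> 1 \<le> k \<Longrightarrow> \<alpha> \<in> Av (k - 1)"
  using Av_fix_last[of k] by blast

lemma card_Av_0: "card (Av 0) = 1"
proof -
  have "Av 0 = {id}" using id_in_Av[of 0] Av_permutes[of _ 0] by auto
  thus ?thesis by simp
qed

text \<open>Split behind the maximum at position \<open>a + 1\<close>: the first block ends in its
  own maximum, so it amounts to an element of \<open>Av a\<close>, and the rest is an arbitrary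
  element of \<open>Av (n - a)\<close>.\<close>

lemma card_Av_Suc: "card (Av (Suc n)) = (\<Sum>a\<le>n. card (Av a) * card (Av (n - a)))"
proof -
  define f where "f = (\<lambda>(a, \<alpha>, \<beta>). skew (a + 1) (n - a) \<alpha> \<beta>)"
  define D where "D = (SIGMA a:{..n}. Av a \<times> Av (n - a))"
  have "inj_on f D"
  proof (rule inj_onI)
    fix x y assume xy: "x \<in> D" "y \<in> D" "f x = f y"
    obtain a \<alpha> \<beta> a' \<alpha>' \<beta>' where x: "x = (a, \<alpha>, \<beta>)" and y: "y = (a', \<alpha>', \<beta>')"
      by (metis prod_cases3)
    have D: "a \<le> n" "\<alpha> \<in> Av a" "\<beta> \<in> Av (n - a)" "a' \<le> n" "\<alpha>' \<in> Av a'" "\<beta>' \<in> Av (n - a')"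
      using xy x y by (auto simp: D_def)
    have \<alpha>: "\<alpha> \<in> Av (a + 1)" "\<alpha> (a + 1) = a + 1" "\<alpha>' \<in> Av (a' + 1)" "\<alpha>' (a' + 1) = a' + 1"
      using Av_pred[of _ "a + 1"] Av_pred[of _ "a' + 1"] D by auto
    have eq: "skew (a + 1) (n - a) \<alpha> \<beta> = skew (a' + 1) (n - a') \<alpha>' \<beta>'"
      using xy(3) x y by (simp add: f_def)
    have perm: "skew (a + 1) (n - a) \<alpha> \<beta> permutes {1..a + 1 + (n - a)}"
      by (rule Av_permutes[OF skew_in_Av[OF \<alpha>(1) D(3)]])
    have "skew (a + 1) (n - a) \<alpha> \<beta> (a + 1) = skew (a + 1) (n - a) \<alpha> \<beta> (a' + 1)"
      using skew_simps(1)[of "a + 1" "a + 1" "n - a" \<alpha> \<beta>]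
        skew_simps(1)[of "a' + 1" "a' + 1" "n - a'" \<alpha>' \<beta>'] \<alpha> eq D by simp
    hence a: "a = a'" using permutes_eq_iff[OF perm] by simp
    thus "x = y"
      using skew_inj[OF Av_permutes[OF \<alpha>(1)] Av_permutes[OF D(3)], of \<alpha>' \<beta>'] eq x y
        Av_permutes[OF \<alpha>(3)] Av_permutes[OF D(6)] by simp
  qed
  moreover have "f ` D = Av (Suc n)"
  proof (intro equalityI subsetI)
    fix p assume "p \<in> f ` D"
    then obtain a \<alpha> \<beta> where "a \<le> n" "\<alpha> \<in> Av a" "\<beta> \<in> Av (n - a)" "p = skew (a + 1) (n - a) \<alpha> \<beta>"
      by (auto simp: f_def D_def)
    thus "p \<in> Av (Suc n)"
      using skew_in_Av[of \<alpha> "a + 1" \<beta> "n - a"] Av_pred(1)[of \<alpha> "a + 1"] by simp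
  next
    fix p assume p: "p \<in> Av (Suc n)"
    note perm = Av_permutes[OF p]
    define a where "a = inv p (Suc n) - 1"
    have P: "p (inv p (Suc n)) = Suc n" by (rule permutes_inverses(1)[OF perm])
    have "1 \<le> inv p (Suc n)" "inv p (Suc n) \<le> Suc n"
      using permutes_interval[OF perm, of "inv p (Suc n)"] P by auto
    hence a: "inv p (Suc n) = a + 1" "a \<le> n" "a + 1 + (n - a) = Suc n" by (auto simp: a_def)
    have "n - a < p x \<longleftrightarrow> x \<le> a + 1" if "1 \<le> x" "x \<le> a + 1 + (n - a)" for x
      using Av_max[OF p P, of x] that a by simp
    then obtain \<alpha> \<beta> where *: "\<alpha> \<in> Av (a + 1)" "\<beta> \<in> Av (n - a)" "p = skew (a + 1) (n - a) \<alpha> \<beta>"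
      using skew_exists[of p "a + 1" "n - a"] p a(3) by metis
    have "\<alpha> (a + 1) = a + 1"
      using skew_simps(1)[of "a + 1" "a + 1" "n - a" \<alpha> \<beta>] P a * by simp
    hence "\<alpha> \<in> Av a" using Av_predI[OF *(1)] by simp
    hence "(a, \<alpha>, \<beta>) \<in> D" using * a by (simp add: D_def)
    moreover have "f (a, \<alpha>, \<beta>) = p" using * by (simp add: f_def)
    ultimately show "p \<in> f ` D" by (metis imageI)
  qed
  ultimately have "card (Av (Suc n)) = card D" by (metis card_image)
  also have "\<dots> = (\<Sum>a\<le>n. card (Av a) * card (Av (n - a)))"
    unfolding D_def by (subst card_SigmaI) (auto simp: finite_Av card_cartesian_product)
  finally show ?thesis .
qed

section \<open>Involutions avoiding 132\<close>

definition Inv :: "nat \<Rightarrow> (nat \<Rightarrow> nat) set" where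
  "Inv n = {p \<in> Av n. p \<circ> p = id}"

lemma finite_Inv: "finite (Inv n)"
  by (rule finite_subset[OF _ finite_Av[of n]]) (auto simp: Inv_def)

lemma card_Inv_0: "card (Inv 0) = 1"
proof -
  have "Inv 0 = {id}" using id_in_Av[of 0] Av_permutes[of _ 0] by (auto simp: Inv_def)
  thus ?thesis by simp
qed

lemma Inv_fix_last:
  assumes "1 \<le> n"
  shows "{p \<in> Inv n. p n = n} = Inv (n - 1)"
proof -
  have "p \<in> Av n \<and> p n = n \<longleftrightarrow> p \<in> Av (n - 1)" for p
    using Av_fix_last[OF assms] by blast
  thus ?thesis unfolding Inv_def by blast
qed

text \<open>With \<open>k = p n\<close>, splitting by the position of the maximum and then by the
  last value gives three blocks of sizes \<open>k\<close>, \<open>n - 2 * k\<close>,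
  \<open>k\<close>. Being an involution makes the last block the inverse of the first and the middle
  block an involution; the maximum at position \<open>k\<close> makes the first block
  indecomposable.\<close>

lemma card_Inv_moved:
  "card {p \<in> Inv n. p n \<noteq> n} = (\<Sum>k | 1 \<le> k \<and> 2 * k \<le> n. card (Av (k - 1)) * card (Inv (n - 2 * k)))"
proof -
  define f where "f = (\<lambda>(k, \<alpha>, \<beta>). skew k (n - k) \<alpha> (skew (n - 2 * k) k \<beta> (inv \<alpha>)))"
  define D where "D = (SIGMA k:{k. 1 \<le> k \<and> 2 * k \<le> n}. Av (k - 1) \<times> Inv (n - 2 * k))"
  have fin: "finite {k. 1 \<le> k \<and> 2 * k \<le> n}" by (rule finite_subset[of _ "{..n}"]) auto
  have D: "\<alpha> \<in> Av k \<and> \<alpha> k = k \<and> skew (n - 2 * k) k \<beta> (inv \<alpha>) \<in> Av (n - k) \<and> f (k, \<alpha>, \<beta>) n = k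
      \<and> f (k, \<alpha>, \<beta>) \<in> Inv n"
    if "(k, \<alpha>, \<beta>) \<in> D" for k \<alpha> \<beta>
  proof -
    have k: "1 \<le> k" "2 * k \<le> n" "\<alpha> \<in> Av (k - 1)" "\<beta> \<in> Inv (n - 2 * k)"
      using that by (auto simp: D_def)
    define b where "b = n - 2 * k"
    have n: "n = k + (b + k)" "n - k = b + k" using k by (auto simp: b_def)
    have \<alpha>: "\<alpha> \<in> Av k" "\<alpha> k = k" using Av_pred[OF k(3,1)] by auto
    have \<beta>: "\<beta> \<in> Av b" "\<And>t. \<beta> (\<beta> t) = t" using k(4) by (auto simp: Inv_def b_def fun_eq_iff)
    note \<alpha>p = Av_permutes[OF \<alpha>(1)]
    note \<alpha>_int = permutes_interval[OF \<alpha>p] and \<alpha>i_int = permutes_interval[OF permutes_inv[OF \<alpha>p]]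
      and \<beta>_int = permutes_interval[OF Av_permutes[OF \<beta>(1)]]
    have inner: "skew b k \<beta> (inv \<alpha>) \<in> Av (b + k)"
      by (rule skew_in_Av[OF \<beta>(1) inv_in_Av[OF \<alpha>(1)]])
    let ?p = "skew k (b + k) \<alpha> (skew b k \<beta> (inv \<alpha>))"
    have p: "?p \<in> Av n" using skew_in_Av[OF \<alpha>(1) inner] n by simp
    have low: "?p t = b + k + \<alpha> t" if "1 \<le> t" "t \<le> k" for t
      using that by (simp add: skew_simps)
    have mid: "?p (k + t) = k + \<beta> t" if "1 \<le> t" "t \<le> b" for t
      using that by (simp add: skew_simps)
    have high: "?p (b + k + t) = inv \<alpha> t" if t: "1 \<le> t" "t \<le> k" for t
      using skew_simps(2)[of "b + t" "b + k" k \<alpha> "skew b k \<beta> (inv \<alpha>)"] skew_simps(2)[of t k b \<beta> "inv \<alpha>"] t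
      by (simp add: ac_simps)
    have "?p (?p t) = t" for t
    proof -
      consider "t = 0 \<or> n < t" | "1 \<le> t" "t \<le> k" | "k < t" "t \<le> b + k" | "b + k < t" "t \<le> n" by linarith
      thus ?thesis
      proof cases
        case 1 thus ?thesis using permutes_not_in[OF Av_permutes[OF p], of t] by auto
      next
        case 2
        thus ?thesis using low[of t] high[of "\<alpha> t"] \<alpha>_int[of t] permutes_inverses[OF \<alpha>p] by simp
      next
        case 3
        hence "t = k + (t - k)" "1 \<le> t - k" "t - k \<le> b" by auto
        thus ?thesis using mid[of "t - k"] mid[of "\<beta> (t - k)"] \<beta>_int[of "t - k"] \<beta>(2) by metis
      next
        case 4
        define u where "u = t - (b + k)"
        have u: "t = b + k + u" "1 \<le> u" "u \<le> k" using 4 n by (auto simp: u_def)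
        thus ?thesis
          using high[of u] low[of "inv \<alpha> u"] \<alpha>i_int[of u] permutes_inverses[OF \<alpha>p] by simp
      qed
    qed
    hence "?p \<in> Inv n" using p by (auto simp: Inv_def)
    moreover have "inv \<alpha> k = k" using \<alpha>(2) permutes_inverses(2)[OF \<alpha>p] by metis
    hence "?p n = k" using high[of k] k n by (simp add: ac_simps)
    moreover have "f (k, \<alpha>, \<beta>) = ?p" by (simp add: f_def n(2) flip: b_def)
    ultimately show ?thesis using \<alpha> inner unfolding n(2) b_def[symmetric] by simp
  qed
  have "inj_on f D"
  proof (rule inj_onI)
    fix x y assume xy: "x \<in> D" "y \<in> D" "f x = f y"
    obtain k \<alpha> \<beta> k' \<alpha>' \<beta>' where x: "x = (k, \<alpha>, \<beta>)" and y: "y = (k', \<alpha>', \<beta>')"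
      by (metis prod_cases3)
    note Dx = D[of k \<alpha> \<beta>] and Dy = D[of k' \<alpha>' \<beta>']
    have k: "k' = k" using Dx Dy xy x y by simp
    have eq: "skew k (n - k) \<alpha> (skew (n - 2 * k) k \<beta> (inv \<alpha>)) = skew k (n - k) \<alpha>' (skew (n - 2 * k) k \<beta>' (inv \<alpha>'))"
      using xy(3) x y k by (simp add: f_def)
    have *: "\<alpha> permutes {1..k}" "\<alpha>' permutes {1..k}"
      "skew (n - 2 * k) k \<beta> (inv \<alpha>) permutes {1..n - k}" "skew (n - 2 * k) k \<beta>' (inv \<alpha>') permutes {1..n - k}"
      "\<beta> permutes {1..n - 2 * k}" "\<beta>' permutes {1..n - 2 * k}"
      using Dx Dy xy x y k Av_permutes by (auto simp: D_def Inv_def)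
    have **: "\<alpha> = \<alpha>'" "skew (n - 2 * k) k \<beta> (inv \<alpha>) = skew (n - 2 * k) k \<beta>' (inv \<alpha>')"
      using skew_inj[OF *(1,3,2,4) eq] by auto
    hence "\<beta> = \<beta>'"
      using skew_inj[OF *(5) permutes_inv[OF *(1)] *(6) permutes_inv[OF *(2)]] by auto
    thus "x = y" using x y k ** by simp
  qed
  moreover have "f ` D = {p \<in> Inv n. p n \<noteq> n}"
  proof (intro equalityI subsetI)
    fix p assume "p \<in> f ` D"
    then obtain k \<alpha> \<beta> where *: "(k, \<alpha>, \<beta>) \<in> D" "p = f (k, \<alpha>, \<beta>)" by auto
    moreover have "k \<noteq> n" using *(1) by (auto simp: D_def)
    ultimately show "p \<in> {p \<in> Inv n. p n \<noteq> n}" using D[of k \<alpha> \<beta>] by simp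
  next
    fix p assume "p \<in> {p \<in> Inv n. p n \<noteq> n}"
    hence p: "p \<in> Av n" and pp: "\<And>t. p (p t) = t" and pn: "p n \<noteq> n"
      by (auto simp: Inv_def fun_eq_iff)
    note perm = Av_permutes[OF p]
    define k where "k = p n"
    have n: "1 \<le> n" using permutes_not_in[OF perm, of n] pn by (cases n) auto
    have k: "1 \<le> k" "k \<le> n" using permutes_interval[OF perm, of n] n by (auto simp: k_def)
    have pk: "p k = n" by (simp add: k_def pp)
    have kn: "2 * k \<le> n" using Av_last[OF p k] pk pn k by (simp add: k_def)
    define b where "b = n - 2 * k"
    have nb: "n = k + (b + k)" using kn by (simp add: b_def)
    have "b + k < p x \<longleftrightarrow> x \<le> k" if "1 \<le> x" "x \<le> k + (b + k)" for x
      using Av_max[OF p pk that(1)] that(2) nb by simp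
    then obtain \<alpha> \<gamma> where \<alpha>: "\<alpha> \<in> Av k" and \<gamma>: "\<gamma> \<in> Av (b + k)" and p1: "p = skew k (b + k) \<alpha> \<gamma>"
      using skew_exists[of p k "b + k"] p nb by metis
    have low: "p t = b + k + \<alpha> t" if "1 \<le> t" "t \<le> k" for t
      using that p1 by (simp add: skew_simps)
    have \<gamma>_eq: "\<gamma> t = p (k + t)" if "1 \<le> t" "t \<le> b + k" for t
      using that p1 by (simp add: skew_simps)
    have last: "k < p x \<longleftrightarrow> x \<le> n - k" if "1 \<le> x" "x \<le> n" for x
      using Av_last[OF p that] by (simp add: k_def)
    have "k < \<gamma> t \<longleftrightarrow> t \<le> b" if "1 \<le> t" "t \<le> b + k" for t
    proof -
      have "1 \<le> k + t" "k + t \<le> n" "k + t \<le> n - k \<longleftrightarrow> t \<le> b" using that nb by auto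
      thus ?thesis using last[of "k + t"] \<gamma>_eq[OF that] by simp
    qed
    then obtain \<beta> \<delta> where \<beta>: "\<beta> \<in> Av b" and \<delta>: "\<delta> \<in> Av k" and \<gamma>1: "\<gamma> = skew b k \<beta> \<delta>"
      using skew_exists[of \<gamma> b k] \<gamma> by metis
    note \<alpha>p = Av_permutes[OF \<alpha>] and \<beta>p = Av_permutes[OF \<beta>] and \<delta>p = Av_permutes[OF \<delta>]
    have mid: "p (k + t) = k + \<beta> t" if "1 \<le> t" "t \<le> b" for t
      using that \<gamma>_eq[of t] \<gamma>1 by (simp add: skew_simps)
    have high: "p (b + k + t) = \<delta> t" if "1 \<le> t" "t \<le> k" for t
      using \<gamma>_eq[of "b + t"] skew_simps(2)[of t k b \<beta> \<delta>] \<gamma>1 that by (simp add: ac_simps)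
    have "\<delta> (\<alpha> t) = t" for t
    proof (cases "1 \<le> t \<and> t \<le> k")
      case True
      thus ?thesis using low[of t] high[of "\<alpha> t"] permutes_interval[OF \<alpha>p, of t] pp[of t] by simp
    next
      case False
      thus ?thesis using permutes_not_in[OF \<alpha>p, of t] permutes_not_in[OF \<delta>p, of t] by auto
    qed
    hence \<delta>_eq: "\<delta> = inv \<alpha>"
      using permutes_inverses(1)[OF \<alpha>p] by (metis ext)
    have "\<beta> (\<beta> t) = t" for t
    proof (cases "1 \<le> t \<and> t \<le> b")
      case True
      thus ?thesis using mid[of t] mid[of "\<beta> t"] permutes_interval[OF \<beta>p, of t] pp[of "k + t"] by simp
    next
      case False
      thus ?thesis using permutes_not_in[OF \<beta>p, of t] by auto
    qed
    hence "\<beta> \<in> Inv (n - 2 * k)" using \<beta> by (simp add: Inv_def fun_eq_iff flip: b_def)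
    moreover have "\<alpha> k = k" using low[of k] pk k nb by simp
    hence "\<alpha> \<in> Av (k - 1)" using Av_predI[OF \<alpha>] k by simp
    ultimately have "(k, \<alpha>, \<beta>) \<in> D" using k kn by (simp add: D_def)
    moreover have "f (k, \<alpha>, \<beta>) = p"
    proof -
      have "n - k = b + k" using nb by simp
      thus ?thesis using p1 \<gamma>1 \<delta>_eq by (simp add: f_def flip: b_def)
    qed
    ultimately show "p \<in> f ` D" by (metis imageI)
  qed
  ultimately have "card {p \<in> Inv n. p n \<noteq> n} = card D" by (metis card_image)
  also have "\<dots> = (\<Sum>k | 1 \<le> k \<and> 2 * k \<le> n. card (Av (k - 1)) * card (Inv (n - 2 * k)))"
    unfolding D_def by (subst card_SigmaI) (use fin in \<open>auto simp: finite_Av finite_Inv card_cartesian_product\<close>)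
  finally show ?thesis .
qed

text \<open>
  As \<open>p \<circ> p\<close> sends 1 to a value at most \<open>p n\<close>, it must be increasing on the positions above \<open>p n\<close>,
  which it preserves.
\<close>

lemma square_fixing_max:
  assumes SAv: "p \<in> SAv n" and pn: "p n \<noteq> n" and ppn: "p (p n) = n"
  shows "p \<circ> p = id"
proof
  have Av: "p \<in> Av n" and Av2: "p \<circ> p \<in> Av n" using SAv by (auto simp: SAv_iff)
  note perm = Av_permutes[OF Av]
  define i where "i = p n"
  have n: "1 \<le> n" using permutes_not_in[OF perm, of n] pn by (cases n) auto
  have i: "1 \<le> i" "i \<le> n" using permutes_interval[OF perm, of n] n by (auto simp: i_def)
  have pi: "p i = n" using ppn by (simp add: i_def)
  have first: "n - i < p x \<longleftrightarrow> x \<le> i" if "1 \<le> x" "x \<le> n" for x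
    using Av_max[OF Av pi that] .
  have last: "i < p x \<longleftrightarrow> x \<le> n - i" if "1 \<le> x" "x \<le> n" for x
    using Av_last[OF Av that] by (simp add: i_def)
  have i_half: "i \<le> n - i" using last[OF i] pi i pn by (simp add: i_def)
  have p_range: "1 \<le> p x" "p x \<le> n" if "1 \<le> x" "x \<le> n" for x
    using permutes_interval[OF perm, of x] that by auto
  have upper: "i < p (p x)" if "i < x" "x \<le> n" for x
    using first[of x] last[of "p x"] p_range[of x] that i by simp
  have one: "p (p 1) \<le> i" using first[of 1] last[of "p 1"] p_range[of 1] i n by simp
  have fixed: "p (p x) = x" if "i < x" "x \<le> n" for x
  proof -
    have "p (p x) + (i + 1) = x + (i + 1)"
    proof (rule strict_mono_on_interval_shift[where f = "\<lambda>x. p (p x)" and l = "n - i"])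
      fix x assume x: "i + 1 \<le> x" "x < i + 1 + (n - i)"
      show "i + 1 \<le> p (p x) \<and> p (p x) < i + 1 + (n - i)"
        using upper[of x] p_range[of x] p_range[of "p x"] x i by simp
      fix y assume y: "x < y" "y < i + 1 + (n - i)"
      have "p (p 1) < p (p y)" using one upper[of y] x y i by simp
      thus "p (p x) < p (p y)" using Av_mono[OF Av2, of 1 x y] x y i by simp
    qed (use that i in auto)
    thus ?thesis by simp
  qed
  fix t
  consider "t = 0 \<or> n < t" | "1 \<le> t" "t \<le> i" | "i < t" "t \<le> n" by linarith
  thus "(p \<circ> p) t = id t"
  proof cases
    case 1 thus ?thesis using permutes_not_in[OF perm, of t] by auto
  next
    case 2
    \<comment> \<open>The first \<open>i\<close> positions are sent above
      \<open>n - i \<ge> i\<close>, where the square is already known to be the identity.\<close>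
    hence "p (p (p t)) = p t" using fixed[of "p t"] first[of t] p_range[of t] i i_half by simp
    thus ?thesis using permutes_eq_iff[OF perm] by simp
  next
    case 3 thus ?thesis using fixed by simp
  qed
qed

section \<open>Counting by the number of cuts\<close>

lemma rank_exists:
  fixes A :: "nat set"
  assumes "finite A" "1 \<le> c" "c \<le> card A"
  shows "\<exists>!q. q \<in> A \<and> card {a \<in> A. a \<le> q} = c"
proof (rule ex_ex1I)
  show "\<exists>q. q \<in> A \<and> card {a \<in> A. a \<le> q} = c"
    using assms
  proof (induction "card A" arbitrary: A)
    case (Suc d)
    define M where "M = Max A"
    have M: "M \<in> A" "\<And>a. a \<in> A \<Longrightarrow> a \<le> M"
    proof -
      have "A \<noteq> {}" using Suc.hyps(2) by auto
      thus "M \<in> A" "\<And>a. a \<in> A \<Longrightarrow> a \<le> M" using Suc.prems(1) by (simp_all add: M_def)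
    qed
    show ?case
    proof (cases "c = card A")
      case True
      have "{a \<in> A. a \<le> M} = A" using M by auto
      thus ?thesis using M True by auto
    next
      case False
      have card: "d = card (A - {M})" using Suc M by simp
      moreover have "c \<le> card (A - {M})" using Suc False card by simp
      ultimately obtain q where q: "q \<in> A - {M}" "card {a \<in> A - {M}. a \<le> q} = c"
        using Suc.hyps(1)[of "A - {M}"] Suc.prems by auto
      have "{a \<in> A - {M}. a \<le> q} = {a \<in> A. a \<le> q}" using q M(2)[of q] by auto
      thus ?thesis using q by auto
    qed
  qed simp
next
  have *: "\<not> q < q'" if "q \<in> A \<and> card {a \<in> A. a \<le> q} = c" "q' \<in> A \<and> card {a \<in> A. a \<le> q'} = c" for q q'
  proof
    assume "q < q'"
    hence "{a \<in> A. a \<le> q} \<subseteq> {a \<in> A. a \<le> q'}" "q' \<in> {a \<in> A. a \<le> q'} - {a \<in> A. a \<le> q}"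
      using that by auto
    hence "{a \<in> A. a \<le> q} \<subset> {a \<in> A. a \<le> q'}" by blast
    hence "card {a \<in> A. a \<le> q} < card {a \<in> A. a \<le> q'}"
      using assms(1) by (intro psubset_card_mono) auto
    thus False using that by simp
  qed
  show "q = q'" if "q \<in> A \<and> card {a \<in> A. a \<le> q} = c" "q' \<in> A \<and> card {a \<in> A. a \<le> q'} = c" for q q'
    using *[OF that] *[OF that(2,1)] by simp
qed

text \<open>The \<open>c\<close>-th smallest element, counted from 1; it selects the cut at which a
  shell is inserted.\<close>

definition rank_elem :: "nat \<Rightarrow> nat set \<Rightarrow> nat" where
  "rank_elem c A = (THE q. q \<in> A \<and> card {a \<in> A. a \<le> q} = c)"

lemma rank_elem:
  assumes "finite A" "1 \<le> c" "c \<le> card A"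
  shows "rank_elem c A \<in> A" "card {a \<in> A. a \<le> rank_elem c A} = c"
  using theI'[OF rank_exists[OF assms]] by (auto simp: rank_elem_def)

lemma rank_elem_eq:
  assumes "finite A" "1 \<le> c" "q \<in> A" "card {a \<in> A. a \<le> q} = c"
  shows "c \<le> card A" "rank_elem c A = q"
proof -
  show c: "c \<le> card A" using card_mono[of A "{a \<in> A. a \<le> q}"] assms by auto
  show "rank_elem c A = q"
    unfolding rank_elem_def by (rule the1_equality[OF rank_exists[OF assms(1,2) c]]) (use assms in auto)
qed

text \<open>A shell can be inserted at the \<open>c\<close>-th cut exactly when there are at least
  \<open>c\<close> cuts, so the recurrence closes on these cumulative classes.\<close>

definition many_cuts :: "nat \<Rightarrow> nat \<Rightarrow> (nat \<Rightarrow> nat) set" where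
  "many_cuts c n = {p \<in> SAv n. c \<le> card (cuts n p)}"

lemma finite_many_cuts: "finite (many_cuts c n)"
  by (rule finite_subset[OF _ finite_SAv[of n]]) (auto simp: many_cuts_def)

lemma SAv_permutes: "p \<in> SAv n \<Longrightarrow> p permutes {1..n}"
  by (simp add: SAv_def)

lemma many_cuts_1: "many_cuts 1 n = SAv n"
proof -
  have "1 \<le> card (cuts n p)" if "p \<in> SAv n" for p
    using zero_in_cuts[OF SAv_permutes[OF that]] finite_cuts[of n p] by (auto simp: Suc_le_eq card_gt_0_iff)
  thus ?thesis by (auto simp: many_cuts_def)
qed

text \<open>Cuts lie in \<open>{0..n}\<close>. This bound later discards one of the two
  characteristic roots.\<close>

lemma many_cuts_empty:
  assumes "n + 1 < c"
  shows "many_cuts c n = {}"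
proof -
  have "card (cuts n p) \<le> n + 1" for p
    using card_mono[of "{..n}" "cuts n p"] by (auto simp: cuts_def)
  hence "card (cuts n p) < c" for p using assms le_less_trans by blast
  thus ?thesis by (auto simp: many_cuts_def not_le)
qed

lemma positive_cut:
  assumes "p \<in> SAv n"
  shows "2 \<le> card (cuts n p) \<longleftrightarrow> (\<exists>Q\<in>cuts n p. 1 \<le> Q)"
proof
  assume "2 \<le> card (cuts n p)"
  moreover have "card (cuts n p) \<le> 1" if "cuts n p \<subseteq> {0}" using card_mono[OF _ that] by simp
  ultimately have "\<not> cuts n p \<subseteq> {0}" by linarith
  thus "\<exists>Q\<in>cuts n p. 1 \<le> Q" by (metis Suc_le_eq One_nat_def singletonI subsetI gr0I)
next
  assume "\<exists>Q\<in>cuts n p. 1 \<le> Q"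
  then obtain Q where "Q \<in> cuts n p" "1 \<le> Q" by blast
  hence "{0, Q} \<subseteq> cuts n p" "card {0, Q} = 2"
    using zero_in_cuts[OF SAv_permutes[OF assms]] by auto
  thus "2 \<le> card (cuts n p)" using card_mono[OF finite_cuts] by metis
qed

text \<open>Wrapping an indecomposable shell around \<open>p\<close> at its \<open>c\<close>-th cut
  is a bijection onto the permutations with \<open>c + 1\<close> cuts: \<open>cuts_shell\<close>
  counts the cuts, \<open>shell_exists\<close> finds the outermost shell, and the rank of its cut is
  recovered from the number of cuts.\<close>

lemma card_shells:
  assumes c: "1 \<le> c"
  shows "card {P \<in> SAv n. card (cuts n P) = c + 1} =
    (\<Sum>k | 1 \<le> k \<and> 3 * k \<le> n. card (Av (k - 1)) * card (many_cuts c (n - 3 * k)))"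
proof -
  let ?q = "\<lambda>k p. rank_elem c (cuts (n - 3 * k) p)"
  define f where "f = (\<lambda>(k, \<alpha>, p). make_shell (n - 3 * k) k (?q k p) \<alpha> p)"
  define D where "D = (SIGMA k:{k. 1 \<le> k \<and> 3 * k \<le> n}. Av (k - 1) \<times> many_cuts c (n - 3 * k))"
  have fin: "finite {k. 1 \<le> k \<and> 3 * k \<le> n}" by (rule finite_subset[of _ "{..n}"]) auto
  have D: "1 \<le> k \<and> 3 * k \<le> n \<and> \<alpha> k = k \<and> \<alpha> \<in> Av k \<and> p \<in> SAv (n - 3 * k) \<and>
      ?q k p \<in> cuts (n - 3 * k) p \<and> card {a \<in> cuts (n - 3 * k) p. a \<le> ?q k p} = c \<and>
      shell (n - 3 * k) k (?q k p) \<alpha> p (f (k, \<alpha>, p))"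
    if "(k, \<alpha>, p) \<in> D" for k \<alpha> p
  proof -
    have *: "1 \<le> k" "3 * k \<le> n" "\<alpha> \<in> Av (k - 1)" "p \<in> SAv (n - 3 * k)" "c \<le> card (cuts (n - 3 * k) p)"
      using that by (auto simp: D_def many_cuts_def)
    note \<alpha> = Av_pred[OF *(3,1)]
    note q = rank_elem[OF finite_cuts c *(5)]
    have "shell (n - 3 * k) k (?q k p) \<alpha> p (f (k, \<alpha>, p))"
      unfolding f_def prod.case
      by (rule shell_make_shell[OF Av_permutes[OF \<alpha>(1)] SAv_permutes[OF *(4)] cutsD(1)[OF q(1)]])
    thus ?thesis using * \<alpha> q by simp
  qed
  have "inj_on f D"
  proof (rule inj_onI)
    fix x y assume xy: "x \<in> D" "y \<in> D" "f x = f y"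
    obtain k \<alpha> p k' \<alpha>' p' where x: "x = (k, \<alpha>, p)" and y: "y = (k', \<alpha>', p')"
      by (metis prod_cases3)
    note Dx = D[of k \<alpha> p] and Dy = D[of k' \<alpha>' p']
    have "k = k' \<and> \<alpha> = \<alpha>' \<and> p = p'"
      using shell_inj[of "n - 3 * k" k "?q k p" \<alpha> p "f x" "n - 3 * k'" k' "?q k' p'" \<alpha>' p'] Dx Dy xy x y
      by simp
    thus "x = y" using x y by simp
  qed
  moreover have "f ` D = {P \<in> SAv n. card (cuts n P) = c + 1}"
  proof (intro equalityI subsetI)
    fix P assume "P \<in> f ` D"
    then obtain k \<alpha> p where x: "(k, \<alpha>, p) \<in> D" "P = f (k, \<alpha>, p)" by auto
    define m where "m = n - 3 * k"
    define q where "q = ?q k p"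
    note Dx = D[OF x(1), folded q_def, folded m_def]
    have n: "n = m + 3 * k" using Dx by (simp add: m_def)
    interpret shell m k q \<alpha> p P using Dx x(2) by simp
    have k: "1 \<le> k" and q: "q \<in> cuts m p" using Dx by auto
    have "P \<in> SAv n" using shell_SAv_iff[OF k] Dx n by simp
    moreover have "card (cuts n P) = c + 1"
    proof -
      have "cuts n P = insert 0 ((\<lambda>q'. k + q') ` {q' \<in> cuts m p. q' \<le> q})"
        using cuts_shell[OF q k] Dx n by simp
      also have "card \<dots> = Suc (card ((\<lambda>q'. k + q') ` {q' \<in> cuts m p. q' \<le> q}))"
        using finite_cuts[of m p] k by (intro card_insert_disjoint) auto
      also have "\<dots> = Suc (card {q' \<in> cuts m p. q' \<le> q})"
        by (subst card_image) auto
      finally show ?thesis using Dx by simp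
    qed
    ultimately show "P \<in> {P \<in> SAv n. card (cuts n P) = c + 1}" by simp
  next
    fix P assume "P \<in> {P \<in> SAv n. card (cuts n P) = c + 1}"
    hence P: "P \<in> SAv n" "card (cuts n P) = c + 1" by auto
    then obtain Q where "Q \<in> cuts n P" "1 \<le> Q" using positive_cut[of P n] c by auto
    moreover have "P \<in> Av n" using P by (simp add: SAv_iff)
    ultimately obtain m k q \<alpha> p where s: "n = m + 3 * k" "1 \<le> k" "\<alpha> k = k" "shell m k q \<alpha> p P"
      using shell_exists by metis
    have m: "n - 3 * k = m" using s by simp
    interpret shell m k q \<alpha> p P by (rule s(4))
    have *: "p \<in> SAv m" "\<alpha> \<in> Av k" "q \<in> cuts m p" using shell_SAv_iff[OF s(2)] P s(1) by auto
    have "cuts n P = insert 0 ((\<lambda>q'. k + q') ` {q' \<in> cuts m p. q' \<le> q})"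
      using cuts_shell[OF *(3) s(2,3)] s(1) by simp
    also have "card \<dots> = Suc (card ((\<lambda>q'. k + q') ` {q' \<in> cuts m p. q' \<le> q}))"
      using finite_cuts[of m p] s(2) by (intro card_insert_disjoint) auto
    also have "\<dots> = Suc (card {q' \<in> cuts m p. q' \<le> q})"
      by (subst card_image) auto
    finally have "card {q' \<in> cuts m p. q' \<le> q} = c" using P(2) by simp
    note r = rank_elem_eq[OF finite_cuts c *(3) this]
    have "(k, \<alpha>, p) \<in> D"
      using s Av_predI[OF *(2) s(3,2)] * r m by (simp add: D_def many_cuts_def)
    moreover from D[OF this] have "f (k, \<alpha>, p) = P"
      using shell_unique[of m k q \<alpha> p "f (k, \<alpha>, p)" P] s(4) m r by simp
    ultimately show "P \<in> f ` D" by (metis imageI)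
  qed
  ultimately have "card {P \<in> SAv n. card (cuts n P) = c + 1} = card D" by (metis card_image)
  also have "\<dots> = (\<Sum>k | 1 \<le> k \<and> 3 * k \<le> n. card (Av (k - 1)) * card (many_cuts c (n - 3 * k)))"
    unfolding D_def
    by (subst card_SigmaI) (use fin in \<open>auto simp: finite_Av finite_many_cuts card_cartesian_product\<close>)
  finally show ?thesis .
qed

lemma card_many_cuts:
  assumes "1 \<le> c"
  shows "card (many_cuts (c + 1) n) = card (many_cuts (c + 2) n) +
    (\<Sum>k | 1 \<le> k \<and> 3 * k \<le> n. card (Av (k - 1)) * card (many_cuts c (n - 3 * k)))"
proof -
  have "many_cuts (c + 1) n = many_cuts (c + 2) n \<union> {P \<in> SAv n. card (cuts n P) = c + 1}"
    by (auto simp: many_cuts_def)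
  moreover have "many_cuts (c + 2) n \<inter> {P \<in> SAv n. card (cuts n P) = c + 1} = {}"
    by (auto simp: many_cuts_def)
  ultimately have "card (many_cuts (c + 1) n) =
      card (many_cuts (c + 2) n) + card {P \<in> SAv n. card (cuts n P) = c + 1}"
    using card_Un_disjoint[OF finite_many_cuts[of "c + 2" n], of "{P \<in> SAv n. card (cuts n P) = c + 1}"]
      finite_SAv[of n] by simp
  thus ?thesis using card_shells[OF assms] by simp
qed

section \<open>Twisted rotations and the total count\<close>

definition rotations :: "nat \<Rightarrow> (nat \<Rightarrow> nat) set" where
  "rotations n = (\<lambda>(k, \<alpha>). skew k (n - k) \<alpha> (inv \<alpha>)) `
     (SIGMA k:{k. 1 \<le> k \<and> 2 * k < n \<and> n \<noteq> 3 * k}. Av (min k (n - 2 * k)))"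

text \<open>Because the support of \<open>\<alpha>\<close> fits into both \<open>k\<close> and
  \<open>n - 2 * k\<close>, the two twists do not interfere in the square: it consists of
  \<open>\<alpha>\<close> followed by an increasing run of length \<open>k\<close>, all lying above
  a final block \<open>inv \<alpha>\<close> of size \<open>n - 2 * k\<close>.\<close>

lemma rotation_props:
  assumes k: "1 \<le> k" "2 * k < n" "n \<noteq> 3 * k" and \<alpha>: "\<alpha> \<in> Av (min k (n - 2 * k))"
  defines "p \<equiv> skew k (n - k) \<alpha> (inv \<alpha>)"
  shows "p \<in> SAv n" and "p n = n - k" and "inv p n \<le> k" and "p (p (p n)) \<noteq> n"
proof -
  define h where "h = min k (n - 2 * k)"
  have h: "1 \<le> h" "h \<le> k" "h \<le> n - 2 * k" "h = k \<or> h = n - 2 * k" using k by (auto simp: h_def)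
  have \<alpha>h: "\<alpha> \<in> Av h" using \<alpha> by (simp add: h_def)
  have \<alpha>_Av: "\<alpha> \<in> Av k" "inv \<alpha> \<in> Av (n - k)" "inv \<alpha> \<in> Av (n - 2 * k)"
  proof -
    have "h \<le> n - k" using h k by simp
    thus "\<alpha> \<in> Av k" "inv \<alpha> \<in> Av (n - k)" "inv \<alpha> \<in> Av (n - 2 * k)"
      using \<alpha>h inv_in_Av[OF \<alpha>h] Av_mono_subset[OF h(2)] Av_mono_subset[OF h(3)] Av_mono_subset[of h "n - k"]
      by blast+
  qed
  note \<alpha>p = Av_permutes[OF \<alpha>h]
  have fixed: "\<alpha> t = t" "inv \<alpha> t = t" if "h < t" for t
    using permutes_not_in[OF \<alpha>p, of t] permutes_not_in[OF permutes_inv[OF \<alpha>p], of t] that by auto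
  have range: "1 \<le> \<alpha> t" "\<alpha> t \<le> k" if "1 \<le> t" "t \<le> k" for t
    using permutes_interval[OF Av_permutes[OF \<alpha>_Av(1)], of t] that by auto
  have range': "1 \<le> inv \<alpha> t" "inv \<alpha> t \<le> n - 2 * k" if "1 \<le> t" "t \<le> n - 2 * k" for t
    using permutes_interval[OF Av_permutes[OF \<alpha>_Av(3)], of t] that by auto
  have n: "k + (n - k) = n" using k by simp
  have Av: "p \<in> Av n" unfolding p_def using skew_in_Av[OF \<alpha>_Av(1,2)] n by simp
  note perm = Av_permutes[OF Av]
  have low: "p t = n - k + \<alpha> t" if "1 \<le> t" "t \<le> k" for t
    using that by (simp add: p_def skew_simps)
  have high: "p t = inv \<alpha> (t - k)" if "k < t" "t \<le> n" for t
    using skew_simps(2)[of "t - k" "n - k" k \<alpha> "inv \<alpha>"] that k by (simp add: p_def)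
  have low2: "p (p t) = n - 2 * k + \<alpha> t" if t: "1 \<le> t" "t \<le> k" for t
  proof -
    have "k < n - k + \<alpha> t" "n - k + \<alpha> t \<le> n" "n - k + \<alpha> t - k = n - 2 * k + \<alpha> t"
      using range[OF t] k by simp_all
    moreover have "h < n - 2 * k + \<alpha> t" using h(3) range[OF t] by simp
    ultimately show ?thesis using low[OF t] high[of "n - k + \<alpha> t"] fixed by simp
  qed
  have mid2: "p (p t) = n - 2 * k + t" if t: "k < t" "t \<le> 2 * k" for t
  proof -
    have u: "1 \<le> inv \<alpha> (t - k)" "inv \<alpha> (t - k) \<le> k"
      using permutes_interval[OF permutes_inv[OF Av_permutes[OF \<alpha>_Av(1)]], of "t - k"] t by auto
    have "p (p t) = n - k + \<alpha> (inv \<alpha> (t - k))" using high[of t] low[OF u] t k by simp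
    thus ?thesis using permutes_inverses(1)[OF \<alpha>p] t k by simp
  qed
  have high2: "p (p t) = inv \<alpha> (t - 2 * k)" if t: "2 * k < t" "t \<le> n" for t
  proof -
    have "p t = t - k" using high[of t] fixed[of "t - k"] t h by simp
    moreover have "t - k - k = t - 2 * k" by simp
    ultimately show ?thesis using high[of "t - k"] t by simp
  qed
  have "p \<circ> p \<in> Av n"
  proof (rule AvI[OF permutes_compose[OF perm perm]])
    fix a b c assume *: "1 \<le> a" "a < b" "b < c" "c \<le> n" "(p \<circ> p) a < (p \<circ> p) c" "(p \<circ> p) c < (p \<circ> p) b"
    have pp: "p (p a) < p (p c)" "p (p c) < p (p b)" using *(5,6) by auto
    have top_le: "p (p t) \<le> n - 2 * k" if "2 * k < t" "t \<le> n" for t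
      using high2[OF that] range'[of "t - 2 * k"] that by simp
    consider "a \<le> k" | "k < a" "a \<le> 2 * k" | "2 * k < a" by linarith
    thus False
    proof cases
      case 1
      have a: "p (p a) = n - 2 * k + \<alpha> a" "1 \<le> \<alpha> a" using low2[of a] range[of a] 1 * by auto
      hence c: "c \<le> 2 * k" using top_le[of c] pp * by fastforce
      show False
      proof (cases "c \<le> k")
        case True
        thus False using Av_mono[OF \<alpha>_Av(1), of a b c] low2[of a] low2[of b] low2[of c] pp * by simp
      next
        case False
        hence "p (p c) = n - 2 * k + c" using mid2[of c] c by simp
        thus False using pp(2) low2[of b] mid2[of b] range[of b] False c * by (cases "b \<le> k") auto
      qed
    next
      case 2
      have "c \<le> 2 * k" using top_le[of c] mid2[of a] pp * 2 by fastforce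
      thus False using mid2[of b] mid2[of c] pp 2 * by simp
    next
      case 3
      hence "1 \<le> a - 2 * k" "a - 2 * k < b - 2 * k" "b - 2 * k < c - 2 * k" "c - 2 * k \<le> n - 2 * k"
        using * by auto
      thus False
        using Av_mono[OF \<alpha>_Av(3), of "a - 2 * k" "b - 2 * k" "c - 2 * k"]
          high2[of a] high2[of b] high2[of c] pp * 3 by simp
    qed
  qed
  thus "p \<in> SAv n" using Av by (simp add: SAv_iff)
  show pn: "p n = n - k" using high[of n] fixed[of "n - k"] h k by simp
  define i where "i = inv p n"
  have pi: "p i = n" using permutes_inverses[OF perm] by (simp add: i_def)
  have "1 \<le> i" "i \<le> n" using permutes_interval[OF perm, of i] pi k by auto
  moreover have "p t \<noteq> n" if "k < t" "t \<le> n" for t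
  proof -
    have "t - k \<le> n - k" using that by simp
    hence "inv \<alpha> (t - k) \<le> n - k"
      using permutes_interval(2)[OF Av_permutes[OF \<alpha>_Av(2)], of "t - k"] by simp
    thus ?thesis using high[OF that] k by linarith
  qed
  ultimately show "inv p n \<le> k" using pi unfolding i_def by (meson not_le)
  \<comment> \<open>For \<open>h = k\<close> the orbit of \<open>n\<close> descends through
    \<open>n - k\<close> and \<open>n - 2 * k\<close> to a value at most \<open>n - 2 * k\<close>;
    for \<open>h = n - 2 * k < k\<close> it ends at \<open>n - k + h\<close>.\<close>
  show "p (p (p n)) \<noteq> n"
  proof (cases "h = k")
    case True
    hence n3: "3 * k < n" using h k by simp
    have "n - k - k = n - 2 * k" "n - 2 * k - k = n - 3 * k" by simp_all
    hence "p (n - k) = n - 2 * k" and "p (n - 2 * k) = inv \<alpha> (n - 3 * k)"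
      using high[of "n - k"] high[of "n - 2 * k"] fixed[of "n - 2 * k"] n3 True by simp_all
    moreover have "inv \<alpha> (n - 3 * k) \<le> n - 2 * k" using range'[of "n - 3 * k"] n3 by simp
    ultimately show ?thesis using pn k by simp
  next
    case False
    hence hn: "h = n - 2 * k" "h < k" using h by auto
    have u: "1 \<le> inv \<alpha> h" "inv \<alpha> h \<le> h"
      using permutes_interval[OF permutes_inv[OF \<alpha>p], of h] h by auto
    have "n - k - k = h" using hn by simp
    hence "p (n - k) = inv \<alpha> h" using high[of "n - k"] k by simp
    moreover have "p (inv \<alpha> h) = n - k + h"
      using low[of "inv \<alpha> h"] u hn permutes_inverses(1)[OF \<alpha>p] by simp
    ultimately show ?thesis using pn hn k by simp
  qed
qed

lemma card_rotations:
  "card (rotations n) = (\<Sum>k | 1 \<le> k \<and> 2 * k < n \<and> n \<noteq> 3 * k. card (Av (min k (n - 2 * k))))"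
proof -
  let ?K = "{k. 1 \<le> k \<and> 2 * k < n \<and> n \<noteq> 3 * k}"
  have fin: "finite ?K" by (rule finite_subset[of _ "{..n}"]) auto
  have "inj_on (\<lambda>(k, \<alpha>). skew k (n - k) \<alpha> (inv \<alpha>)) (SIGMA k:?K. Av (min k (n - 2 * k)))"
  proof (rule inj_onI, clarify)
    fix k \<alpha> k' \<alpha>'
    assume k: "1 \<le> k" "2 * k < n" "n \<noteq> 3 * k" and k': "1 \<le> k'" "2 * k' < n" "n \<noteq> 3 * k'"
      and \<alpha>: "\<alpha> \<in> Av (min k (n - 2 * k))" and \<alpha>': "\<alpha>' \<in> Av (min k' (n - 2 * k'))"
      and eq: "skew k (n - k) \<alpha> (inv \<alpha>) = skew k' (n - k') \<alpha>' (inv \<alpha>')"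
    have kk: "k = k'" using rotation_props(2)[OF k \<alpha>] rotation_props(2)[OF k' \<alpha>'] eq k k' by simp
    have sub: "Av (min k (n - 2 * k)) \<subseteq> Av k" "Av (min k (n - 2 * k)) \<subseteq> Av (n - k)"
      using k by (auto intro!: Av_mono_subset)
    have \<alpha>'k: "\<alpha>' \<in> Av (min k (n - 2 * k))" using \<alpha>' kk by simp
    note perm = Av_permutes[OF subsetD[OF sub(1) \<alpha>]] Av_permutes[OF subsetD[OF sub(1) \<alpha>'k]]
      permutes_inv[OF Av_permutes[OF subsetD[OF sub(2) \<alpha>]]]
      permutes_inv[OF Av_permutes[OF subsetD[OF sub(2) \<alpha>'k]]]
    show "k = k' \<and> \<alpha> = \<alpha>'" using skew_inj[OF perm(1,3,2,4)] eq kk by simp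
  qed
  hence "card (rotations n) = card (SIGMA k:?K. Av (min k (n - 2 * k)))"
    unfolding rotations_def by (rule card_image)
  also have "\<dots> = (\<Sum>k\<in>?K. card (Av (min k (n - 2 * k))))"
    using fin by (subst card_SigmaI) (auto simp: finite_Av)
  finally show ?thesis .
qed

definition rising :: "nat \<Rightarrow> (nat \<Rightarrow> nat) set" where
  "rising n = {p \<in> SAv n. inv p n < p n}"

text \<open>For the reverse inclusion the outermost shell shows the orbit of the maximum:
  \<open>k\<close> goes to \<open>n\<close>, which goes to \<open>m - q + 2 * k > k\<close>.\<close>

lemma rising_eq: "rising n = many_cuts 2 n \<union> rotations n"
proof (intro equalityI subsetI)
  fix p assume p: "p \<in> rising n"
  hence SAv: "p \<in> SAv n" by (simp add: rising_def)
  interpret rising_max n p "inv p n" "p n"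
    using p permutes_inverses[OF SAv_permutes[OF SAv]] by unfold_locales (auto simp: rising_def)
  from rising_classification show "p \<in> many_cuts 2 n \<union> rotations n"
  proof
    assume "\<exists>q\<in>cuts n p. 1 \<le> q"
    thus ?thesis using positive_cut[OF SAv] SAv by (simp add: many_cuts_def)
  next
    assume "\<exists>k \<alpha>. 1 \<le> k \<and> 2 * k < n \<and> n \<noteq> 3 * k \<and> \<alpha> \<in> Av (min k (n - 2 * k)) \<and>
     p = skew k (n - k) \<alpha> (inv \<alpha>)"
    thus ?thesis unfolding rotations_def by force
  qed
next
  fix p assume "p \<in> many_cuts 2 n \<union> rotations n"
  thus "p \<in> rising n"
  proof
    assume "p \<in> many_cuts 2 n"
    hence SAv: "p \<in> SAv n" and "2 \<le> card (cuts n p)" by (auto simp: many_cuts_def)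
    then obtain Q where "Q \<in> cuts n p" "1 \<le> Q" using positive_cut by blast
    moreover have "p \<in> Av n" using SAv by (simp add: SAv_iff)
    ultimately obtain m k q \<alpha> p' where s: "n = m + 3 * k" "1 \<le> k" "\<alpha> k = k" "shell m k q \<alpha> p' p"
      using shell_exists by metis
    interpret shell m k q \<alpha> p' p by (rule s(4))
    have "p k = n" using P_low[of k] s by simp
    hence "inv p n = k" using permutes_inverses(2)[OF SAv_permutes[OF SAv]] by metis
    moreover have "p n = m - q + 2 * k" using P_n[OF s(2)] s(1) by simp
    ultimately show ?thesis using SAv s(2) by (simp add: rising_def)
  next
    assume "p \<in> rotations n"
    then obtain k \<alpha> where k: "1 \<le> k" "2 * k < n" "n \<noteq> 3 * k" "\<alpha> \<in> Av (min k (n - 2 * k))"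
      "p = skew k (n - k) \<alpha> (inv \<alpha>)" by (auto simp: rotations_def)
    thus ?thesis using rotation_props[OF k(1-4)] by (simp add: rising_def)
  qed
qed

text \<open>A positive cut puts \<open>n\<close> on a three-cycle, which never happens for a member
  of \<open>rotations n\<close>; so the union in \<open>rising_eq\<close> is disjoint.\<close>

lemma card_rising: "card (rising n) = card (many_cuts 2 n) + card (rotations n)"
proof -
  have "many_cuts 2 n \<inter> rotations n = {}"
  proof (rule ccontr)
    assume "many_cuts 2 n \<inter> rotations n \<noteq> {}"
    then obtain p where p: "p \<in> many_cuts 2 n" "p \<in> rotations n" by blast
    have SAv: "p \<in> SAv n" using p by (simp add: many_cuts_def)
    obtain Q where Q: "Q \<in> cuts n p" "1 \<le> Q"
      using p positive_cut[OF SAv] by (auto simp: many_cuts_def)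
    obtain k \<alpha> where k: "1 \<le> k" "2 * k < n" "n \<noteq> 3 * k" "\<alpha> \<in> Av (min k (n - 2 * k))"
      "p = skew k (n - k) \<alpha> (inv \<alpha>)" using p by (auto simp: rotations_def)
    have "p (p (p n)) = n" using cutsD(5)[OF Q(1), of n] Q(2) k by simp
    thus False using rotation_props(4)[OF k(1-4)] k(5) by simp
  qed
  moreover have "finite (rotations n)"
    unfolding rising_eq[symmetric] using finite_subset[OF _ finite_SAv[of n], of "rising n"]
      rising_eq[of n] by (metis (no_types, lifting) finite_Un mem_Collect_eq rising_def subsetI)
  ultimately show ?thesis unfolding rising_eq by (simp add: card_Un_disjoint finite_many_cuts)
qed

text \<open>The middle summand is the class with \<open>n\<close> on a two-cycle:
  \<open>square_fixing_max\<close> makes its members involutions, and conversely an involution has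
  square \<open>id\<close>, which avoids 132. The factor 2 comes from the bijection
  \<open>inv\<close>.\<close>

lemma card_SAv:
  assumes n: "1 \<le> n"
  shows "card (SAv n) = card (SAv (n - 1)) + card {p \<in> Inv n. p n \<noteq> n} + 2 * card (rising n)"
proof -
  define F where "F = {p \<in> SAv n. inv p n > p n}"
  have inv_inv: "inv (inv p) = p" if "p \<in> SAv n" for p
    by (rule permutes_inv_inv[OF SAv_permutes[OF that]])
  have "bij_betw inv (rising n) F"
  proof (rule bij_betw_byWitness[where f' = inv])
    show "inv ` rising n \<subseteq> F" using inv_in_SAv inv_inv by (auto simp: rising_def F_def)
    show "inv ` F \<subseteq> rising n" using inv_in_SAv inv_inv by (auto simp: rising_def F_def)
  qed (use inv_inv in \<open>auto simp: rising_def F_def\<close>)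
  hence card_F: "card F = card (rising n)" using bij_betw_same_card by metis
  have eq_iff: "inv p n = p n \<longleftrightarrow> p (p n) = n" if "p \<in> SAv n" for p
    using permutes_inv_eq[OF SAv_permutes[OF that], of n "p n"] by auto
  have Inv: "{p \<in> Inv n. p n \<noteq> n} = {p \<in> SAv n. p n \<noteq> n \<and> inv p n = p n}"
  proof (intro equalityI subsetI)
    fix p assume "p \<in> {p \<in> Inv n. p n \<noteq> n}"
    hence "p \<in> Av n" "p \<circ> p = id" "p n \<noteq> n" by (auto simp: Inv_def)
    moreover from this have "p \<in> SAv n" by (simp add: SAv_iff id_in_Av)
    moreover have "p (p n) = n" using \<open>p \<circ> p = id\<close> by (simp add: fun_eq_iff)
    ultimately show "p \<in> {p \<in> SAv n. p n \<noteq> n \<and> inv p n = p n}" using eq_iff by simp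
  next
    fix p assume "p \<in> {p \<in> SAv n. p n \<noteq> n \<and> inv p n = p n}"
    hence p: "p \<in> SAv n" "p n \<noteq> n" "p (p n) = n" using eq_iff by auto
    thus "p \<in> {p \<in> Inv n. p n \<noteq> n}" using square_fixing_max[OF p] by (simp add: Inv_def SAv_iff)
  qed
  define A where "A = {p \<in> SAv n. p n = n}"
  define B where "B = {p \<in> SAv n. p n \<noteq> n \<and> inv p n = p n}"
  have "inv p n = n" if "p \<in> A" for p
    using that permutes_inv_eq[OF SAv_permutes[of p n], of n n] by (auto simp: A_def)
  hence "SAv n = A \<union> B \<union> rising n \<union> F" "A \<inter> B = {}" "(A \<union> B) \<inter> rising n = {}" "(A \<union> B \<union> rising n) \<inter> F = {}"
    unfolding A_def B_def F_def rising_def by force+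
  moreover have "finite A" "finite B" "finite F" "finite (rising n)"
    using finite_SAv[of n] by (auto simp: A_def B_def F_def rising_def)
  ultimately have "card (SAv n) = card A + card B + card (rising n) + card F"
    by (simp add: card_Un_disjoint)
  moreover have "A = SAv (n - 1)" unfolding A_def by (rule SAv_fix_last[OF n])
  ultimately show ?thesis using card_F Inv B_def by simp
qed

section \<open>Generating functions\<close>

unbundle fps_syntax

section \<open>Composition with powers of the variable, and the Catalan equation\<close>

lemma fps_compose_X_power_nth:
  fixes f :: "'a :: comm_ring_1 fps"
  assumes "1 \<le> d"
  shows "(f oo fps_X ^ d) $ i = (if d dvd i then f $ (i div d) else 0)"
proof -
  have "(f oo fps_X ^ d) $ i = (\<Sum>k = 0..i. f $ k * (if i = d * k then 1 else 0))"
    by (simp add: fps_compose_nth power_mult[symmetric])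
  also have "\<dots> = (\<Sum>k = 0..i. if k = i div d \<and> d dvd i then f $ k else 0)"
    by (rule sum.cong) (use assms in auto)
  also have "\<dots> = (if d dvd i then f $ (i div d) else 0)"
    by (auto simp: sum.delta)
  finally show ?thesis .
qed

lemma fps_compose_X_power_mult_nth:
  fixes f g :: "'a :: comm_ring_1 fps"
  assumes d: "1 \<le> d"
  shows "((f oo fps_X ^ d) * g) $ n = (\<Sum>k | d * k \<le> n. f $ k * g $ (n - d * k))"
proof -
  have "((f oo fps_X ^ d) * g) $ n = (\<Sum>i = 0..n. (f oo fps_X ^ d) $ i * g $ (n - i))"
    by (simp add: fps_mult_nth)
  also have "\<dots> = (\<Sum>i | i \<le> n \<and> d dvd i. (f oo fps_X ^ d) $ i * g $ (n - i))"
    by (rule sum.mono_neutral_right) (auto simp: fps_compose_X_power_nth[OF d])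
  also have "\<dots> = (\<Sum>k | d * k \<le> n. f $ k * g $ (n - d * k))"
    by (rule sum.reindex_bij_witness[where i = "\<lambda>k. d * k" and j = "\<lambda>i. i div d"])
      (use d in \<open>auto simp: fps_compose_X_power_nth[OF d]\<close>)
  finally show ?thesis .
qed

lemma fps_X_mult_compose_X_power:
  fixes f :: "'a :: idom fps"
  assumes "1 \<le> d"
  shows "(fps_X * f) oo fps_X ^ d = fps_X ^ d * (f oo fps_X ^ d)"
  using assms by (subst fps_compose_mult_distrib) auto

text \<open>The difference of the two equations factors as
  \<open>(a - b) * (1 - fps_X * (a + b)) = 0\<close>, and the second factor has constant term
  1.\<close>

lemma catalan_equation_unique:
  fixes a b :: "'a :: idom fps"
  assumes "a = 1 + fps_X * a ^ 2" "b = 1 + fps_X * b ^ 2"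
  shows "a = b"
proof -
  have "(a - b) * (1 - fps_X * (a + b)) = (a - fps_X * a ^ 2) - (b - fps_X * b ^ 2)"
    by (simp add: algebra_simps power2_eq_square)
  also have "\<dots> = 0" using assms by (metis add_diff_cancel_right' diff_self)
  finally have "a - b = 0 \<or> 1 - fps_X * (a + b) = 0" by simp
  moreover have "(1 - fps_X * (a + b)) $ 0 = 1" by simp
  hence "1 - fps_X * (a + b) \<noteq> 0" by (metis fps_zero_nth zero_neq_one)
  ultimately show ?thesis by simp
qed

text \<open>The right-hand side is the coefficient of degree \<open>n + 1\<close> in (1 - sqrt (1 -
  4 x)) / 2; both sides satisfy the recursion with ratio (4 n + 2) / (n + 2).\<close>

lemma catalan_fps_nth_gbinomial:
  "catalan_fps $ n = - (1 / 2) * ((- 4) ^ Suc n * ((1 / 2) gchoose Suc n))"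
proof (induction n)
  case 0
  show ?case by (simp add: catalan_fps_def)
next
  case (Suc n)
  have gb: "((1 / 2 :: rat) gchoose Suc (Suc n)) = ((1 / 2) gchoose Suc n) * (1 / 2 - of_nat (Suc n)) / of_nat (Suc (Suc n))"
    by (simp add: gbinomial_prod_rev field_simps del: of_nat_Suc)
  have "catalan_fps $ Suc n = catalan_fps $ n * (4 * of_nat n + 2) / of_nat (n + 2)"
  proof -
    have f: "fact (2 * Suc n) = (fact (2 * n) :: rat) * (2 * of_nat n + 1) * (2 * of_nat n + 2)"
      by (simp add: algebra_simps)
    have b: "of_nat ((2 * m) choose m) = (fact (2 * m) / (fact m * fact m) :: rat)" for m
      using binomial_fact[of m "2 * m", where ?'a = rat] by (simp add: mult_2)
    have "fact (Suc n) = (of_nat n + 1) * (fact n :: rat)" by (simp add: algebra_simps)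
    thus ?thesis unfolding catalan_fps_def fps_nth_Abs_fps b f
      by (simp add: divide_simps) (simp add: algebra_simps)
  qed
  also have "\<dots> = - (1 / 2) * ((- 4) ^ Suc (Suc n) * ((1 / 2) gchoose Suc (Suc n)))"
    unfolding Suc gb by (simp add: field_simps)
  finally show ?case .
qed

text \<open>The series \<open>s\<close> is the square root of \<open>1 - 4 * fps_X\<close> and
  equals \<open>1 - 2 * fps_X * catalan_fps\<close>; squaring gives the equation up to the factor
  \<open>4 * fps_X\<close>.\<close>

lemma catalan_fps_equation: "catalan_fps = 1 + fps_X * catalan_fps ^ 2"
proof -
  define s :: "rat fps" where "s = fps_binomial (1 / 2) oo (fps_const (- 4) * fps_X)"
  have "s ^ 2 = (fps_binomial (1 / 2) * fps_binomial (1 / 2)) oo (fps_const (- 4) * fps_X)"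
    unfolding s_def by (subst fps_compose_mult_distrib) (simp_all add: power2_eq_square)
  also have "fps_binomial (1 / 2) * fps_binomial (1 / 2) = (1 + fps_X :: rat fps)"
    by (simp add: fps_binomial_1 flip: fps_binomial_add_mult)
  also have "(1 + fps_X) oo (fps_const (- 4) * fps_X) = (1 - 4 * fps_X :: rat fps)"
    by (simp add: fps_compose_add_distrib fps_numeral_fps_const flip: fps_const_neg)
  finally have s2: "s ^ 2 = 1 - 4 * fps_X" .
  have "s = 1 - 2 * fps_X * catalan_fps"
  proof (rule fps_ext)
    fix n show "s $ n = (1 - 2 * fps_X * catalan_fps) $ n"
    proof (cases n)
      case 0 thus ?thesis by (simp add: s_def mult.assoc)
    next
      case (Suc m)
      have "(2 * fps_X * catalan_fps) $ Suc m = 2 * catalan_fps $ m"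
        by (simp add: mult.assoc fps_numeral_fps_const)
      thus ?thesis using catalan_fps_nth_gbinomial[of m] Suc by (simp add: s_def)
    qed
  qed
  hence "(1 - 2 * fps_X * catalan_fps) ^ 2 = (1 - 4 * fps_X :: rat fps)" using s2 by simp
  hence "4 * fps_X * (1 + fps_X * catalan_fps ^ 2 - catalan_fps) = 0"
    by (simp add: algebra_simps power2_eq_square)
  hence "1 + fps_X * catalan_fps ^ 2 - catalan_fps = 0" by (metis fps_X_neq_zero mult_eq_0_iff zero_neq_numeral)
  thus ?thesis by simp
qed

lemma catalan_compose_equation:
  assumes "t $ 0 = 0"
  shows "catalan_fps oo t = 1 + t * (catalan_fps oo t) ^ 2"
  using assms by (subst catalan_fps_equation)
    (simp add: fps_compose_add_distrib fps_compose_mult_distrib fps_compose_power)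

lemma card_Av_catalan: "rat_of_nat (card (Av n)) = catalan_fps $ n"
proof -
  define a :: "rat fps" where "a = Abs_fps (\<lambda>n. of_nat (card (Av n)))"
  have "a = 1 + fps_X * a ^ 2"
  proof (rule fps_ext)
    fix n show "a $ n = (1 + fps_X * a ^ 2) $ n"
    proof (cases n)
      case 0 thus ?thesis by (simp add: a_def card_Av_0)
    next
      case (Suc m)
      have "(1 + fps_X * a ^ 2) $ Suc m = (a * a) $ m" by (simp add: power2_eq_square)
      also have "\<dots> = of_nat (card (Av (Suc m)))"
        by (simp add: a_def card_Av_Suc fps_mult_nth atLeast0AtMost)
      finally show ?thesis using Suc by (simp add: a_def)
    qed
  qed
  hence "a = catalan_fps" by (rule catalan_equation_unique[OF _ catalan_fps_equation])
  thus ?thesis by (metis a_def fps_nth_Abs_fps)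
qed

section \<open>The series of shells, involutions and rotations\<close>

definition cuts_fps :: "nat \<Rightarrow> rat fps" where
  "cuts_fps c = Abs_fps (\<lambda>n. of_nat (card (many_cuts c n)))"

abbreviation (input) shell_fps :: "rat fps" where
  "shell_fps \<equiv> fps_X ^ 3 * (catalan_fps oo fps_X ^ 3)"

text \<open>An indecomposable shape of size \<open>k\<close> occupies \<open>d\<close> blocks of
  length \<open>k\<close>: three blocks in a shell, two in an involution.\<close>

lemma sum_shift_catalan:
  fixes g :: "rat fps"
  assumes d: "1 \<le> d"
  shows "(fps_X ^ d * (catalan_fps oo fps_X ^ d) * g) $ n =
    (\<Sum>k | 1 \<le> k \<and> d * k \<le> n. of_nat (card (Av (k - 1))) * g $ (n - d * k))"
proof -
  have fin: "finite {k. d * k \<le> n}"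
    using d by (intro finite_subset[of "{k. d * k \<le> n}" "{..n}"]) (auto intro: order.trans[rotated])
  have "(fps_X ^ d * (catalan_fps oo fps_X ^ d) * g) $ n = (\<Sum>k | d * k \<le> n. (fps_X * catalan_fps) $ k * g $ (n - d * k))"
    by (simp add: fps_compose_X_power_mult_nth[OF d] flip: fps_X_mult_compose_X_power[OF d])
  also have "\<dots> = (\<Sum>k | 1 \<le> k \<and> d * k \<le> n. (fps_X * catalan_fps) $ k * g $ (n - d * k))"
    by (rule sum.mono_neutral_right[OF fin]) (auto simp: not_less_eq_eq)
  also have "\<dots> = (\<Sum>k | 1 \<le> k \<and> d * k \<le> n. of_nat (card (Av (k - 1))) * g $ (n - d * k))"
    by (rule sum.cong) (auto simp: card_Av_catalan)
  finally show ?thesis .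
qed

lemma cuts_fps_rec:
  assumes "1 \<le> c"
  shows "cuts_fps (c + 1) = cuts_fps (c + 2) + shell_fps * cuts_fps c"
proof (rule fps_ext)
  fix n
  show "cuts_fps (c + 1) $ n = (cuts_fps (c + 2) + shell_fps * cuts_fps c) $ n"
    using card_many_cuts[OF assms, of n] by (simp add: cuts_fps_def sum_shift_catalan)
qed

text \<open>
  The recurrence \<open>cuts_fps_rec\<close> has the characteristic roots \<open>l = shell_fps * C\<close> and \<open>1 - l = 1 / C\<close>.
  The second one does not contribute since \<open>cuts_fps c\<close> has no terms of degree below \<open>c - 1\<close>.
\<close>

lemma cuts_fps_2: "cuts_fps 2 = shell_fps * (catalan_fps oo shell_fps) * cuts_fps 1"
proof -
  define C where "C = catalan_fps oo shell_fps"
  define l where "l = shell_fps * C"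
  \<comment> \<open>Subtracting \<open>l\<close> times the previous term removes the root
    \<open>l\<close>, so \<open>D\<close> is geometric with ratio \<open>1 - l\<close>, the inverse
    of \<open>C\<close>.\<close>
  define D where "D c = cuts_fps (c + 1) - l * cuts_fps c" for c
  have C: "C = 1 + shell_fps * C ^ 2"
    unfolding C_def by (rule catalan_compose_equation) simp
  hence inv: "C * (1 - l) = 1" by (simp add: l_def algebra_simps power2_eq_square)
  have l: "l * (1 - l) = shell_fps"
  proof -
    have "l * (1 - l) = shell_fps * (C * (1 - l))" by (simp add: l_def)
    thus ?thesis using inv by simp
  qed
  have D_step: "D c = C * D (c + 1)" if "1 \<le> c" for c
  proof -
    have "D (c + 1) = cuts_fps (c + 1) - shell_fps * cuts_fps c - l * cuts_fps (c + 1)"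
      using cuts_fps_rec[OF that] by (simp add: D_def)
    also have "\<dots> = (1 - l) * cuts_fps (c + 1) - (l * (1 - l)) * cuts_fps c"
      by (simp only: l) (simp add: algebra_simps)
    also have "\<dots> = (1 - l) * D c"
      by (simp add: D_def algebra_simps)
    finally have "C * D (c + 1) = C * (1 - l) * D c" by (simp add: mult.assoc)
    thus ?thesis using inv by simp
  qed
  have D_power: "D 1 = C ^ m * D (m + 1)" for m
  proof (induction m)
    case (Suc m)
    thus ?case using D_step[of "m + 1"] by (simp add: ac_simps)
  qed simp
  have zero: "cuts_fps c $ n = 0" if "n + 1 < c" for c n
    using many_cuts_empty[OF that] by (simp add: cuts_fps_def)
  \<comment> \<open>\<open>D 1\<close> is a multiple of \<open>D (n + 2)\<close>, whose coefficients
    up to degree \<open>n\<close> vanish.\<close>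
  have "D 1 $ n = 0" for n
  proof -
    have "D (n + 2) $ i = 0" if "i \<le> n" for i
      using that by (simp add: D_def zero fps_mult_nth)
    thus ?thesis using D_power[of "n + 1"] by (simp add: fps_mult_nth)
  qed
  hence "D 1 = 0" by (simp add: fps_eq_iff)
  thus ?thesis by (simp add: D_def l_def C_def numeral_2_eq_2)
qed

definition Inv_fps :: "rat fps" where
  "Inv_fps = Abs_fps (\<lambda>n. of_nat (card (Inv n)))"

definition moved_fps :: "rat fps" where
  "moved_fps = Abs_fps (\<lambda>n. of_nat (card {p \<in> Inv n. p n \<noteq> n}))"

lemma moved_fps: "moved_fps = fps_X ^ 2 * (catalan_fps oo fps_X ^ 2) * Inv_fps"
  by (rule fps_ext) (simp add: moved_fps_def Inv_fps_def card_Inv_moved sum_shift_catalan)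

lemma Inv_fps_rec: "Inv_fps = 1 + fps_X * Inv_fps + moved_fps"
proof (rule fps_ext)
  fix n show "Inv_fps $ n = (1 + fps_X * Inv_fps + moved_fps) $ n"
  proof (cases n)
    case 0
    have "moved_fps $ 0 = 0" by (simp add: moved_fps)
    thus ?thesis using 0 by (simp add: Inv_fps_def card_Inv_0)
  next
    case (Suc m)
    have "Inv n = {p \<in> Inv n. p n = n} \<union> {p \<in> Inv n. p n \<noteq> n}" by blast
    hence "card (Inv n) = card {p \<in> Inv n. p n = n} + card {p \<in> Inv n. p n \<noteq> n}"
      using card_Un_disjoint[of "{p \<in> Inv n. p n = n}" "{p \<in> Inv n. p n \<noteq> n}"] finite_Inv[of n] by auto
    also have "{p \<in> Inv n. p n = n} = Inv m" using Inv_fix_last[of n] Suc by simp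
    finally show ?thesis using Suc by (simp add: Inv_fps_def moved_fps_def)
  qed
qed

definition rotations_fps :: "rat fps" where
  "rotations_fps = Abs_fps (\<lambda>n. of_nat (card (rotations n)))"

text \<open>If \<open>3 * k < n\<close>, the twist has size \<open>k\<close> and the remainder
  \<open>n - 3 * k\<close> is any positive number, counted by \<open>g1\<close>. If
  \<open>n < 3 * k\<close>, it has size \<open>h = n - 2 * k\<close> and
  \<open>n - 3 * h = 2 * (k - h)\<close> is any positive even number, counted by \<open>g2\<close>.
  Multiplying \<open>g1 + g2\<close> by \<open>1 - fps_X ^ 2\<close> leaves x (1 + x) + x^2 = x (1 +
  2 x).\<close>

lemma rotations_fps:
  "rotations_fps * (1 - fps_X ^ 2) = fps_X * (1 + 2 * fps_X) * ((catalan_fps oo fps_X ^ 3) - 1)"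
proof -
  define g1 :: "rat fps" where "g1 = Abs_fps (\<lambda>n. if 1 \<le> n then 1 else 0)"
  define g2 :: "rat fps" where "g2 = Abs_fps (\<lambda>n. if 2 \<le> n \<and> even n then 1 else 0)"
  have g1: "g1 = fps_X + fps_X * g1"
  proof (rule fps_ext)
    fix n show "g1 $ n = (fps_X + fps_X * g1) $ n"
      by (cases n) (auto simp: g1_def fps_X_nth)
  qed
  have g2: "g2 = fps_X ^ 2 + fps_X ^ 2 * g2"
  proof (rule fps_ext)
    fix n :: nat
    show "g2 $ n = (fps_X ^ 2 + fps_X ^ 2 * g2) $ n"
    proof (cases "n < 2")
      case True
      thus ?thesis by (auto simp: g2_def fps_X_power_mult_nth)
    next
      case False
      then obtain m where n: "n = m + 2" by (metis add.commute le_Suc_ex not_less)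
      have "2 \<le> m" if "even m" "m \<noteq> 0" using that by (cases m) (auto simp: Suc_le_eq dest: odd_pos)
      thus ?thesis by (auto simp: n g2_def fps_X_power_mult_nth)
    qed
  qed
  \<comment> \<open>Twists have size at least 1, so the constant term is removed.\<close>
  define f :: "rat fps" where "f = catalan_fps - 1"
  have f_nth: "f $ k = (if k = 0 then 0 else of_nat (card (Av k)))" for k
    by (simp add: f_def card_Av_catalan catalan_fps_def)
  have f3: "f oo fps_X ^ 3 = (catalan_fps oo fps_X ^ 3) - 1"
    by (simp add: f_def fps_compose_sub_distrib)
  have fin: "finite {k. 3 * k \<le> n}" for n :: nat by (rule finite_subset[of _ "{..n}"]) auto
  have split: "rotations_fps = (f oo fps_X ^ 3) * g1 + (f oo fps_X ^ 3) * g2"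
  proof (rule fps_ext)
    fix n :: nat
    let ?A = "{k. 1 \<le> k \<and> 3 * k < n}" and ?B = "{k. 2 * k < n \<and> n < 3 * k}"
    have finAB: "finite ?A" "finite ?B"
      by (rule finite_subset[of _ "{..n}"]; force)+
    have split: "{k. 1 \<le> k \<and> 2 * k < n \<and> n \<noteq> 3 * k} = ?A \<union> ?B" by auto
    have "rotations_fps $ n = (\<Sum>k\<in>?A \<union> ?B. of_nat (card (Av (min k (n - 2 * k)))))"
      unfolding split[symmetric] by (simp add: rotations_fps_def card_rotations)
    also have "\<dots> = (\<Sum>k\<in>?A. of_nat (card (Av (min k (n - 2 * k))))) + (\<Sum>k\<in>?B. of_nat (card (Av (min k (n - 2 * k)))))"
      by (rule sum.union_disjoint) (use finAB in auto)
    also have "(\<Sum>k\<in>?A. of_nat (card (Av (min k (n - 2 * k))))) = (\<Sum>k\<in>?A. f $ k * g1 $ (n - 3 * k))"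
      by (rule sum.cong) (auto simp: f_nth g1_def min_def)
    also have "\<dots> = ((f oo fps_X ^ 3) * g1) $ n"
      by (subst fps_compose_X_power_mult_nth, simp, rule sum.mono_neutral_left[OF fin])
        (auto simp: f_nth g1_def)
    also have "(\<Sum>k\<in>?B. of_nat (card (Av (min k (n - 2 * k))))) =
        (\<Sum>h | 1 \<le> h \<and> 3 * h + 2 \<le> n \<and> even (n - 3 * h). f $ h * g2 $ (n - 3 * h))"
    proof (rule sum.reindex_bij_witness[where i = "\<lambda>h. (n - h) div 2" and j = "\<lambda>k. n - 2 * k"])
      fix k assume k: "k \<in> ?B"
      define h where "h = n - 2 * k"
      define e where "e = k - h"
      have n: "n = 2 * k + h" "k = h + e" "1 \<le> h" "1 \<le> e" using k by (auto simp: h_def e_def)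
      have n3: "n - 3 * h = 2 * e" using n by linarith
      show "n - 2 * k \<in> {h. 1 \<le> h \<and> 3 * h + 2 \<le> n \<and> even (n - 3 * h)}"
        unfolding h_def[symmetric] mem_Collect_eq n3 using n by (intro conjI) (linarith, linarith, simp)
      show "(n - (n - 2 * k)) div 2 = k" using k by simp
      show "f $ (n - 2 * k) * g2 $ (n - 3 * (n - 2 * k)) = of_nat (card (Av (min k (n - 2 * k))))"
        unfolding h_def[symmetric] n3 using n by (simp add: f_nth g2_def min_def)
    next
      fix h assume h: "h \<in> {h. 1 \<le> h \<and> 3 * h + 2 \<le> n \<and> even (n - 3 * h)}"
      then obtain e where "n - 3 * h = 2 * e" by blast
      hence n: "n = 3 * h + 2 * e" "1 \<le> e" "1 \<le> h" using h by auto
      hence "(n - h) div 2 = h + e" by simp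
      thus "(n - h) div 2 \<in> ?B" "n - 2 * ((n - h) div 2) = h" using n by simp_all
    qed
    also have "\<dots> = ((f oo fps_X ^ 3) * g2) $ n"
      by (subst fps_compose_X_power_mult_nth, simp, rule sum.mono_neutral_left[OF fin])
        (auto simp: f_nth g2_def)
    finally show "rotations_fps $ n = ((f oo fps_X ^ 3) * g1 + (f oo fps_X ^ 3) * g2) $ n" by simp
  qed
  have "rotations_fps * (1 - fps_X ^ 2) =
      (f oo fps_X ^ 3) * ((g1 - fps_X * g1) * (1 + fps_X) + (g2 - fps_X ^ 2 * g2))"
    unfolding split by (simp add: algebra_simps power2_eq_square)
  also have "g1 - fps_X * g1 = fps_X" using g1 by (metis add_diff_cancel_right')
  also have "g2 - fps_X ^ 2 * g2 = fps_X ^ 2" using g2 by (metis add_diff_cancel_right')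
  finally show ?thesis unfolding f3 by (simp add: algebra_simps power2_eq_square)
qed

lemma Sav_132_nth: "Sav_132 $ n = of_nat (card (SAv n))"
  by (simp add: Sav_132_def num_strongly_avoiding_132_def SAv_def)

lemma Sav_132_cuts: "Sav_132 = cuts_fps 1"
  by (rule fps_ext) (simp only: Sav_132_nth cuts_fps_def many_cuts_1 fps_nth_Abs_fps)

lemma Sav_132_rec:
  "Sav_132 = 1 + fps_X * Sav_132 + moved_fps + 2 * (cuts_fps 2 + rotations_fps)"
proof (rule fps_ext)
  fix n show "Sav_132 $ n = (1 + fps_X * Sav_132 + moved_fps + 2 * (cuts_fps 2 + rotations_fps)) $ n"
  proof (cases n)
    case 0
    have "SAv 0 = {id}" using id_in_Av[of 0] SAv_permutes[of _ 0] by (auto simp: SAv_iff)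
    moreover have "moved_fps $ 0 = 0" by (simp add: moved_fps)
    moreover have "cuts_fps 2 $ 0 = 0" by (simp add: cuts_fps_def many_cuts_empty)
    moreover have "rotations_fps $ 0 = 0" by (simp add: rotations_fps_def card_rotations)
    ultimately show ?thesis using 0 by (simp add: Sav_132_nth)
  next
    case (Suc m)
    have "(2 * (cuts_fps 2 + rotations_fps)) $ n = 2 * of_nat (card (rising n))"
      by (simp add: fps_numeral_fps_const cuts_fps_def rotations_fps_def card_rising)
    thus ?thesis using card_SAv[of n] Suc by (simp add: Sav_132_nth moved_fps_def)
  qed
qed

theorem theorem1p2:
  fixes x :: "rat fps" and c :: "rat fps \<Rightarrow> rat fps"
  defines "x \<equiv> fps_X"
    and "c \<equiv> fps_compose catalan_fps"
  shows "Sav_132 =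
    c (x^3 * c (x^3)) / (2 - (1 + x) * c (x^3 * c (x^3))) *
    ((1 - x) / (1 - x - x^2 * c (x^2)) +
     2 * x * (1 + 2 * x) * (c (x^3) - 1) / (1 - x^2))"
proof -
  define t where "t = x ^ 3 * c (x ^ 3)"
  define C where "C = c t"
  define den where "den = 2 - (1 + x) * C"
  define A where "A = C / den"
  define Y where "Y = (1 - x) / (1 - x - x^2 * c (x^2)) + 2 * x * (1 + 2 * x) * (c (x^3) - 1) / (1 - x^2)"
  have C0: "C $ 0 = 1" by (simp add: C_def c_def catalan_fps_def)
  have C: "C = 1 + t * C ^ 2"
    unfolding C_def c_def by (rule catalan_compose_equation) (simp add: t_def x_def)
  have den0: "den $ 0 \<noteq> 0" using C0 by (simp add: den_def x_def)
  have A: "A * den = C" unfolding A_def using den0 by (simp add: fps_divide_unit mult.assoc inverse_mult_eq_1)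
  \<comment> \<open>The prefactor \<open>A\<close> of the theorem is thus the reciprocal of
    \<open>1 - x - 2 * (t * C)\<close>, the factor that arises from the recurrence for
    \<open>Sav_132\<close>.\<close>
  have den: "den = C * (1 - x - 2 * (t * C))"
  proof -
    have "C * (1 - x - 2 * (t * C)) = C - x * C - 2 * (t * C ^ 2)"
      by (simp add: algebra_simps power2_eq_square)
    also have "t * C ^ 2 = C - 1" using C by (metis add_diff_cancel_left')
    finally show ?thesis by (simp add: den_def algebra_simps)
  qed
  have "Inv_fps * (1 - x - x ^ 2 * c (x ^ 2)) = 1"
    using Inv_fps_rec moved_fps by (simp add: x_def c_def algebra_simps)
  hence "(1 - x) * Inv_fps * (1 - x - x ^ 2 * c (x ^ 2)) = 1 - x" by (simp add: mult.assoc)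
  moreover have "(1 - x - x ^ 2 * c (x ^ 2)) $ 0 \<noteq> 0" by (simp add: x_def)
  hence "1 - x - x ^ 2 * c (x ^ 2) \<noteq> 0" by (metis fps_zero_nth)
  ultimately have Y1: "(1 - x) / (1 - x - x ^ 2 * c (x ^ 2)) = (1 - x) * Inv_fps"
    by (metis nonzero_mult_div_cancel_right)
  have "2 * rotations_fps * (1 - x ^ 2) = 2 * x * (1 + 2 * x) * (c (x ^ 3) - 1)"
    using rotations_fps by (simp add: x_def c_def mult.assoc)
  moreover have "(1 - x ^ 2) $ 0 \<noteq> 0" by (simp add: x_def)
  hence "1 - x ^ 2 \<noteq> 0" by (metis fps_zero_nth)
  ultimately have Y2: "2 * x * (1 + 2 * x) * (c (x ^ 3) - 1) / (1 - x ^ 2) = 2 * rotations_fps"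
    by (metis nonzero_mult_div_cancel_right)
  have E2: "cuts_fps 2 = t * C * Sav_132"
    unfolding Sav_132_cuts C_def t_def x_def c_def by (rule cuts_fps_2)
  have "Inv_fps = 1 + x * Inv_fps + moved_fps" using Inv_fps_rec by (simp only: x_def)
  moreover have "Sav_132 = 1 + x * Sav_132 + moved_fps + 2 * (t * C * Sav_132 + rotations_fps)"
    using Sav_132_rec unfolding E2 by (simp only: x_def)
  \<comment> \<open>Eliminates \<open>moved_fps\<close> by
    \<open>1 + moved_fps = (1 - x) * Inv_fps\<close>.\<close>
  ultimately have "Sav_132 * (1 - x - 2 * (t * C)) = (1 - x) * Inv_fps + 2 * rotations_fps"
    by algebra
  hence S: "Sav_132 * (1 - x - 2 * (t * C)) = Y" unfolding Y_def Y1 Y2 .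
  \<comment> \<open>The extra factor \<open>C\<close> turns the bracket into \<open>den\<close>, so
    that \<open>A * den = C\<close> applies; \<open>C\<close> has constant term 1 and is cancelled
    afterwards.\<close>
  have "C * (A * Y) = A * (C * (1 - x - 2 * (t * C))) * Sav_132"
    by (simp add: S[symmetric] algebra_simps)
  also have "\<dots> = C * Sav_132" using A den by simp
  finally have "Sav_132 = A * Y" using C0 by (metis fps_zero_nth mult_left_cancel zero_neq_one)
  thus ?thesis by (simp add: A_def Y_def den_def C_def t_def)
qed

end
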